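(* Let $(X,\mathsf d,\mathsf m)$ be a metric space equipped with a Borel measure with $\mathsf m(X)<+\infty$, let $p\ge 2$, and assume that $H^{1,p}(X)$ is compactly embedded in $L^p(X,\mathsf m)$. For each integer $k\ge 1$ define $$\lambda_{k,p}:=\inf_{A\in\mathcal F_k}\ \sup_{f\in A} p\,\mathsf{Ch}_p(f),$$ where $\mathcal F_k$ is the set of all closed symmetric subsets $A\subset \mathrm S$ with $\gamma(A)\ge k$. Then, for each $k\geq 1$, if $\lambda_{k,p}$ is finite, it is an eigenvalue of the $p$-Laplacian $\Delta_p$. Moreover, if for some integers $k,\ell\ge 1$ $$\lambda:=\lambda_{k,p}=\lambda_{k+1,p}=\cdots=\lambda_{k+\ell-1,p}$$ is finite, then $\gamma(K_\lambda)\ge \ell$; in particular, if $\ell>1$, there exist infinitely many eigenfunctions for $\lambda$.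
   Context: $L^p(X,\mathsf m)$ is the real Lebesgue space and $\mathrm S:=\{f\in L^p(X,\mathsf m): \|f\|_{L^p}=1\}$; $q$ is the Hölder conjugate of $p$; $J_p(f):=|f|^{p-2}f\in L^q$. Cheeger energy. For a Lipschitz function $h:X\to\mathbb R$ put $|Dh|(x):=\limsup_{y\to x}|h(y)-h(x)|/\mathsf d(y,x)$ ($0$ at isolated points). A function $G\in L^p(X,\mathsf m)$ is a $p$-relaxed slope of $f\in L^p(X,\mathsf m)$ if there are $\tilde G\in L^p(X,\mathsf m)$ and Lipschitz functions $h_n\in L^p(X,\mathsf m)$ with $h_n\to f$ in $L^p$, $|Dh_n|\rightharpoonup\tilde G$ weakly in $L^p$ and $\tilde G\le G$ $\mathsf m$-a.e.; the $p$-minimal relaxed slope $|\mathrm Df|_*$ is the $p$-relaxed slope of minimal $L^p$-norm (it exists as soon as some $p$-relaxed slope exists). The $p$-Cheeger energy is $\mathsf{Ch}_p(f):=\frac1p\int_X|\mathrm Df|_*^p\,d\mathsf m$ if $|\mathrm Df|_*$ exists and $+\infty$ otherwise. $H^{1,p}(X):=\{f\in L^p:\mathsf{Ch}_p(f)<+\infty\}$. Compact embedding means: if $f_n\in L^p(X,\mathsf m)$ and $\sup_n(\|f_n\|_{L^p}+\mathsf{Ch}_p(f_n))<+\infty$, then some subsequence converges in $L^p$. $p$-Laplacian. $\partial\mathsf{Ch}_p(f)\subset L^q(X,\mathsf m)$ is the convex subdifferential of $\mathsf{Ch}_p$ on $L^p$. If it is nonempty, $\Delta_pf$ is the element of minimal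 $L^q$-norm in $-\partial\mathsf{Ch}_p(f)$. A real number $\lambda$ is an eigenvalue of $\Delta_p$ if there is $f\in H^{1,p}(X)\setminus\{0\}$ with $\Delta_pf=-\lambda J_p(f)$; such $f$ is an eigenfunction for $\lambda$. Krasnoselskii genus. For a nonempty closed symmetric ($A=-A$) subset $A$ of $L^p(X,\mathsf m)$, $\gamma(A):=\inf\{m\in\mathbb N:\text{there is an odd continuous map } h:A\to\mathbb R^m\setminus\{0\}\}$ (with $\gamma(A)=+\infty$ if there is no such $m$), and $\gamma(\emptyset):=0$. The infimum over an empty family is $+\infty$. The set $K_\lambda$. Put $M:=\lambda+1$, $L:=M+1$ and $\Phi(f):=\mathsf{Ch}_p(f)-\frac Lp\|f\|_{L^p}^p$ if $\|f\|_{L^p}\le1$ and $\mathsf{Ch}_p(f)\le\frac Mp$, $\Phi(f):=+\infty$ otherwise. The local slope is $|\partial\Phi|(f):=\limsup_{g\to f}\frac{(\Phi(f)-\Phi(g))^+}{\|g-f\|_{L^p}}$ if $\Phi(f)<+\infty$ and $+\infty$ otherwise. Then $K_\lambda:=\{f\in\mathrm S:\mathsf{Ch}_p(f)=\frac\lambda p,\ |\partial\Phi|(f)=0\}$. *)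

theory Defs
  imports "HOL-Analysis.Analysis"
begin

text \<open>
  A point of \<open>L\<^sup>p\<close> is represented by a function, and two functions that agree almost everywhere are
  the same point. All notions below are invariant under this identification: the topology is the
  one of the \<open>L\<^sup>p\<close> seminorm, so a closed set contains with a function all functions equal to it
  almost everywhere, and a continuous map into a Hausdorff space takes the same value on them.
  Only for counting points is the passage to equivalence classes (\<open>Lp_class\<close>) made explicit.
\<close>

definition Lp :: "'a measure \<Rightarrow> real \<Rightarrow> ('a \<Rightarrow> real) set" where
  "Lp M p = {f \<in> borel_measurable M. integrable M (\<lambda>x. \<bar>f x\<bar> powr p)}"

definition Lp_norm :: "'a measure \<Rightarrow> real \<Rightarrow> ('a \<Rightarrow> real) \<Rightarrow> real" where
  "Lp_norm M p f = (\<integral>x. \<bar>f x\<bar> powr p \<partial>M) powr (1 / p)"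

definition Lp_dist :: "'a measure \<Rightarrow> real \<Rightarrow> ('a \<Rightarrow> real) \<Rightarrow> ('a \<Rightarrow> real) \<Rightarrow> real" where
  "Lp_dist M p f g = Lp_norm M p (\<lambda>x. f x - g x)"

definition Lp_class :: "'a measure \<Rightarrow> real \<Rightarrow> ('a \<Rightarrow> real) \<Rightarrow> ('a \<Rightarrow> real) set" where
  "Lp_class M p f = {g \<in> Lp M p. AE x in M. g x = f x}"

definition Lp_sphere :: "'a measure \<Rightarrow> real \<Rightarrow> ('a \<Rightarrow> real) set" where
  "Lp_sphere M p = {f \<in> Lp M p. Lp_norm M p f = 1}"

definition Lp_topology :: "'a measure \<Rightarrow> real \<Rightarrow> ('a \<Rightarrow> real) topology" where
  "Lp_topology M p =
     topology (\<lambda>U. U \<subseteq> Lp M p \<and>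
       (\<forall>f\<in>U. \<exists>e>0. \<forall>g\<in>Lp M p. Lp_dist M p g f < e \<longrightarrow> g \<in> U))"

lemma openin_Lp_topology:
  "openin (Lp_topology M p) U \<longleftrightarrow>
     U \<subseteq> Lp M p \<and> (\<forall>f\<in>U. \<exists>e>0. \<forall>g\<in>Lp M p. Lp_dist M p g f < e \<longrightarrow> g \<in> U)"
proof -
  let ?P = "\<lambda>U. U \<subseteq> Lp M p \<and>
       (\<forall>f\<in>U. \<exists>e>0. \<forall>g\<in>Lp M p. Lp_dist M p g f < e \<longrightarrow> g \<in> U)"
  have "?P (S \<inter> T)" if S: "?P S" and T: "?P T" for S T
  proof (intro conjI ballI)
    show "S \<inter> T \<subseteq> Lp M p" using S by blast
    fix f assume f: "f \<in> S \<inter> T"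
    obtain a where a: "a > 0" "\<forall>g\<in>Lp M p. Lp_dist M p g f < a \<longrightarrow> g \<in> S" using f S by blast
    obtain b where b: "b > 0" "\<forall>g\<in>Lp M p. Lp_dist M p g f < b \<longrightarrow> g \<in> T" using f T by blast
    show "\<exists>e>0. \<forall>g\<in>Lp M p. Lp_dist M p g f < e \<longrightarrow> g \<in> S \<inter> T"
      using a b by (intro exI[of _ "min a b"]) auto
  qed
  moreover have "?P (\<Union>\<K>)" if "\<forall>K\<in>\<K>. ?P K" for \<K>
    using that by (meson Sup_least UnionE UnionI)
  ultimately have "istopology ?P"
    unfolding istopology_def by blast
  then show ?thesis
    unfolding Lp_topology_def by (simp add: topology_inverse')
qed

lemma topspace_Lp_topology: "topspace (Lp_topology M p) = Lp M p"
proof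
  show "topspace (Lp_topology M p) \<subseteq> Lp M p"
    using openin_topspace[of "Lp_topology M p"] unfolding openin_Lp_topology by blast
  have "openin (Lp_topology M p) (Lp M p)"
    unfolding openin_Lp_topology by (auto intro: exI[of _ 1])
  then show "Lp M p \<subseteq> topspace (Lp_topology M p)" by (rule openin_subset)
qed

definition Lp_converges :: "'a measure \<Rightarrow> real \<Rightarrow> (nat \<Rightarrow> 'a \<Rightarrow> real) \<Rightarrow> ('a \<Rightarrow> real) \<Rightarrow> bool" where
  "Lp_converges M p u f \<longleftrightarrow>
     (\<forall>n. u n \<in> Lp M p) \<and> f \<in> Lp M p \<and> (\<lambda>n. Lp_dist M p (u n) f) \<longlonglongrightarrow> 0"

definition hoelder_conjugate :: "real \<Rightarrow> real" where
  "hoelder_conjugate p = p / (p - 1)"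

text \<open>Weak convergence in \<open>L\<^sup>p\<close>, where the dual of \<open>L\<^sup>p\<close> is \<open>L\<^sup>q\<close> acting by integration.\<close>

definition Lp_converges_weakly ::
    "'a measure \<Rightarrow> real \<Rightarrow> (nat \<Rightarrow> 'a \<Rightarrow> real) \<Rightarrow> ('a \<Rightarrow> real) \<Rightarrow> bool" where
  "Lp_converges_weakly M p u f \<longleftrightarrow>
     (\<forall>n. u n \<in> Lp M p) \<and> f \<in> Lp M p \<and>
     (\<forall>v\<in>Lp M (hoelder_conjugate p).
        (\<lambda>n. \<integral>x. u n x * v x \<partial>M) \<longlonglongrightarrow> (\<integral>x. f x * v x \<partial>M))"

definition duality_map :: "real \<Rightarrow> ('a \<Rightarrow> real) \<Rightarrow> 'a \<Rightarrow> real" where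
  "duality_map p f = (\<lambda>x. \<bar>f x\<bar> powr (p - 2) * f x)"

text \<open>For Lipschitz \<open>h\<close> the upper limit below is finite.\<close>

definition local_lip :: "('a::metric_space \<Rightarrow> real) \<Rightarrow> 'a \<Rightarrow> real" where
  "local_lip h x =
     (if x islimpt UNIV
      then real_of_ereal (Limsup (at x) (\<lambda>y. ereal (\<bar>h y - h x\<bar> / dist y x)))
      else 0)"

definition relaxed_slope ::
    "'a::metric_space measure \<Rightarrow> real \<Rightarrow> ('a \<Rightarrow> real) \<Rightarrow> ('a \<Rightarrow> real) \<Rightarrow> bool" where
  "relaxed_slope M p f G \<longleftrightarrow>
     f \<in> Lp M p \<and> G \<in> Lp M p \<and>
     (\<exists>G' h. (\<forall>n::nat. \<exists>C. C-lipschitz_on UNIV (h n)) \<and>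
        Lp_converges M p h f \<and>
        Lp_converges_weakly M p (\<lambda>n. local_lip (h n)) G' \<and>
        (AE x in M. G' x \<le> G x))"

definition minimal_relaxed_slope ::
    "'a::metric_space measure \<Rightarrow> real \<Rightarrow> ('a \<Rightarrow> real) \<Rightarrow> ('a \<Rightarrow> real) \<Rightarrow> bool" where
  "minimal_relaxed_slope M p f G \<longleftrightarrow>
     relaxed_slope M p f G \<and>
     (\<forall>G'. relaxed_slope M p f G' \<longrightarrow> Lp_norm M p G \<le> Lp_norm M p G')"

text \<open>The minimal relaxed slope is unique and nonnegative almost everywhere, so the choice made by
  \<open>SOME\<close> does not matter.\<close>

definition cheeger :: "'a::metric_space measure \<Rightarrow> real \<Rightarrow> ('a \<Rightarrow> real) \<Rightarrow> ereal" where
  "cheeger M p f =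
     (if \<exists>G. minimal_relaxed_slope M p f G
      then ereal (1 / p * (\<integral>x. (SOME G. minimal_relaxed_slope M p f G) x powr p \<partial>M))
      else \<infinity>)"

definition sobolev :: "'a::metric_space measure \<Rightarrow> real \<Rightarrow> ('a \<Rightarrow> real) set" where
  "sobolev M p = {f \<in> Lp M p. cheeger M p f < \<infinity>}"

definition compactly_embedded :: "'a::metric_space measure \<Rightarrow> real \<Rightarrow> bool" where
  "compactly_embedded M p \<longleftrightarrow>
     (\<forall>u. (\<forall>n::nat. u n \<in> Lp M p) \<and>
          (SUP n. ereal (Lp_norm M p (u n)) + cheeger M p (u n)) < \<infinity> \<longrightarrow>
        (\<exists>r f. strict_mono (r :: nat \<Rightarrow> nat) \<and> Lp_converges M p (u \<circ> r) f))"

definition cheeger_subdifferential ::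
    "'a::metric_space measure \<Rightarrow> real \<Rightarrow> ('a \<Rightarrow> real) \<Rightarrow> ('a \<Rightarrow> real) set" where
  "cheeger_subdifferential M p f =
     {v \<in> Lp M (hoelder_conjugate p). f \<in> sobolev M p \<and>
        (\<forall>g\<in>Lp M p. cheeger M p f + ereal (\<integral>x. v x * (g x - f x) \<partial>M) \<le> cheeger M p g)}"

text \<open>\<open>is_p_laplacian M p f w\<close> says that the subdifferential at \<open>f\<close> is nonempty and that \<open>w\<close>
  represents \<open>\<Delta>\<^sub>p f\<close>, which is unique up to equality almost everywhere.\<close>

definition is_p_laplacian ::
    "'a::metric_space measure \<Rightarrow> real \<Rightarrow> ('a \<Rightarrow> real) \<Rightarrow> ('a \<Rightarrow> real) \<Rightarrow> bool" where
  "is_p_laplacian M p f w \<longleftrightarrow>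
     (\<lambda>x. - w x) \<in> cheeger_subdifferential M p f \<and>
     (\<forall>v\<in>cheeger_subdifferential M p f.
        Lp_norm M (hoelder_conjugate p) w \<le> Lp_norm M (hoelder_conjugate p) (\<lambda>x. - v x))"

definition eigenfunction ::
    "'a::metric_space measure \<Rightarrow> real \<Rightarrow> real \<Rightarrow> ('a \<Rightarrow> real) \<Rightarrow> bool" where
  "eigenfunction M p l f \<longleftrightarrow>
     f \<in> sobolev M p \<and> \<not> (AE x in M. f x = 0) \<and>
     (\<exists>w. is_p_laplacian M p f w \<and> (AE x in M. w x = - l * duality_map p f x))"

definition eigenvalue :: "'a::metric_space measure \<Rightarrow> real \<Rightarrow> real \<Rightarrow> bool" where
  "eigenvalue M p l \<longleftrightarrow> (\<exists>f. eigenfunction M p l f)"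

definition fun_symmetric :: "('a \<Rightarrow> real) set \<Rightarrow> bool" where
  "fun_symmetric A \<longleftrightarrow> (\<lambda>f x. - f x) ` A = A"

definition odd_map_to_punctured ::
    "'a measure \<Rightarrow> real \<Rightarrow> ('a \<Rightarrow> real) set \<Rightarrow> nat \<Rightarrow> (('a \<Rightarrow> real) \<Rightarrow> nat \<Rightarrow> real) \<Rightarrow> bool" where
  "odd_map_to_punctured M p A m h \<longleftrightarrow>
     continuous_map (subtopology (Lp_topology M p) A)
       (subtopology (Euclidean_space m) (- {\<lambda>i. 0})) h \<and>
     (\<forall>f\<in>A. h (\<lambda>x. - f x) = (\<lambda>i. - h f i))"

text \<open>Only meaningful for closed symmetric \<open>A\<close>.\<close>

definition genus :: "'a measure \<Rightarrow> real \<Rightarrow> ('a \<Rightarrow> real) set \<Rightarrow> enat" where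
  "genus M p A =
     (if A = {} then 0 else Inf {enat m | m. \<exists>h. odd_map_to_punctured M p A m h})"

definition genus_family :: "'a measure \<Rightarrow> real \<Rightarrow> nat \<Rightarrow> ('a \<Rightarrow> real) set set" where
  "genus_family M p k =
     {A. closedin (Lp_topology M p) A \<and> fun_symmetric A \<and> A \<subseteq> Lp_sphere M p \<and>
         enat k \<le> genus M p A}"

definition minmax_level :: "'a::metric_space measure \<Rightarrow> real \<Rightarrow> nat \<Rightarrow> ereal" where
  "minmax_level M p k = (INF A\<in>genus_family M p k. SUP f\<in>A. ereal p * cheeger M p f)"

text \<open>The descending slope of a functional on \<open>L\<^sup>p\<close>; the upper limit is over \<open>g \<rightarrow> f\<close>, \<open>g \<noteq> f\<close> in \<open>L\<^sup>p\<close>.\<close>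

definition Lp_at :: "'a measure \<Rightarrow> real \<Rightarrow> ('a \<Rightarrow> real) \<Rightarrow> ('a \<Rightarrow> real) filter" where
  "Lp_at M p f =
     (INF e\<in>{0<..}. principal {g \<in> Lp M p. 0 < Lp_dist M p g f \<and> Lp_dist M p g f < e})"

definition descending_slope ::
    "'a measure \<Rightarrow> real \<Rightarrow> (('a \<Rightarrow> real) \<Rightarrow> ereal) \<Rightarrow> ('a \<Rightarrow> real) \<Rightarrow> ereal" where
  "descending_slope M p F f =
     (if F f < \<infinity>
      then Limsup (Lp_at M p f) (\<lambda>g. max 0 (F f - F g) / ereal (Lp_dist M p g f))
      else \<infinity>)"

definition Phi :: "'a::metric_space measure \<Rightarrow> real \<Rightarrow> real \<Rightarrow> ('a \<Rightarrow> real) \<Rightarrow> ereal" where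
  "Phi M p l f =
     (let B = l + 1; L = B + 1 in
      if Lp_norm M p f \<le> 1 \<and> cheeger M p f \<le> ereal (B / p)
      then cheeger M p f - ereal (L / p * Lp_norm M p f powr p)
      else \<infinity>)"

definition critical_set :: "'a::metric_space measure \<Rightarrow> real \<Rightarrow> real \<Rightarrow> ('a \<Rightarrow> real) set" where
  "critical_set M p l =
     {f \<in> Lp_sphere M p. cheeger M p f = ereal (l / p) \<and> descending_slope M p (Phi M p l) f = 0}"

end

theory Submission
  imports Defs
begin

text \<open>
  The energy is \<open>I\<^sup>p / p\<close> for a lower semicontinuous extended seminorm \<open>I\<close> on \<open>L\<^sup>p\<close> (\<open>slope\<close> below), the
  relaxation of \<open>h \<mapsto> \<parallel>|Dh|\<parallel>\<close>. By uniform convexity (Clarkson's inequality) minimizing sequences of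
  slopes converge strongly, which makes weak compactness unnecessary.

  Instead of a descending flow one uses the proximal map \<open>P f = argmin\<^sub>g I(g)\<^sup>p + \<parallel>g - f\<parallel>\<^sup>p\<close>. It is odd and
  continuous, \<open>I \<circ> P\<close> is continuous as well, and comparing \<open>P f\<close> with \<open>\<parallel>P f\<parallel> f\<close> gives
  \<open>I(P f) \<le> \<parallel>P f\<parallel> I(f)\<close> on the unit sphere, with equality exactly at the \<open>f\<close> such that
  \<open>I(g) \<ge> I(f) \<langle>J f, g\<rangle>\<close> for all \<open>g\<close>. These \<open>f\<close> have zero slope and are eigenfunctions. By compactness
  the normalized map \<open>P f / \<parallel>P f\<parallel>\<close> lowers the level by a fixed amount on a sublevel set slightly above a
  critical level \<open>c\<close> and away from the critical set \<open>K\<close>. If \<open>K\<close> had genus less than \<open>\<ell>\<close>, extending an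
  odd map on \<open>K\<close> and an odd map on the image of the complement by Tietze's theorem and combining the two
  would bound the genus of an almost optimal set for level \<open>k + \<ell> - 1\<close> by \<open>k + \<ell> - 2\<close>.
\<close>

section \<open>Real inequalities\<close>

text \<open>The obstacle is that I is only lower semicontinuous, so a condition such as I(f) = c
  does not survive L^p convergence. Along proximal points the missing upper bound is available: the
  minimal energy does not jump up and the distance term converges, hence the slopes cannot jump up
  either. Criticality is therefore tested by I(P f) >= c norm(P f), which is a closed condition. The
  distance enters with the power p because Clarkson's inequality for p >= 2 then makes the energy
  uniformly convex, and because J is, up to the factor p, the gradient of that power.

  No neighbourhood of K is removed. An odd map on K is extended to the whole space; its zero set is
  closed and disjoint from K and takes over the role of the complement. The genus bound is proved
  for the f satisfying the variational inequality with c = \<lambda>^(1/p), and reaches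
  \<open>critical_set\<close> by inclusion.

  Functions equal almost everywhere are distinct points here, so L^p is a pseudometric space, P f is
  determined up to null sets only, and images under P must be saturated under null
  modifications.\<close>

lemma weighted_Young:
  fixes u w t :: real
  assumes "0 \<le> u" "0 \<le> w" "0 \<le> t" "t \<le> 1"
  shows "u powr t * w powr (1 - t) \<le> t * u + (1 - t) * w"
proof (cases "u = 0 \<or> w = 0")
  case True
  \<comment> \<open>The product vanishes even for a zero exponent, since
    \<open>0 powr 0 = 0\<close>.\<close>
  then show ?thesis using assms by auto
next
  case False
  then show ?thesis using Youngs_inequality_0[of t "1 - t" u w] assms by auto
qed

text \<open>Weighted Young for \<open>x powr r\<close> and \<open>y powr r\<close> with weight 1 -
  1/r. This is the tangent inequality of z^r at x in a form that covers the endpoint 0 without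
  differentiation.\<close>

lemma powr_tangent_le:
  fixes x y r :: real
  assumes "0 \<le> x" "0 \<le> y" "1 \<le> r"
  shows "x powr r - y powr r \<le> r * x powr (r - 1) * (x - y)"
proof -
  have "(x powr r) powr (1 - 1 / r) * (y powr r) powr (1 - (1 - 1 / r))
      \<le> (1 - 1 / r) * x powr r + (1 - (1 - 1 / r)) * y powr r"
    using assms by (intro weighted_Young) auto
  moreover have "r * (1 - 1 / r) = r - 1" using assms by (simp add: field_simps)
  moreover have "r * (1 - (1 - 1 / r)) = 1" using assms by (simp add: field_simps)
  ultimately have "x powr (r - 1) * y \<le> (1 - 1 / r) * x powr r + (1 / r) * y powr r"
    using assms by (simp add: powr_powr)
  then have "r * (x powr (r - 1) * y) \<le> r * ((1 - 1 / r) * x powr r + (1 / r) * y powr r)"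
    using assms by (intro mult_left_mono) auto
  also have "\<dots> = (r - 1) * x powr r + y powr r"
    using assms by (simp add: field_simps)
  finally have 1: "r * x powr (r - 1) * y \<le> (r - 1) * x powr r + y powr r" by (simp add: mult.assoc)
  have 2: "x powr (r - 1) * x = x powr r"
    using assms by (cases "x = 0") (auto simp: powr_diff)
  have "r * x powr (r - 1) * (x - y) = r * (x powr (r - 1) * x) - r * x powr (r - 1) * y"
    by (simp add: algebra_simps)
  also have "\<dots> = r * x powr r - r * x powr (r - 1) * y" by (simp only: 2)
  finally have "r * x powr (r - 1) * (x - y) = r * x powr r - r * x powr (r - 1) * y" .
  moreover have "(r - 1) * x powr r = r * x powr r - x powr r" by (simp add: algebra_simps)
  ultimately show ?thesis using 1 by linarith
qed

text \<open>Both tangents are taken at the combination itself; their weighted sum has no linear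
  part.\<close>

lemma powr_convex_comb:
  fixes x y r t :: real
  assumes "0 \<le> x" "0 \<le> y" "1 \<le> r" "0 \<le> t" "t \<le> 1"
  shows "(t * x + (1 - t) * y) powr r \<le> t * x powr r + (1 - t) * y powr r"
proof -
  define z where "z = t * x + (1 - t) * y"
  have z: "0 \<le> z" using assms by (simp add: z_def)
  have "t * (z powr r - x powr r) \<le> t * (r * z powr (r - 1) * (z - x))"
    using powr_tangent_le[of z x r] z assms by (intro mult_left_mono) auto
  moreover have "(1 - t) * (z powr r - y powr r) \<le> (1 - t) * (r * z powr (r - 1) * (z - y))"
    using powr_tangent_le[of z y r] z assms by (intro mult_left_mono) auto
  moreover have "t * (r * z powr (r - 1) * (z - x)) + (1 - t) * (r * z powr (r - 1) * (z - y))
      = r * z powr (r - 1) * (z - (t * x + (1 - t) * y))"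
    by (simp add: algebra_simps)
  ultimately show ?thesis unfolding z_def[symmetric] by (simp add: algebra_simps)
qed

lemma powr_superadditive:
  fixes x y r :: real
  assumes "0 \<le> x" "0 \<le> y" "1 \<le> r"
  shows "x powr r + y powr r \<le> (x + y) powr r"
proof -
  have *: "z powr r = z * z powr (r - 1)" if "0 \<le> z" for z :: real
    using that by (cases "z = 0") (auto simp: powr_diff)
  have "x * x powr (r - 1) \<le> x * (x + y) powr (r - 1)" "y * y powr (r - 1) \<le> y * (x + y) powr (r - 1)"
    using assms by (auto intro!: mult_left_mono powr_mono2)
  then have "x powr r + y powr r \<le> (x + y) * (x + y) powr (r - 1)"
    using assms by (simp add: * algebra_simps)
  then show ?thesis using assms by (simp add: *[symmetric])
qed

text \<open>For p >= 2 the function z^(p/2) is superadditive and convex on z >= 0; the parallelogram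
  identity for the squares joins the two properties.\<close>

lemma Clarkson_real:
  fixes a b p :: real
  assumes "2 \<le> p"
  shows "\<bar>(a + b) / 2\<bar> powr p + \<bar>(a - b) / 2\<bar> powr p \<le> (\<bar>a\<bar> powr p + \<bar>b\<bar> powr p) / 2"
proof -
  have sq: "\<bar>x\<bar> powr p = (x\<^sup>2) powr (p / 2)" for x :: real
  proof (cases "x = 0")
    case False
    then have "(x\<^sup>2) powr (p / 2) = (\<bar>x\<bar> powr 2) powr (p / 2)" by simp
    then show ?thesis by (simp only: powr_powr) simp
  qed simp
  have "((a + b) / 2)\<^sup>2 powr (p / 2) + ((a - b) / 2)\<^sup>2 powr (p / 2)
      \<le> (((a + b) / 2)\<^sup>2 + ((a - b) / 2)\<^sup>2) powr (p / 2)"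
    using assms by (intro powr_superadditive) auto
  also have "((a + b) / 2)\<^sup>2 + ((a - b) / 2)\<^sup>2 = 1 / 2 * a\<^sup>2 + (1 - 1 / 2) * b\<^sup>2"
    by (simp add: power2_eq_square field_simps)
  also have "(1 / 2 * a\<^sup>2 + (1 - 1 / 2) * b\<^sup>2) powr (p / 2) \<le> 1 / 2 * a\<^sup>2 powr (p / 2) + (1 - 1 / 2) * b\<^sup>2 powr (p / 2)"
    using assms by (intro powr_convex_comb) auto
  finally show ?thesis unfolding sq by simp
qed

section \<open>Pointwise estimates for the duality map\<close>

lemma abs_duality_map: "\<bar>duality_map p f x\<bar> = \<bar>f x\<bar> powr (p - 1)"
proof (cases "f x = 0")
  case False
  then have "\<bar>f x\<bar> powr (p - 2) * \<bar>f x\<bar> powr 1 = \<bar>f x\<bar> powr (p - 1)"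
    by (subst powr_add[symmetric]) simp
  then show ?thesis by (simp add: duality_map_def abs_mult)
qed (simp add: duality_map_def)

lemma duality_map_mult_self: "duality_map p f x * f x = \<bar>f x\<bar> powr p"
proof (cases "f x = 0")
  case False
  then have "\<bar>f x\<bar> powr (p - 2) * \<bar>f x\<bar> powr 2 = \<bar>f x\<bar> powr p"
    by (subst powr_add[symmetric]) simp
  then show ?thesis by (simp add: duality_map_def power2_eq_square mult.assoc)
qed (simp add: duality_map_def)

text \<open>For arguments of one sign the tangent inequality replaces the mean value theorem; for
  opposite signs crude bounds suffice because p - 1 >= 1.\<close>

lemma abs_powr_duality_diff:
  fixes x y s p :: real
  assumes p: "2 \<le> p" and "\<bar>x\<bar> \<le> s" "\<bar>y\<bar> \<le> s"
  shows "\<bar>\<bar>x\<bar> powr (p - 2) * x - \<bar>y\<bar> powr (p - 2) * y\<bar> \<le> (p - 1) * s powr (p - 2) * \<bar>x - y\<bar>"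
proof -
  have J: "\<bar>z\<bar> powr (p - 2) * z = z powr (p - 1)" if "0 \<le> z" for z :: real
    using that by (cases "z = 0") (auto simp: powr_diff powr_numeral power2_eq_square)
  have mono: "(p - 1) * u powr (p - 2) * d \<le> (p - 1) * s powr (p - 2) * d"
    if "0 \<le> u" "u \<le> s" "0 \<le> d" for u d
    using that p by (intro mult_right_mono mult_left_mono powr_mono2) auto
  have pos: "\<bar>\<bar>u\<bar> powr (p - 2) * u - \<bar>v\<bar> powr (p - 2) * v\<bar> \<le> (p - 1) * s powr (p - 2) * \<bar>u - v\<bar>"
    if "0 \<le> v" "v \<le> u" "u \<le> s" for u v
  proof -
    have "u powr (p - 1) - v powr (p - 1) \<le> (p - 1) * u powr (p - 1 - 1) * (u - v)"
      using that p by (intro powr_tangent_le) auto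
    also have "\<dots> \<le> (p - 1) * s powr (p - 2) * (u - v)" using mono[of u "u - v"] that by simp
    finally have "u powr (p - 1) - v powr (p - 1) \<le> (p - 1) * s powr (p - 2) * (u - v)" .
    moreover have "v powr (p - 1) \<le> u powr (p - 1)" using that p by (intro powr_mono2) auto
    ultimately show ?thesis using that J[of u] J[of v] by simp
  qed
  have neg: "\<bar>\<bar>u\<bar> powr (p - 2) * u - \<bar>v\<bar> powr (p - 2) * v\<bar> \<le> (p - 1) * s powr (p - 2) * \<bar>u - v\<bar>"
    if "v \<le> 0" "0 \<le> u" "u \<le> s" "- s \<le> v" for u v
  proof -
    have 0: "0 \<le> s powr (p - 2) * (u - v)" using that by simp
    have "\<bar>u\<bar> powr (p - 2) * u - \<bar>v\<bar> powr (p - 2) * v = u powr (p - 2) * u + (- v) powr (p - 2) * (- v)"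
      using that by simp
    also have "\<dots> \<le> s powr (p - 2) * u + s powr (p - 2) * (- v)"
      using that p by (intro add_mono mult_right_mono powr_mono2) auto
    also have "\<dots> = 1 * (s powr (p - 2) * (u - v))" by (simp add: algebra_simps)
    also have "\<dots> \<le> (p - 1) * (s powr (p - 2) * (u - v))" using 0 p by (intro mult_right_mono) auto
    finally have "\<bar>u\<bar> powr (p - 2) * u - \<bar>v\<bar> powr (p - 2) * v \<le> (p - 1) * s powr (p - 2) * \<bar>u - v\<bar>"
      using that by (simp add: mult.assoc)
    moreover have "0 \<le> \<bar>u\<bar> powr (p - 2) * u - \<bar>v\<bar> powr (p - 2) * v"
      using mult_nonneg_nonpos[of "\<bar>v\<bar> powr (p - 2)" v] mult_nonneg_nonneg[of "\<bar>u\<bar> powr (p - 2)" u] that(1,2)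
      by (metis diff_ge_0_iff_ge order_trans powr_ge_zero)
    ultimately show ?thesis by simp
  qed
  consider "0 \<le> y" "y \<le> x" | "0 \<le> x" "x \<le> y" | "x \<le> 0" "y \<le> x" | "y \<le> 0" "x \<le> y"
    | "y \<le> 0" "0 \<le> x" | "x \<le> 0" "0 \<le> y" by linarith
  then show ?thesis
  proof cases
    case 1 then show ?thesis using pos[of y x] assms by auto
  next
    case 2 then show ?thesis using pos[of x y] assms by (auto simp: abs_minus_commute)
  next
    case 3 then show ?thesis using pos[of "-x" "-y"] assms by auto
  next
    case 4 then show ?thesis using pos[of "-y" "-x"] assms by (auto simp: abs_minus_commute)
  next
    case 5 then show ?thesis using neg[of y x] assms by auto
  next
    case 6 then show ?thesis using neg[of x y] assms by (auto simp: abs_minus_commute)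
  qed
qed

lemma abs_powr_tangent_le:
  fixes a b p :: real
  assumes "1 \<le> p"
  shows "\<bar>a\<bar> powr p - \<bar>b\<bar> powr p \<le> p * (\<bar>a\<bar> powr (p - 2) * a) * (a - b)"
proof -
  have "\<bar>a\<bar> powr p - \<bar>b\<bar> powr p \<le> p * \<bar>a\<bar> powr (p - 1) * (\<bar>a\<bar> - \<bar>b\<bar>)"
    using assms by (intro powr_tangent_le) auto
  also have "\<bar>a\<bar> powr (p - 1) = \<bar>a\<bar> powr (p - 2) * \<bar>a\<bar>"
    using abs_duality_map[of p "\<lambda>_. a" undefined] by (simp add: duality_map_def abs_mult)
  also have "p * (\<bar>a\<bar> powr (p - 2) * \<bar>a\<bar>) * (\<bar>a\<bar> - \<bar>b\<bar>) = p * \<bar>a\<bar> powr (p - 2) * (a * a - \<bar>a\<bar> * \<bar>b\<bar>)"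
    by (simp add: algebra_simps abs_mult_self_eq)
  also have "\<dots> \<le> p * \<bar>a\<bar> powr (p - 2) * (a * a - a * b)"
    using assms by (intro mult_left_mono) (auto simp: abs_mult[symmetric])
  finally show ?thesis by (simp add: algebra_simps)
qed

text \<open>The tangent is taken at a + b and not at a, which makes it an upper bound; replacing the
  gradient at a + b by the one at a costs the last term.\<close>

lemma abs_powr_expansion:
  fixes a b p :: real
  assumes p: "2 \<le> p"
  shows "\<bar>a + b\<bar> powr p \<le> \<bar>a\<bar> powr p + p * (\<bar>a\<bar> powr (p - 2) * a) * b
            + p * (p - 1) * ((\<bar>a\<bar> + \<bar>b\<bar>) powr (p - 2) * b\<^sup>2)"
proof -
  let ?J = "\<lambda>x::real. \<bar>x\<bar> powr (p - 2) * x"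
  have "\<bar>a + b\<bar> powr p - \<bar>a\<bar> powr p \<le> p * ?J (a + b) * (a + b - a)"
    using p by (intro abs_powr_tangent_le) auto
  also have "\<dots> = p * ?J a * b + p * ((?J (a + b) - ?J a) * b)" by (simp add: algebra_simps)
  also have "(?J (a + b) - ?J a) * b \<le> \<bar>?J (a + b) - ?J a\<bar> * \<bar>b\<bar>"
    by (metis abs_ge_self abs_mult)
  also have "\<bar>?J (a + b) - ?J a\<bar> \<le> (p - 1) * (\<bar>a\<bar> + \<bar>b\<bar>) powr (p - 2) * \<bar>a + b - a\<bar>"
    using p by (intro abs_powr_duality_diff) auto
  finally have "\<bar>a + b\<bar> powr p - \<bar>a\<bar> powr p \<le> p * ?J a * b
     + p * ((p - 1) * (\<bar>a\<bar> + \<bar>b\<bar>) powr (p - 2) * \<bar>a + b - a\<bar> * \<bar>b\<bar>)"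
    using p by (simp add: mult_left_mono mult_right_mono)
  moreover have "(p - 1) * (\<bar>a\<bar> + \<bar>b\<bar>) powr (p - 2) * \<bar>a + b - a\<bar> * \<bar>b\<bar>
      = (p - 1) * ((\<bar>a\<bar> + \<bar>b\<bar>) powr (p - 2) * b\<^sup>2)"
    by (simp add: power2_eq_square mult.assoc)
  ultimately show ?thesis by (simp add: mult.assoc power2_eq_square)
qed

text \<open>Stands in for a one-sided derivative in first-order optimality conditions, where the
  objective is known only up to an error of order t^2.\<close>

lemma nonneg_of_quadratic_perturbation:
  fixes b C :: real
  assumes "\<And>t. 0 < t \<Longrightarrow> t \<le> 1 \<Longrightarrow> 0 \<le> t * b + t\<^sup>2 * C"
  shows "0 \<le> b"
proof (rule ccontr)
  assume "\<not> 0 \<le> b"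
  then have b: "b < 0" by simp
  \<comment> \<open>Small enough that the quadratic term costs at most half of -b; the summand 1
    covers C = 0.\<close>
  define t where "t = min 1 (- b / (2 * (\<bar>C\<bar> + 1)))"
  have t: "0 < t" "t \<le> 1" using b by (auto simp: t_def divide_neg_pos)
  have "t * C \<le> t * (\<bar>C\<bar> + 1)" using t by (intro mult_left_mono) auto
  also have "\<dots> \<le> - b / (2 * (\<bar>C\<bar> + 1)) * (\<bar>C\<bar> + 1)" by (intro mult_right_mono) (auto simp: t_def)
  also have "\<dots> = - b / 2" by (simp add: field_simps)
  finally have "b + t * C < 0" using b by linarith
  then have "t * (b + t * C) < 0" using t by (simp add: mult_pos_neg)
  then show False using assms[OF t] by (simp add: algebra_simps power2_eq_square)
qed

section \<open>The space \<open>L\<^sup>p\<close>\<close>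

text \<open>The form with weights t and 1 - t serves both the conjugate exponents and the pair
  p/(p-2), p/2 of \<open>N_expansion\<close>, including t = 0 for p = 2.\<close>

lemma Hoelder_weighted:
  fixes U W :: "'a \<Rightarrow> real" and t :: real
  assumes [simp]: "integrable M U" "integrable M W"
    and U: "\<And>x. 0 \<le> U x" and W: "\<And>x. 0 \<le> W x" and t: "0 \<le> t" "t \<le> 1"
  shows "integrable M (\<lambda>x. U x powr t * W x powr (1 - t))"
    and "(\<integral>x. U x powr t * W x powr (1 - t) \<partial>M) \<le> (\<integral>x. U x \<partial>M) powr t * (\<integral>x. W x \<partial>M) powr (1 - t)"
proof -
  have [measurable]: "U \<in> borel_measurable M" "W \<in> borel_measurable M"
    using assms(1,2) by (auto intro: borel_measurable_integrable)
  show *: "integrable M (\<lambda>x. U x powr t * W x powr (1 - t))"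
  proof (rule Bochner_Integration.integrable_bound[of M "\<lambda>x. t * U x + (1 - t) * W x"])
    show "AE x in M. norm (U x powr t * W x powr (1 - t)) \<le> norm (t * U x + (1 - t) * W x)"
      using weighted_Young[OF U W t] U W t by (intro AE_I2) (auto simp: abs_of_nonneg)
  qed auto
  define a b where "a = (\<integral>x. U x \<partial>M)" and "b = (\<integral>x. W x \<partial>M)"
  have ab: "0 \<le> a" "0 \<le> b" using U W by (auto simp: a_def b_def)
  show "(\<integral>x. U x powr t * W x powr (1 - t) \<partial>M) \<le> (\<integral>x. U x \<partial>M) powr t * (\<integral>x. W x \<partial>M) powr (1 - t)"
  proof (cases "a = 0 \<or> b = 0")
    case True
    then have "(AE x in M. U x = 0) \<or> (AE x in M. W x = 0)"
      using U W by (auto simp: a_def b_def integral_nonneg_eq_0_iff_AE)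
    then have "AE x in M. U x powr t * W x powr (1 - t) = 0" by auto
    then have "(\<integral>x. U x powr t * W x powr (1 - t) \<partial>M) = 0"
      by (intro integral_eq_zero_AE)
    then show ?thesis by simp
  next
    case False
    then have ab: "0 < a" "0 < b" using ab by auto
    \<comment> \<open>Young's inequality for the functions normalized to integral one; after
      integration the right-hand weights add up to one.\<close>
    have "U x powr t * W x powr (1 - t) \<le> a powr t * b powr (1 - t) * (t * (U x / a) + (1 - t) * (W x / b))" for x
    proof -
      have "U x powr t * W x powr (1 - t) = a powr t * b powr (1 - t) * ((U x / a) powr t * (W x / b) powr (1 - t))"
        using U[of x] W[of x] ab by (simp add: powr_divide)
      also have "\<dots> \<le> a powr t * b powr (1 - t) * (t * (U x / a) + (1 - t) * (W x / b))"
        using U[of x] W[of x] ab t by (intro mult_left_mono weighted_Young) auto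
      finally show ?thesis .
    qed
    then have "(\<integral>x. U x powr t * W x powr (1 - t) \<partial>M)
        \<le> (\<integral>x. a powr t * b powr (1 - t) * (t * (U x / a) + (1 - t) * (W x / b)) \<partial>M)"
      using * by (intro integral_mono) auto
    also have "\<dots> = a powr t * b powr (1 - t) * (t * (a / a) + (1 - t) * (b / b))"
      by (simp add: a_def b_def)
    also have "\<dots> = a powr t * b powr (1 - t)" using ab by simp
    finally show ?thesis by (simp add: a_def b_def)
  qed
qed

lemma Lp_norm_nonneg [simp]: "0 \<le> Lp_norm M p f"
  by (simp add: Lp_norm_def)

lemma Lp_dist_nonneg [simp]: "0 \<le> Lp_dist M p f g"
  by (simp add: Lp_dist_def)

lemma Lp_norm_cong_AE:
  assumes "f \<in> borel_measurable M" "g \<in> borel_measurable M" "AE x in M. f x = g x"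
  shows "Lp_norm M p f = Lp_norm M p g"
proof -
  have "(\<integral>x. \<bar>f x\<bar> powr p \<partial>M) = (\<integral>x. \<bar>g x\<bar> powr p \<partial>M)"
    using assms by (intro integral_cong_AE) auto
  then show ?thesis by (simp add: Lp_norm_def)
qed

lemma Lp_norm_powr:
  assumes "0 < p"
  shows "Lp_norm M p f powr p = (\<integral>x. \<bar>f x\<bar> powr p \<partial>M)"
  using assms by (simp add: Lp_norm_def powr_powr)

lemma powr_le_powr_iff:
  fixes a b p :: real
  assumes "0 < p" "0 \<le> a" "0 \<le> b"
  shows "a powr p \<le> b powr p \<longleftrightarrow> a \<le> b"
  using assms powr_mono2[of p a b] powr_less_mono2[of p b a] by force

lemma Lp_Hoelder:
  assumes p: "1 < p" and u: "u \<in> Lp M (hoelder_conjugate p)" and f: "f \<in> Lp M p"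
  shows "integrable M (\<lambda>x. u x * f x)"
    and "\<bar>\<integral>x. u x * f x \<partial>M\<bar> \<le> Lp_norm M (hoelder_conjugate p) u * Lp_norm M p f"
proof -
  define q where "q = hoelder_conjugate p"
  have q: "0 < q" "1 / q = 1 - 1 / p" "q * (1 / q) = 1" "p * (1 - 1 / q) = 1" using p by (auto simp: q_def hoelder_conjugate_def field_simps)
  define U where "U = (\<lambda>x. \<bar>u x\<bar> powr q)"
  define W where "W = (\<lambda>x. \<bar>f x\<bar> powr p)"
  have [simp]: "integrable M U" "integrable M W" and [measurable]: "u \<in> borel_measurable M" "f \<in> borel_measurable M"
    using u f by (auto simp: Lp_def U_def W_def q_def)
  have eq: "U x powr (1 / q) * W x powr (1 - 1 / q) = \<bar>u x * f x\<bar>" for x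
    unfolding U_def W_def powr_powr q(3,4) by (simp add: abs_mult)
  have nn: "0 \<le> U x" "0 \<le> W x" for x by (auto simp: U_def W_def)
  have "0 \<le> 1 / q" "1 / q \<le> 1" using q p by auto
  note H = Hoelder_weighted[OF \<open>integrable M U\<close> \<open>integrable M W\<close> nn this]
  have i: "integrable M (\<lambda>x. \<bar>u x * f x\<bar>)" using H(1) unfolding eq .
  then show "integrable M (\<lambda>x. u x * f x)" by (subst (asm) integrable_abs_iff) auto
  have "\<bar>\<integral>x. u x * f x \<partial>M\<bar> \<le> (\<integral>x. \<bar>u x * f x\<bar> \<partial>M)" by (rule integral_abs_bound)
  also have "\<dots> \<le> (\<integral>x. U x \<partial>M) powr (1 / q) * (\<integral>x. W x \<partial>M) powr (1 - 1 / q)" using H(2) unfolding eq .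
  also have "\<dots> = Lp_norm M q u * Lp_norm M p f" using q by (simp add: Lp_norm_def U_def W_def)
  finally show "\<bar>\<integral>x. u x * f x \<partial>M\<bar> \<le> Lp_norm M (hoelder_conjugate p) u * Lp_norm M p f"
    by (simp add: q_def)
qed

lemma duality_map_cmult: "duality_map p (\<lambda>x. c * f x) x = \<bar>c\<bar> powr (p - 2) * c * duality_map p f x"
  by (simp add: duality_map_def abs_mult powr_mult)

text \<open>Both claims rest on (p - 1) q = p, which gives |J f|^q = |f|^p.\<close>

lemma
  assumes p: "1 < p" and f: "f \<in> Lp M p"
  shows duality_map_in_Lp: "duality_map p f \<in> Lp M (hoelder_conjugate p)"
    and Lp_norm_duality_map: "Lp_norm M (hoelder_conjugate p) (duality_map p f) = Lp_norm M p f powr (p - 1)"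
proof -
  define q where "q = hoelder_conjugate p"
  have q: "(p - 1) * q = p" "0 < q" "1 / q = (p - 1) / p" using p by (auto simp: q_def hoelder_conjugate_def field_simps)
  have [measurable]: "f \<in> borel_measurable M" using f by (auto simp: Lp_def)
  have eq: "\<bar>duality_map p f x\<bar> powr q = \<bar>f x\<bar> powr p" for x
    unfolding abs_duality_map by (simp add: powr_powr q)
  have [measurable]: "duality_map p f \<in> borel_measurable M" unfolding duality_map_def by measurable
  show "duality_map p f \<in> Lp M (hoelder_conjugate p)"
    using f unfolding q_def[symmetric] Lp_def by (auto simp: eq)
  show "Lp_norm M (hoelder_conjugate p) (duality_map p f) = Lp_norm M p f powr (p - 1)"
    unfolding q_def[symmetric] Lp_norm_def eq by (simp add: powr_powr q)
qed

locale Lp_space = finite_measure M for M :: "'a measure" +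
  fixes p :: real
  assumes two_le_p: "2 \<le> p"
begin

abbreviation E :: "('a \<Rightarrow> real) set" where "E \<equiv> Lp M p"
abbreviation N :: "('a \<Rightarrow> real) \<Rightarrow> real" where "N \<equiv> Lp_norm M p"
abbreviation J :: "('a \<Rightarrow> real) \<Rightarrow> 'a \<Rightarrow> real" where "J \<equiv> duality_map p"

lemma p_pos: "0 < p" "1 < p" "1 \<le> p" "p \<noteq> 0" using two_le_p by auto

lemma Lp_measurable [measurable_dest]: "f \<in> E \<Longrightarrow> f \<in> borel_measurable M"
  by (simp add: Lp_def)

lemma Lp_integrable: "f \<in> E \<Longrightarrow> integrable M (\<lambda>x. \<bar>f x\<bar> powr p)"
  by (simp add: Lp_def)

lemma N_le_iff: "0 \<le> a \<Longrightarrow> N f \<le> a \<longleftrightarrow> (\<integral>x. \<bar>f x\<bar> powr p \<partial>M) \<le> a powr p"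
  using powr_le_powr_iff[of p "N f" a] p_pos Lp_norm_powr[of p M f] by simp

lemma Lp_mono:
  assumes [measurable]: "f \<in> borel_measurable M" and g: "g \<in> E" and le: "AE x in M. \<bar>f x\<bar> \<le> \<bar>g x\<bar>"
  shows "f \<in> E" "N f \<le> N g"
proof -
  have le': "AE x in M. \<bar>f x\<bar> powr p \<le> \<bar>g x\<bar> powr p"
    using le by eventually_elim (use p_pos in \<open>auto intro: powr_mono2\<close>)
  have "integrable M (\<lambda>x. \<bar>f x\<bar> powr p)"
    by (rule Bochner_Integration.integrable_bound[OF Lp_integrable[OF g]]) (use le' in auto)
  then show "f \<in> E" by (simp add: Lp_def)
  show "N f \<le> N g"
    unfolding N_le_iff[OF Lp_norm_nonneg] Lp_norm_powr[OF p_pos(1)]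
    using le' \<open>f \<in> E\<close> g by (intro integral_mono_AE) (auto dest: Lp_integrable)
qed

lemma Lp_bounded:
  assumes [measurable]: "f \<in> borel_measurable M" and "\<And>x. \<bar>f x\<bar> \<le> C"
  shows "f \<in> E"
proof -
  have "integrable M (\<lambda>x. \<bar>f x\<bar> powr p)"
    using assms p_pos by (intro integrable_const_bound[where B="C powr p"]) (auto intro!: powr_mono2)
  then show ?thesis by (simp add: Lp_def)
qed

lemma Lp_abs: "f \<in> E \<Longrightarrow> (\<lambda>x. \<bar>f x\<bar>) \<in> E" "N (\<lambda>x. \<bar>f x\<bar>) = N f"
  by (auto simp: Lp_def Lp_norm_def)

lemma Lp_cmult: "f \<in> E \<Longrightarrow> (\<lambda>x. c * f x) \<in> E"
  by (auto simp: Lp_def abs_mult powr_mult)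

lemma N_cmult: "N (\<lambda>x. c * f x) = \<bar>c\<bar> * N f"
  using p_pos by (simp add: Lp_norm_def abs_mult powr_mult powr_powr)

lemma Lp_uminus: "f \<in> E \<Longrightarrow> (\<lambda>x. - f x) \<in> E"
  using Lp_cmult[of f "-1"] by simp

lemma N_uminus: "N (\<lambda>x. - f x) = N f"
  using N_cmult[of "-1" f] by simp

lemma Lp_zero: "(\<lambda>x. 0) \<in> E" and N_zero: "N (\<lambda>x. 0) = 0"
  using p_pos by (auto simp: Lp_def Lp_norm_def)

lemma Lp_add:
  assumes f: "f \<in> E" and g: "g \<in> E"
  shows "(\<lambda>x. f x + g x) \<in> E"
proof -
  have [measurable]: "f \<in> borel_measurable M" "g \<in> borel_measurable M" using f g by auto
  have b: "\<bar>f x + g x\<bar> powr p \<le> 2 powr p * (\<bar>f x\<bar> powr p + \<bar>g x\<bar> powr p)" for x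
  proof -
    have "\<bar>f x + g x\<bar> powr p = 2 powr p * \<bar>(f x + g x) / 2\<bar> powr p"
      by (simp add: powr_mult[symmetric])
    also have "\<dots> \<le> 2 powr p * ((\<bar>f x\<bar> powr p + \<bar>g x\<bar> powr p) / 2)"
      using Clarkson_real[OF two_le_p, of "f x" "g x"] powr_ge_zero[of "\<bar>(f x - g x) / 2\<bar>" p]
      by (intro mult_left_mono) (linarith, simp)
    also have "\<dots> \<le> 2 powr p * (\<bar>f x\<bar> powr p + \<bar>g x\<bar> powr p)"
      by (intro mult_left_mono) auto
    finally show ?thesis .
  qed
  have "integrable M (\<lambda>x. \<bar>f x + g x\<bar> powr p)"
    by (rule Bochner_Integration.integrable_bound[of M "\<lambda>x. 2 powr p * (\<bar>f x\<bar> powr p + \<bar>g x\<bar> powr p)"])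
      (use f g b in \<open>auto dest: Lp_integrable\<close>)
  then show ?thesis by (simp add: Lp_def)
qed

lemma Lp_diff: "f \<in> E \<Longrightarrow> g \<in> E \<Longrightarrow> (\<lambda>x. f x - g x) \<in> E"
  using Lp_add[of f "\<lambda>x. - g x"] Lp_uminus[of g] by simp

lemmas Lp_intros = Lp_add Lp_diff Lp_cmult Lp_uminus Lp_zero Lp_abs(1)

text \<open>Minkowski from convexity of z^p: |f| + |g| is s + t times the combination of |f|/s and
  |g|/t with weights s/(s+t) and t/(s+t).\<close>

lemma N_add_le:
  assumes f: "f \<in> E" and g: "g \<in> E"
  shows "N (\<lambda>x. f x + g x) \<le> N f + N g"
proof (rule field_le_epsilon)
  fix e :: real assume e: "0 < e"
  \<comment> \<open>The surplus e/2 keeps both denominators positive when a norm vanishes.\<close>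
  define s t where "s = N f + e / 2" and "t = N g + e / 2"
  have st: "0 < s" "0 < t" using e by (auto simp: s_def t_def add_nonneg_pos)
  define r where "r = s / (s + t)"
  have r: "0 \<le> r" "r \<le> 1" "1 - r = t / (s + t)" using st by (auto simp: r_def field_simps)
  have b: "\<bar>f x + g x\<bar> powr p \<le> (s + t) powr p * (r * (\<bar>f x\<bar> powr p / s powr p) + (1 - r) * (\<bar>g x\<bar> powr p / t powr p))" for x
  proof -
    have "\<bar>f x + g x\<bar> powr p \<le> (\<bar>f x\<bar> + \<bar>g x\<bar>) powr p" using p_pos by (intro powr_mono2) auto
    also have "\<bar>f x\<bar> + \<bar>g x\<bar> = (s + t) * (r * (\<bar>f x\<bar> / s) + (1 - r) * (\<bar>g x\<bar> / t))"
    proof -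
      have "(s + t) * (r * (\<bar>f x\<bar> / s)) = \<bar>f x\<bar>" using st by (simp add: r_def)
      moreover have "(s + t) * ((1 - r) * (\<bar>g x\<bar> / t)) = \<bar>g x\<bar>" using st by (simp add: r(3))
      ultimately show ?thesis by (simp add: distrib_left)
    qed
    also have "\<dots> powr p = (s + t) powr p * (r * (\<bar>f x\<bar> / s) + (1 - r) * (\<bar>g x\<bar> / t)) powr p"
      by (rule powr_mult)
    also have "\<dots> \<le> (s + t) powr p * (r * (\<bar>f x\<bar> / s) powr p + (1 - r) * (\<bar>g x\<bar> / t) powr p)"
      using st r p_pos by (intro mult_left_mono powr_convex_comb) auto
    finally show ?thesis using st by (simp add: powr_divide)
  qed
  have fs: "(\<integral>x. \<bar>f x\<bar> powr p \<partial>M) \<le> s powr p" "(\<integral>x. \<bar>g x\<bar> powr p \<partial>M) \<le> t powr p"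
    using N_le_iff[of s f] N_le_iff[of t g] st e by (auto simp: s_def t_def)
  have "(\<integral>x. \<bar>f x + g x\<bar> powr p \<partial>M)
      \<le> (\<integral>x. (s + t) powr p * (r * (\<bar>f x\<bar> powr p / s powr p) + (1 - r) * (\<bar>g x\<bar> powr p / t powr p)) \<partial>M)"
    using f g b Lp_add[OF f g] by (intro integral_mono) (auto dest!: Lp_integrable)
  also have "\<dots> = (s + t) powr p * (r * ((\<integral>x. \<bar>f x\<bar> powr p \<partial>M) / s powr p) + (1 - r) * ((\<integral>x. \<bar>g x\<bar> powr p \<partial>M) / t powr p))"
    using f g by (auto dest!: Lp_integrable)
  also have "\<dots> \<le> (s + t) powr p * (r * 1 + (1 - r) * 1)"
    using fs st r by (intro mult_left_mono add_mono) auto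
  finally have "N (\<lambda>x. f x + g x) \<le> s + t" using st by (subst N_le_iff) auto
  then show "N (\<lambda>x. f x + g x) \<le> N f + N g + e" by (simp add: s_def t_def)
qed

lemma N_diff_le: "f \<in> E \<Longrightarrow> g \<in> E \<Longrightarrow> N (\<lambda>x. f x - g x) \<le> N f + N g"
  using N_add_le[of f "\<lambda>x. - g x"] Lp_uminus[of g] N_uminus[of g] by simp

lemma N_diff_commute: "N (\<lambda>x. f x - g x) = N (\<lambda>x. g x - f x)"
  using N_uminus[of "\<lambda>x. f x - g x"] by simp

lemma N_triangle:
  assumes "f \<in> E" "g \<in> E" "h \<in> E"
  shows "N (\<lambda>x. f x - h x) \<le> N (\<lambda>x. f x - g x) + N (\<lambda>x. g x - h x)"
  using N_add_le[of "\<lambda>x. f x - g x" "\<lambda>x. g x - h x"] assms Lp_diff by simp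

lemma N_diff_ge:
  assumes "f \<in> E" "g \<in> E"
  shows "\<bar>N f - N g\<bar> \<le> N (\<lambda>x. f x - g x)"
  using N_add_le[of "\<lambda>x. f x - g x" g] N_add_le[of "\<lambda>x. g x - f x" f] assms Lp_diff
    N_diff_commute[of f g] by auto

lemma N_eq_0_iff: "f \<in> E \<Longrightarrow> N f = 0 \<longleftrightarrow> (AE x in M. f x = 0)"
  using p_pos by (simp add: Lp_norm_def powr_eq_0_iff integral_nonneg_eq_0_iff_AE Lp_integrable)

lemma N_Clarkson:
  assumes f: "f \<in> E" and g: "g \<in> E"
  shows "N (\<lambda>x. (f x + g x) / 2) powr p + N (\<lambda>x. (f x - g x) / 2) powr p \<le> (N f powr p + N g powr p) / 2"
proof -
  have i: "(\<lambda>x. (f x + g x) / 2) \<in> E" "(\<lambda>x. (f x - g x) / 2) \<in> E"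
    using Lp_cmult[OF Lp_add[OF f g], of "1/2"] Lp_cmult[OF Lp_diff[OF f g], of "1/2"] by auto
  note i' = Lp_integrable[OF i(1)] Lp_integrable[OF i(2)] Lp_integrable[OF f] Lp_integrable[OF g]
  have "(\<integral>x. \<bar>(f x + g x) / 2\<bar> powr p \<partial>M) + (\<integral>x. \<bar>(f x - g x) / 2\<bar> powr p \<partial>M)
      = (\<integral>x. \<bar>(f x + g x) / 2\<bar> powr p + \<bar>(f x - g x) / 2\<bar> powr p \<partial>M)"
    using i' by (intro Bochner_Integration.integral_add[symmetric])
  also have "\<dots> \<le> (\<integral>x. (\<bar>f x\<bar> powr p + \<bar>g x\<bar> powr p) / 2 \<partial>M)"
    using i' Clarkson_real[OF two_le_p] by (intro integral_mono Bochner_Integration.integrable_add) auto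
  also have "\<dots> = ((\<integral>x. \<bar>f x\<bar> powr p \<partial>M) + (\<integral>x. \<bar>g x\<bar> powr p \<partial>M)) / 2"
    using i' by simp
  finally show ?thesis by (simp add: Lp_norm_powr p_pos)
qed

lemma J_integrable: "f \<in> E \<Longrightarrow> g \<in> E \<Longrightarrow> integrable M (\<lambda>x. J f x * g x)"
  using Lp_Hoelder(1)[OF p_pos(2) duality_map_in_Lp[OF p_pos(2)]] .

lemma J_Hoelder: "f \<in> E \<Longrightarrow> g \<in> E \<Longrightarrow> \<bar>\<integral>x. J f x * g x \<partial>M\<bar> \<le> N f powr (p - 1) * N g"
  using Lp_Hoelder(2)[OF p_pos(2) duality_map_in_Lp[OF p_pos(2)], of f M g]
  by (simp add: Lp_norm_duality_map p_pos)

lemma J_self: "(\<integral>x. J f x * f x \<partial>M) = N f powr p"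
  by (simp add: duality_map_mult_self Lp_norm_powr p_pos)

text \<open>Source of the first-order conditions for elements of minimal norm and for proximal
  points, and of the quadratic bound on \<open>Phi\<close>.\<close>

lemma N_expansion:
  assumes f: "f \<in> E" and v: "v \<in> E"
  shows "N (\<lambda>x. f x + v x) powr p
    \<le> N f powr p + p * (\<integral>x. J f x * v x \<partial>M) + p * (p - 1) * ((N f + N v) powr (p - 2) * (N v)\<^sup>2)"
proof -
  define s where "s = (\<lambda>x. \<bar>f x\<bar> + \<bar>v x\<bar>)"
  have s: "s \<in> E" "N s \<le> N f + N v"
    using Lp_intros f v N_add_le[of "\<lambda>x. \<bar>f x\<bar>" "\<lambda>x. \<bar>v x\<bar>"] by (auto simp: s_def Lp_abs)
  \<comment> \<open>Hoelder with exponents p/(p-2) and p/2 separates the two factors of the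
    remainder.\<close>
  define t where "t = (p - 2) / p"
  have t: "0 \<le> t" "t \<le> 1" "1 - t = 2 / p" "p * t = p - 2" "p * (1 - t) = 2"
    using two_le_p by (auto simp: t_def field_simps)
  have eq: "(\<bar>s x\<bar> powr p) powr t * (\<bar>v x\<bar> powr p) powr (1 - t) = (\<bar>f x\<bar> + \<bar>v x\<bar>) powr (p - 2) * (v x)\<^sup>2" for x
    by (simp only: powr_powr t) (simp add: s_def p_pos)
  have H: "integrable M (\<lambda>x. (\<bar>f x\<bar> + \<bar>v x\<bar>) powr (p - 2) * (v x)\<^sup>2)"
    "(\<integral>x. (\<bar>f x\<bar> + \<bar>v x\<bar>) powr (p - 2) * (v x)\<^sup>2 \<partial>M)
       \<le> (\<integral>x. \<bar>s x\<bar> powr p \<partial>M) powr t * (\<integral>x. \<bar>v x\<bar> powr p \<partial>M) powr (1 - t)"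
    using Hoelder_weighted[OF Lp_integrable[OF s(1)] Lp_integrable[OF v] _ _ t(1,2)] unfolding eq by auto
  have "(\<integral>x. \<bar>s x\<bar> powr p \<partial>M) powr t * (\<integral>x. \<bar>v x\<bar> powr p \<partial>M) powr (1 - t) = N s powr (p - 2) * (N v)\<^sup>2"
    unfolding Lp_norm_powr[OF p_pos(1), symmetric] powr_powr t by (simp add: p_pos)
  also have "\<dots> \<le> (N f + N v) powr (p - 2) * (N v)\<^sup>2"
    using s two_le_p by (intro mult_right_mono powr_mono2) auto
  finally have H2: "(\<integral>x. (\<bar>f x\<bar> + \<bar>v x\<bar>) powr (p - 2) * (v x)\<^sup>2 \<partial>M) \<le> (N f + N v) powr (p - 2) * (N v)\<^sup>2"
    using H(2) by linarith
  have "N (\<lambda>x. f x + v x) powr p = (\<integral>x. \<bar>f x + v x\<bar> powr p \<partial>M)" by (simp add: Lp_norm_powr p_pos)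
  also have "\<dots> \<le> (\<integral>x. \<bar>f x\<bar> powr p + p * (J f x * v x) + p * (p - 1) * ((\<bar>f x\<bar> + \<bar>v x\<bar>) powr (p - 2) * (v x)\<^sup>2) \<partial>M)"
  proof (intro integral_mono)
    show "integrable M (\<lambda>x. \<bar>f x + v x\<bar> powr p)" by (intro Lp_integrable Lp_add f v)
    show "\<bar>f x + v x\<bar> powr p \<le> \<bar>f x\<bar> powr p + p * (J f x * v x) + p * (p - 1) * ((\<bar>f x\<bar> + \<bar>v x\<bar>) powr (p - 2) * (v x)\<^sup>2)" for x
      using abs_powr_expansion[OF two_le_p, of "f x" "v x"] by (simp add: duality_map_def mult.assoc)
    show "integrable M (\<lambda>x. \<bar>f x\<bar> powr p + p * (J f x * v x) + p * (p - 1) * ((\<bar>f x\<bar> + \<bar>v x\<bar>) powr (p - 2) * (v x)\<^sup>2))"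
      using H(1) J_integrable[OF f v] Lp_integrable[OF f]
      by (intro Bochner_Integration.integrable_add integrable_mult_right)
  qed
  also have "\<dots> = N f powr p + p * (\<integral>x. J f x * v x \<partial>M) + p * (p - 1) * (\<integral>x. (\<bar>f x\<bar> + \<bar>v x\<bar>) powr (p - 2) * (v x)\<^sup>2 \<partial>M)"
    using H(1) J_integrable[OF f v] Lp_integrable[OF f]
    by (simp add: Lp_norm_powr p_pos)
  also have "\<dots> \<le> N f powr p + p * (\<integral>x. J f x * v x \<partial>M) + p * (p - 1) * ((N f + N v) powr (p - 2) * (N v)\<^sup>2)"
    using H2 p_pos by (intro add_left_mono mult_left_mono) auto
  finally show ?thesis .
qed

text \<open>Provides a remainder constant independent of t, as
  \<open>nonneg_of_quadratic_perturbation\<close> requires.\<close>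

lemma N_expansion_scaled:
  assumes f: "f \<in> E" and v: "v \<in> E"
  obtains C where "\<And>t. 0 \<le> t \<Longrightarrow> t \<le> 1 \<Longrightarrow>
    N (\<lambda>x. f x + t * v x) powr p \<le> N f powr p + t * (p * (\<integral>x. J f x * v x \<partial>M)) + t\<^sup>2 * C"
proof
  fix t :: real assume t: "0 \<le> t" "t \<le> 1"
  have Nt: "N (\<lambda>x. t * v x) = t * N v" using t by (simp add: N_cmult)
  have "t * N v \<le> N v" using t by (simp add: mult_left_le_one_le)
  then have "(N f + t * N v) powr (p - 2) \<le> (N f + N v) powr (p - 2)"
    using t two_le_p by (intro powr_mono2) auto
  then have *: "p * (p - 1) * ((N f + t * N v) powr (p - 2) * (t * N v)\<^sup>2)
      \<le> p * (p - 1) * ((N f + N v) powr (p - 2) * (t * N v)\<^sup>2)"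
    using p_pos by (intro mult_left_mono mult_right_mono) auto
  have "N (\<lambda>x. f x + t * v x) powr p \<le> N f powr p + p * (\<integral>x. J f x * (t * v x) \<partial>M)
      + p * (p - 1) * ((N f + t * N v) powr (p - 2) * (t * N v)\<^sup>2)"
    using N_expansion[OF f Lp_cmult[OF v, of t]] by (simp add: Nt)
  also have "(\<integral>x. J f x * (t * v x) \<partial>M) = t * (\<integral>x. J f x * v x \<partial>M)"
    using integral_mult_right_zero[of M t "\<lambda>x. J f x * v x"] by (simp add: mult.left_commute)
  finally show "N (\<lambda>x. f x + t * v x) powr p \<le> N f powr p + t * (p * (\<integral>x. J f x * v x \<partial>M))
      + t\<^sup>2 * (p * (p - 1) * ((N f + N v) powr (p - 2) * (N v)\<^sup>2))"
    using * by (simp add: power_mult_distrib mult.commute mult.left_commute)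
qed

section \<open>Completeness and uniform convexity of L^p\<close>

lemma integral_abs_le_N:
  assumes f: "f \<in> E"
  shows "integrable M f" "(\<integral>x. \<bar>f x\<bar> \<partial>M) \<le> Lp_norm M (hoelder_conjugate p) (\<lambda>_. 1) * N f"
proof -
  have 1: "(\<lambda>_. 1) \<in> Lp M (hoelder_conjugate p)" by (simp add: Lp_def)
  show "integrable M f" using Lp_Hoelder(1)[OF p_pos(2) 1 f] by simp
  have "\<bar>\<integral>x. 1 * \<bar>f x\<bar> \<partial>M\<bar> \<le> Lp_norm M (hoelder_conjugate p) (\<lambda>_. 1) * N (\<lambda>x. \<bar>f x\<bar>)"
    using Lp_Hoelder(2)[OF p_pos(2) 1 Lp_abs(1)[OF f]] .
  then show "(\<integral>x. \<bar>f x\<bar> \<partial>M) \<le> Lp_norm M (hoelder_conjugate p) (\<lambda>_. 1) * N f"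
    by (simp add: Lp_abs)
qed

text \<open>Fatou's lemma for the p-th powers. Membership of the pointwise limit in L^p is part of
  the conclusion, since it is not known beforehand.\<close>

lemma N_fatou:
  assumes g: "\<And>n. g n \<in> E" and [measurable]: "f \<in> borel_measurable M"
    and lim: "AE x in M. (\<lambda>n. g n x) \<longlonglongrightarrow> f x"
    and le: "eventually (\<lambda>n. N (g n) \<le> e) sequentially" and e: "0 \<le> e"
  shows "f \<in> E" "N f \<le> e"
proof -
  have [measurable]: "g n \<in> borel_measurable M" for n using g by auto
  have int: "(\<integral>\<^sup>+x. ennreal (\<bar>g n x\<bar> powr p) \<partial>M) = ennreal (N (g n) powr p)" for n
    unfolding Lp_norm_powr[OF p_pos(1)] using g by (intro nn_integral_eq_integral) (auto dest: Lp_integrable)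
  have "(\<integral>\<^sup>+x. ennreal (\<bar>f x\<bar> powr p) \<partial>M) = (\<integral>\<^sup>+x. liminf (\<lambda>n. ennreal (\<bar>g n x\<bar> powr p)) \<partial>M)"
  proof (intro nn_integral_cong_AE)
    show "AE x in M. ennreal (\<bar>f x\<bar> powr p) = liminf (\<lambda>n. ennreal (\<bar>g n x\<bar> powr p))"
      using lim
    proof eventually_elim
      case (elim x)
      have "(\<lambda>n. \<bar>g n x\<bar> powr p) \<longlonglongrightarrow> \<bar>f x\<bar> powr p"
        using p_pos by (intro tendsto_powr' tendsto_rabs elim tendsto_const) auto
      then show ?case by (intro lim_imp_Liminf[symmetric]) auto
    qed
  qed
  also have "\<dots> \<le> liminf (\<lambda>n. \<integral>\<^sup>+x. ennreal (\<bar>g n x\<bar> powr p) \<partial>M)"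
    by (intro nn_integral_liminf) auto
  also have "\<dots> \<le> liminf (\<lambda>n. ennreal (e powr p))"
    by (intro Liminf_mono, unfold int) (use le e p_pos in \<open>auto elim!: eventually_mono intro!: ennreal_leI powr_mono2\<close>)
  also have "\<dots> = ennreal (e powr p)" by (simp add: Liminf_const)
  finally have *: "(\<integral>\<^sup>+x. ennreal (\<bar>f x\<bar> powr p) \<partial>M) \<le> ennreal (e powr p)" .
  have "integrable M (\<lambda>x. \<bar>f x\<bar> powr p)"
    using * by (intro integrableI_nonneg) (auto intro: le_less_trans)
  then show "f \<in> E" by (simp add: Lp_def)
  then show "N f \<le> e"
    using * e unfolding N_le_iff[OF e]
    by (subst (asm) nn_integral_eq_integral) (auto simp: Lp_def ennreal_le_iff)
qed

text \<open>Riesz-Fischer: a subsequence with geometrically small increments converges almost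
  everywhere, and Fatou applied to u m - u (r n) for growing n upgrades this to norm convergence of
  the whole sequence.\<close>

lemma Lp_complete:
  assumes u: "\<And>n. u n \<in> E"
    and cau: "\<And>e. 0 < e \<Longrightarrow> \<exists>k. \<forall>m\<ge>k. \<forall>n\<ge>k. N (\<lambda>x. u m x - u n x) < e"
  obtains f where "f \<in> E" "(\<lambda>n. N (\<lambda>x. u n x - f x)) \<longlonglongrightarrow> 0"
proof -
  have [measurable]: "u n \<in> borel_measurable M" for n using u by auto
  have "\<exists>r::nat\<Rightarrow>nat. strict_mono r \<and> (\<forall>j. \<forall>m\<ge>r j. \<forall>n\<ge>r j. N (\<lambda>x. u m x - u n x) < (1 / 2) ^ j)"
  proof -
    have "\<exists>r::nat\<Rightarrow>nat. \<forall>j. (\<forall>m\<ge>r j. \<forall>n\<ge>r j. N (\<lambda>x. u m x - u n x) < (1 / 2) ^ j) \<and> r j < r (Suc j)"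
    proof (rule dependent_nat_choice)
      show "\<exists>k. \<forall>m\<ge>k. \<forall>n\<ge>k. N (\<lambda>x. u m x - u n x) < (1 / 2) ^ 0" using cau[of 1] by simp
      fix l j
      obtain k where k: "\<forall>m\<ge>k. \<forall>n\<ge>k. N (\<lambda>x. u m x - u n x) < (1 / 2) ^ Suc j"
        using cau[of "(1 / 2) ^ Suc j"] by auto
      then show "\<exists>k. (\<forall>m\<ge>k. \<forall>n\<ge>k. N (\<lambda>x. u m x - u n x) < (1 / 2) ^ Suc j) \<and> l < k"
        by (intro exI[of _ "max k (Suc l)"]) auto
    qed
    then show ?thesis by (auto simp: strict_mono_Suc_iff)
  qed
  then obtain r where r: "strict_mono r"
    and rN: "\<And>j m n. r j \<le> m \<Longrightarrow> r j \<le> n \<Longrightarrow> N (\<lambda>x. u m x - u n x) < (1 / 2) ^ j" by blast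
  define D where "D = (\<lambda>k x. u (r (Suc k)) x - u (r k) x)"
  have D: "D k \<in> E" for k using u Lp_diff by (simp add: D_def)
  have DN: "N (D k) \<le> (1 / 2) ^ k" for k
    unfolding D_def using rN[of k "r (Suc k)" "r k"] strict_monoD[OF r, of k "Suc k"] by (simp add: less_imp_le)
  define C where "C = Lp_norm M (hoelder_conjugate p) (\<lambda>_. 1)"
  have C: "0 \<le> C" by (simp add: C_def)
  have [measurable]: "D k \<in> borel_measurable M" for k using D by auto
  \<comment> \<open>On a finite measure space L^p embeds into L^1, so the increments are summable in
    L^1 and hence absolutely summable almost everywhere.\<close>
  have "(\<integral>\<^sup>+x. (\<Sum>k. ennreal \<bar>D k x\<bar>) \<partial>M) = (\<Sum>k. \<integral>\<^sup>+x. ennreal \<bar>D k x\<bar> \<partial>M)"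
    by (intro nn_integral_suminf) auto
  also have "\<dots> \<le> (\<Sum>k. ennreal (C * (1 / 2) ^ k))"
  proof (intro suminf_le allI summableI)
    fix k
    have "(\<integral>\<^sup>+x. ennreal \<bar>D k x\<bar> \<partial>M) = ennreal (\<integral>x. \<bar>D k x\<bar> \<partial>M)"
      using integral_abs_le_N(1)[OF D] by (intro nn_integral_eq_integral) auto
    also have "(\<integral>x. \<bar>D k x\<bar> \<partial>M) \<le> C * N (D k)" using integral_abs_le_N(2)[OF D] by (simp add: C_def)
    also have "\<dots> \<le> C * (1 / 2) ^ k" using DN C by (intro mult_left_mono)
    finally show "(\<integral>\<^sup>+x. ennreal \<bar>D k x\<bar> \<partial>M) \<le> ennreal (C * (1 / 2) ^ k)" by (simp add: ennreal_leI)
  qed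
  also have "\<dots> = ennreal (\<Sum>k. C * (1 / 2) ^ k)"
    using C by (intro suminf_ennreal2) (auto intro!: summable_mult summable_geometric)
  finally have fin: "(\<integral>\<^sup>+x. (\<Sum>k. ennreal \<bar>D k x\<bar>) \<partial>M) \<noteq> \<infinity>" by (auto simp: top_unique)
  have "AE x in M. (\<Sum>k. ennreal \<bar>D k x\<bar>) \<noteq> \<infinity>"
    using fin by (intro nn_integral_noteq_infinite) auto
  then have lim: "AE x in M. (\<lambda>k. u (r k) x) \<longlonglongrightarrow> lim (\<lambda>k. u (r k) x)"
  proof eventually_elim
    case (elim x)
    then have "summable (\<lambda>k. \<bar>D k x\<bar>)" by (intro summable_suminf_not_top) auto
    then have "convergent (\<lambda>n. u (r 0) x + (\<Sum>k<n. D k x))"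
      by (intro convergent_add convergent_const) (auto simp: summable_iff_convergent[symmetric] intro: summable_rabs_cancel)
    moreover have "(\<lambda>n. u (r 0) x + (\<Sum>k<n. D k x)) = (\<lambda>k. u (r k) x)"
      using sum_lessThan_telescope[of "\<lambda>k. u (r k) x"] by (auto simp: D_def)
    ultimately show ?case by (simp add: convergent_LIMSEQ_iff)
  qed
  define f where "f = (\<lambda>x. lim (\<lambda>k. u (r k) x))"
  have [measurable]: "f \<in> borel_measurable M" unfolding f_def by (intro borel_measurable_lim_metric) auto
  have *: "(\<lambda>x. u m x - f x) \<in> E \<and> N (\<lambda>x. u m x - f x) \<le> e"
    if e: "0 < e" and k: "\<forall>m\<ge>k. \<forall>n\<ge>k. N (\<lambda>x. u m x - u n x) < e" and m: "k \<le> m" for e k m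
  proof -
    have a: "AE x in M. (\<lambda>n. u m x - u (r n) x) \<longlonglongrightarrow> u m x - f x"
      using lim by eventually_elim (auto simp: f_def intro!: tendsto_intros)
    have b: "eventually (\<lambda>n. N (\<lambda>x. u m x - u (r n) x) \<le> e) sequentially"
      using eventually_ge_at_top[of k]
    proof eventually_elim
      case (elim n)
      then have "k \<le> r n" using seq_suble[OF r, of n] by linarith
      then show ?case using k m by (simp add: less_imp_le)
    qed
    have "(\<lambda>x. u m x - u (r n) x) \<in> E" for n using u by (intro Lp_diff) auto
    then show ?thesis using N_fatou[OF _ _ a b] e by auto
  qed
  obtain k0 where "\<forall>m\<ge>k0. \<forall>n\<ge>k0. N (\<lambda>x. u m x - u n x) < 1" using cau[of 1] by auto
  then have "(\<lambda>x. u k0 x - f x) \<in> E" using *[of 1 k0 k0] by auto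
  then have "f \<in> E" using Lp_diff[OF u[of k0], of "\<lambda>x. u k0 x - f x"] by simp
  moreover have "(\<lambda>n. N (\<lambda>x. u n x - f x)) \<longlonglongrightarrow> 0"
  proof (rule LIMSEQ_I)
    fix e :: real assume "0 < e"
    then obtain k where "\<forall>m\<ge>k. \<forall>n\<ge>k. N (\<lambda>x. u m x - u n x) < e / 2" using cau[of "e / 2"] by auto
    then show "\<exists>k. \<forall>n\<ge>k. norm (N (\<lambda>x. u n x - f x) - 0) < e"
      using *[of "e / 2" k] \<open>0 < e\<close> by (intro exI[of _ k]) force
  qed
  ultimately show thesis ..
qed

lemma N_tendsto:
  assumes u: "\<And>n. u n \<in> E" and f: "f \<in> E" and lim: "(\<lambda>n. N (\<lambda>x. u n x - f x)) \<longlonglongrightarrow> 0"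
  shows "(\<lambda>n. N (u n)) \<longlonglongrightarrow> N f"
proof -
  have "(\<lambda>n. N (u n) - N f) \<longlonglongrightarrow> 0"
    using N_diff_ge[OF u f] by (intro Lim_null_comparison[OF _ lim]) auto
  then show ?thesis by (simp add: LIM_zero_iff)
qed

text \<open>Uniform convexity in sequential form: midpoints that asymptotically do not lose norm
  force a Cauchy sequence. The lower bounds b k may vary with k, which suits midpoints known only to
  lie in shrinking balls.\<close>

lemma N_midpoint_converges:
  assumes u: "\<And>n. u n \<in> E" and lim: "(\<lambda>n. N (u n)) \<longlonglongrightarrow> a"
    and b: "b \<longlonglongrightarrow> a" and mid: "\<And>k m n. k \<le> m \<Longrightarrow> k \<le> n \<Longrightarrow> b k \<le> N (\<lambda>x. (u m x + u n x) / 2)"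
  obtains g where "g \<in> E" "(\<lambda>n. N (\<lambda>x. u n x - g x)) \<longlonglongrightarrow> 0" "N g = a"
proof -
  \<comment> \<open>Truncation at 0 makes the p-th powers of the lower bounds monotone and
    convergent.\<close>
  define c where "c = (\<lambda>k. max 0 (b k))"
  have a: "0 \<le> a" by (rule LIMSEQ_le_const[OF lim]) auto
  have "c \<longlonglongrightarrow> max 0 a" unfolding c_def by (intro tendsto_max b tendsto_const)
  then have c: "c \<longlonglongrightarrow> a" using a by (simp add: max_def)
  have mid': "c k \<le> N (\<lambda>x. (u m x + u n x) / 2)" if "k \<le> m" "k \<le> n" for k m n
    using mid[OF that] by (simp add: c_def)
  have lim1: "(\<lambda>n. N (u n) powr p) \<longlonglongrightarrow> a powr p"
    using p_pos by (intro tendsto_powr' lim tendsto_const) auto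
  have lim2: "(\<lambda>n. c n powr p) \<longlonglongrightarrow> a powr p"
    using p_pos by (intro tendsto_powr' c tendsto_const) (auto simp: c_def)
  have cau: "\<exists>k. \<forall>m\<ge>k. \<forall>n\<ge>k. N (\<lambda>x. u m x - u n x) < e" if e: "0 < e" for e
  proof -
    \<comment> \<open>Clarkson bounds the p-th power of the half difference by 2 d: at most d of
      excess in the norms and d of defect in the midpoint.\<close>
    define d where "d = (e / 2) powr p / 2"
    have d: "0 < d" using e by (simp add: d_def)
    have "eventually (\<lambda>n. N (u n) powr p < a powr p + d) sequentially"
      using order_tendstoD(2)[OF lim1] d by simp
    moreover have "eventually (\<lambda>n. a powr p - d < c n powr p) sequentially"
      using order_tendstoD(1)[OF lim2] d by simp
    ultimately have "eventually (\<lambda>n. N (u n) powr p < a powr p + d \<and> a powr p - d < c n powr p) sequentially"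
      by eventually_elim auto
    then obtain k where k: "\<And>n. k \<le> n \<Longrightarrow> N (u n) powr p < a powr p + d \<and> a powr p - d < c n powr p"
      unfolding eventually_sequentially by blast
    have "N (\<lambda>x. u m x - u n x) < e" if mn: "k \<le> m" "k \<le> n" for m n
    proof -
      have "c k powr p \<le> N (\<lambda>x. (u m x + u n x) / 2) powr p"
        using mid'[OF mn] p_pos by (intro powr_mono2) (auto simp: c_def)
      moreover have "X \<le> Y \<Longrightarrow> Y + Z \<le> (A + B) / 2 \<Longrightarrow> A < s + d \<Longrightarrow> B < s + d \<Longrightarrow> s - d < X \<Longrightarrow> Z < 2 * d"
        for X Y Z A B s :: real by argo
      ultimately have "N (\<lambda>x. (u m x - u n x) / 2) powr p < 2 * d"
        using N_Clarkson[OF u u, of m n] k[OF mn(1)] k[OF mn(2)] k[OF order_refl] by blast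
      then have "N (\<lambda>x. (u m x - u n x) / 2) powr p < (e / 2) powr p" by (simp add: d_def)
      then have "N (\<lambda>x. (u m x - u n x) / 2) < e / 2"
        using powr_le_powr_iff[of p "e / 2" "N (\<lambda>x. (u m x - u n x) / 2)"] e p_pos by force
      then show ?thesis using N_cmult[of "1/2" "\<lambda>x. u m x - u n x"] by simp
    qed
    then show ?thesis by blast
  qed
  obtain g where g: "g \<in> E" "(\<lambda>n. N (\<lambda>x. u n x - g x)) \<longlonglongrightarrow> 0"
    by (rule Lp_complete[OF u cau])
  moreover have "N g = a" using LIMSEQ_unique[OF N_tendsto[OF u g] lim] .
  ultimately show thesis by (rule that)
qed

text \<open>As R is only convex, g is the limit of a minimizing sequence and lies in the closure of
  R. The last claim is the variational inequality <J g, w - g> >= 0.\<close>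

lemma convex_min_norm:
  assumes R: "R \<subseteq> E" "R \<noteq> {}"
    and conv: "\<And>u v t. u \<in> R \<Longrightarrow> v \<in> R \<Longrightarrow> 0 \<le> t \<Longrightarrow> t \<le> 1 \<Longrightarrow> (\<lambda>x. (1 - t) * u x + t * v x) \<in> R"
  obtains g u where "g \<in> E" "\<And>n::nat. u n \<in> R" "(\<lambda>n. N (\<lambda>x. u n x - g x)) \<longlonglongrightarrow> 0"
    "\<And>w. w \<in> R \<Longrightarrow> N g powr p \<le> (\<integral>x. J g x * w x \<partial>M)"
proof -
  define a where "a = Inf (N ` R)"
  have bdd: "bdd_below (N ` R)" by (auto intro!: bdd_belowI[of _ 0])
  have a: "a \<le> N w" if "w \<in> R" for w unfolding a_def using that bdd by (intro cInf_lower) auto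
  have "\<exists>w\<in>R. N w < a + 1 / real (Suc n)" for n
  proof -
    have "a < a + 1 / real (Suc n)" by simp
    then show ?thesis unfolding a_def using R bdd by (subst (asm) cInf_less_iff) auto
  qed
  then obtain u where u: "\<And>n. u n \<in> R" "\<And>n. N (u n) < a + 1 / real (Suc n)" by metis
  have uE: "u n \<in> E" for n using u R by auto
  have "(\<lambda>n. a + 1 / real (Suc n)) \<longlonglongrightarrow> a + 0" by (intro tendsto_intros LIMSEQ_Suc lim_1_over_n)
  then have lim': "(\<lambda>n. a + 1 / real (Suc n)) \<longlonglongrightarrow> a" by simp
  have lim: "(\<lambda>n. N (u n)) \<longlonglongrightarrow> a"
    by (rule tendsto_sandwich[OF _ _ tendsto_const lim'])
      (intro always_eventually allI a u(1) less_imp_le[OF u(2)])+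
  have "a \<le> N (\<lambda>x. (u m x + u n x) / 2)" for m n
    using a[OF conv[OF u(1) u(1), of "1/2" m n]] by (simp add: field_simps)
  then obtain g where g: "g \<in> E" "(\<lambda>n. N (\<lambda>x. u n x - g x)) \<longlonglongrightarrow> 0" "N g = a"
    by (rule N_midpoint_converges[OF uE lim tendsto_const])
  have "N g powr p \<le> (\<integral>x. J g x * w x \<partial>M)" if w: "w \<in> R" for w
  proof -
    have wE: "w \<in> E" using w R by auto
    define v where "v = (\<lambda>x. w x - g x)"
    have v: "v \<in> E" using wE g Lp_diff by (simp add: v_def)
    \<comment> \<open>g may lie outside R, so convexity is used with u n in its place; the error
      disappears in the limit.\<close>
    have ge: "a \<le> N (\<lambda>x. g x + t * v x)" if t: "0 \<le> t" "t \<le> 1" for t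
    proof (rule LIMSEQ_le_const)
      show "(\<lambda>n. N (\<lambda>x. u n x - g x) + N (\<lambda>x. g x + t * v x)) \<longlonglongrightarrow> N (\<lambda>x. g x + t * v x)"
        using tendsto_add[OF g(2) tendsto_const] by simp
      have "a \<le> N (\<lambda>x. u n x - g x) + N (\<lambda>x. g x + t * v x)" for n
      proof -
        have "a \<le> N (\<lambda>x. (1 - t) * u n x + t * w x)" using a[OF conv[OF u(1) w t]] .
        also have "(\<lambda>x. (1 - t) * u n x + t * w x) = (\<lambda>x. (1 - t) * (u n x - g x) + (g x + t * v x))"
          by (auto simp: v_def algebra_simps)
        also have "N \<dots> \<le> N (\<lambda>x. (1 - t) * (u n x - g x)) + N (\<lambda>x. g x + t * v x)"
          using uE g v by (intro N_add_le Lp_intros)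
        also have "N (\<lambda>x. (1 - t) * (u n x - g x)) \<le> N (\<lambda>x. u n x - g x)"
          using t by (simp add: N_cmult mult_left_le_one_le)
        finally show ?thesis by simp
      qed
      then show "\<exists>k. \<forall>n\<ge>k. a \<le> N (\<lambda>x. u n x - g x) + N (\<lambda>x. g x + t * v x)" by blast
    qed
    obtain C where C: "\<And>t. 0 \<le> t \<Longrightarrow> t \<le> 1 \<Longrightarrow>
        N (\<lambda>x. g x + t * v x) powr p \<le> N g powr p + t * (p * (\<integral>x. J g x * v x \<partial>M)) + t\<^sup>2 * C"
      using N_expansion_scaled[OF g(1) v] by blast
    have "0 \<le> p * (\<integral>x. J g x * v x \<partial>M)"
    proof (rule nonneg_of_quadratic_perturbation[where C=C])
      fix t :: real assume t: "0 < t" "t \<le> 1"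
      have "N g powr p \<le> N (\<lambda>x. g x + t * v x) powr p"
        using ge[of t] t g(3) p_pos Lp_norm_nonneg[of M p g] by (intro powr_mono2) auto
      then show "0 \<le> t * (p * (\<integral>x. J g x * v x \<partial>M)) + t\<^sup>2 * C" using C[of t] t by linarith
    qed
    then have "0 \<le> (\<integral>x. J g x * v x \<partial>M)" using p_pos by (simp add: zero_le_mult_iff)
    also have "(\<integral>x. J g x * v x \<partial>M) = (\<integral>x. J g x * w x \<partial>M) - N g powr p"
      unfolding v_def J_self[symmetric]
      using J_integrable[OF g(1) wE] J_integrable[OF g(1) g(1)] by (simp add: right_diff_distrib)
    finally show ?thesis by simp
  qed
  then show thesis using that g u(1) by blast
qed

end

section \<open>Local Lipschitz constants and relaxed slopes\<close>

text \<open>The Lipschitz constant bounds the difference quotients, so their upper limit is finite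
  and \<open>real_of_ereal\<close> loses nothing. At an isolated point \<open>at x\<close> is
  \<open>bot\<close> and the claim is void.\<close>

lemma eventually_local_lip_less:
  assumes h: "C-lipschitz_on UNIV h" and a: "local_lip h x < a"
  shows "\<forall>\<^sub>F y in at x. \<bar>h y - h x\<bar> \<le> a * dist y x"
proof (cases "x islimpt UNIV")
  case False
  then have "at x = bot" by (simp add: trivial_limit_within)
  then show ?thesis by simp
next
  case True
  let ?q = "\<lambda>y. ereal (\<bar>h y - h x\<bar> / dist y x)"
  have nb: "at x \<noteq> bot" using True by (simp add: trivial_limit_within)
  have le: "\<forall>\<^sub>F y in at x. ?q y \<le> ereal C"
    using lipschitz_onD[OF h, of _ x]
    by (intro eventually_at_filter[THEN iffD2] always_eventually) (auto simp: dist_real_def divide_simps)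
  have "Limsup (at x) ?q \<le> ereal C" by (rule Limsup_bounded[OF le])
  moreover have "0 \<le> Limsup (at x) ?q"
    by (rule le_Limsup[OF nb]) (auto intro!: always_eventually)
  ultimately have "ereal (local_lip h x) = Limsup (at x) ?q"
    using True by (cases "Limsup (at x) ?q") (auto simp: local_lip_def)
  then have "Limsup (at x) ?q < ereal a" using a by (metis ereal_less_eq(3) linorder_not_le)
  then have "\<forall>\<^sub>F y in at x. ?q y < ereal a" by (rule Limsup_lessD)
  moreover have "\<forall>\<^sub>F y in at x. y \<noteq> x" by (simp add: eventually_at_filter)
  ultimately show ?thesis by eventually_elim (auto simp: divide_simps)
qed

lemma local_lip_le:
  assumes a: "0 \<le> a" and ev: "\<forall>\<^sub>F y in at x. \<bar>h y - h x\<bar> \<le> a * dist y x"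
  shows "local_lip h x \<le> a"
proof (cases "x islimpt UNIV")
  case True
  let ?q = "\<lambda>y. ereal (\<bar>h y - h x\<bar> / dist y x)"
  have nb: "at x \<noteq> bot" using True by (simp add: trivial_limit_within)
  have "\<forall>\<^sub>F y in at x. ?q y \<le> ereal a"
    using ev by eventually_elim (use a in \<open>auto simp: divide_simps mult.commute\<close>)
  then have "Limsup (at x) ?q \<le> ereal a" by (rule Limsup_bounded)
  moreover have "0 \<le> Limsup (at x) ?q"
    by (rule le_Limsup[OF nb]) (auto intro!: always_eventually)
  ultimately show ?thesis using True
    by (cases "Limsup (at x) ?q") (auto simp: local_lip_def)
qed (use a in \<open>simp add: local_lip_def\<close>)

lemma local_lip_nonneg: "0 \<le> local_lip h x"
proof (cases "x islimpt UNIV")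
  case True
  have "at x \<noteq> bot" using True by (simp add: trivial_limit_within)
  then have "0 \<le> Limsup (at x) (\<lambda>y. ereal (\<bar>h y - h x\<bar> / dist y x))"
    by (rule le_Limsup) (auto intro!: always_eventually)
  then show ?thesis by (simp add: local_lip_def real_of_ereal_pos)
qed (simp add: local_lip_def)

lemma local_lip_le_lipschitz:
  assumes "C-lipschitz_on UNIV h"
  shows "local_lip h x \<le> C"
  using lipschitz_onD[OF assms, of _ x] lipschitz_on_nonneg[OF assms]
  by (intro local_lip_le always_eventually) (auto simp: dist_real_def)

lemma local_lip_lincomb_le:
  assumes f: "A-lipschitz_on UNIV f" and g: "B-lipschitz_on UNIV g"
  shows "local_lip (\<lambda>x. s * f x + t * g x) x \<le> \<bar>s\<bar> * local_lip f x + \<bar>t\<bar> * local_lip g x"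
proof (rule field_le_epsilon)
  fix e :: real assume e: "0 < e"
  define d where "d = e / (\<bar>s\<bar> + \<bar>t\<bar> + 1)"
  have d: "0 < d" using e by (simp add: d_def add_nonneg_pos)
  have "local_lip (\<lambda>x. s * f x + t * g x) x \<le> \<bar>s\<bar> * (local_lip f x + d) + \<bar>t\<bar> * (local_lip g x + d)"
  proof (rule local_lip_le)
    show "0 \<le> \<bar>s\<bar> * (local_lip f x + d) + \<bar>t\<bar> * (local_lip g x + d)"
      using d local_lip_nonneg[of f x] local_lip_nonneg[of g x] by auto
    have "\<forall>\<^sub>F y in at x. \<bar>f y - f x\<bar> \<le> (local_lip f x + d) * dist y x"
      "\<forall>\<^sub>F y in at x. \<bar>g y - g x\<bar> \<le> (local_lip g x + d) * dist y x"
      using d by (auto intro: eventually_local_lip_less[OF f] eventually_local_lip_less[OF g])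
    then show "\<forall>\<^sub>F y in at x. \<bar>s * f y + t * g y - (s * f x + t * g x)\<bar>
        \<le> (\<bar>s\<bar> * (local_lip f x + d) + \<bar>t\<bar> * (local_lip g x + d)) * dist y x"
    proof eventually_elim
      case (elim y)
      have "\<bar>s * f y + t * g y - (s * f x + t * g x)\<bar> = \<bar>s * (f y - f x) + t * (g y - g x)\<bar>"
        by (simp add: algebra_simps)
      also have "\<dots> \<le> \<bar>s\<bar> * \<bar>f y - f x\<bar> + \<bar>t\<bar> * \<bar>g y - g x\<bar>"
        unfolding abs_mult[symmetric] by (rule abs_triangle_ineq)
      also have "\<dots> \<le> \<bar>s\<bar> * ((local_lip f x + d) * dist y x) + \<bar>t\<bar> * ((local_lip g x + d) * dist y x)"
        using elim by (intro add_mono mult_left_mono) auto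
      finally show ?case by (simp add: algebra_simps)
    qed
  qed
  also have "\<dots> = \<bar>s\<bar> * local_lip f x + \<bar>t\<bar> * local_lip g x + (\<bar>s\<bar> + \<bar>t\<bar>) * d" by (simp add: algebra_simps)
  also have "(\<bar>s\<bar> + \<bar>t\<bar>) * d \<le> (\<bar>s\<bar> + \<bar>t\<bar> + 1) * d" using d by (intro mult_right_mono) auto
  also have "(\<bar>s\<bar> + \<bar>t\<bar> + 1) * d = e" by (simp add: d_def add_nonneg_pos)
  finally show "local_lip (\<lambda>x. s * f x + t * g x) x \<le> \<bar>s\<bar> * local_lip f x + \<bar>t\<bar> * local_lip g x + e" by simp
qed

text \<open>Sublevel sets are countable unions, over rational b < a and radii 1/(n+1), of closed
  sets. The quantifier over all y is harmless because it is an intersection of closed conditions on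
  x.\<close>

lemma borel_measurable_local_lip:
  assumes h: "C-lipschitz_on UNIV h"
  shows "local_lip h \<in> borel_measurable borel"
proof (unfold borel_measurable_iff_less, intro allI)
  fix a :: real
  have cont: "continuous_on UNIV h" using h by (rule lipschitz_on_continuous_on)
  define S where "S = (\<lambda>(n::nat) (b::real). {x. \<forall>y. 1 / real (Suc n) \<le> dist y x \<or> \<bar>h y - h x\<bar> \<le> b * dist y x})"
  have "closed (S n b)" for n b
  proof -
    have "S n b = (\<Inter>y. {x. 1 / real (Suc n) \<le> dist y x} \<union> {x. \<bar>h y - h x\<bar> \<le> b * dist y x})"
      by (auto simp: S_def)
    also have "closed \<dots>"
      by (intro closed_INT ballI closed_Un closed_Collect_le continuous_intros cont)
    finally show ?thesis .
  qed
  then have "(\<Union>b\<in>{b. b \<in> \<rat> \<and> 0 \<le> b \<and> b < a}. \<Union>n. S n b) \<in> sets borel"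
    using countable_rat by (intro sets.countable_UN' countable_subset[OF _ countable_rat]) auto
  also have "(\<Union>b\<in>{b. b \<in> \<rat> \<and> 0 \<le> b \<and> b < a}. \<Union>n. S n b) = {x. local_lip h x < a}"
  proof (intro equalityI subsetI)
    fix x assume "x \<in> (\<Union>b\<in>{b. b \<in> \<rat> \<and> 0 \<le> b \<and> b < a}. \<Union>n. S n b)"
    then obtain b n where b: "0 \<le> b" "b < a" and x: "x \<in> S n b" by auto
    have "\<bar>h y - h x\<bar> \<le> b * dist y x" if "dist y x < 1 / real (Suc n)" for y
    proof -
      have "1 / real (Suc n) \<le> dist y x \<or> \<bar>h y - h x\<bar> \<le> b * dist y x"
        using x unfolding S_def by blast
      then show ?thesis using that by linarith
    qed
    then have "\<forall>\<^sub>F y in at x. \<bar>h y - h x\<bar> \<le> b * dist y x"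
      unfolding eventually_at by (intro exI[of _ "1 / real (Suc n)"]) simp
    then show "x \<in> {x. local_lip h x < a}" using local_lip_le[OF b(1), of h x] b by auto
  next
    fix x assume "x \<in> {x. local_lip h x < a}"
    then obtain b where b: "b \<in> \<rat>" "local_lip h x < b" "b < a" using Rats_dense_in_real[of "local_lip h x" a] by auto
    have "\<forall>\<^sub>F y in at x. \<bar>h y - h x\<bar> \<le> b * dist y x" by (rule eventually_local_lip_less[OF h b(2)])
    then obtain d where d: "0 < d" "\<And>y. y \<noteq> x \<Longrightarrow> dist y x < d \<Longrightarrow> \<bar>h y - h x\<bar> \<le> b * dist y x"
      unfolding eventually_at by auto
    obtain n where n: "1 / real (Suc n) < d" using nat_approx_posE[OF d(1)] by auto
    have "x \<in> S n b"
      unfolding S_def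
    proof (intro CollectI allI)
      fix y show "1 / real (Suc n) \<le> dist y x \<or> \<bar>h y - h x\<bar> \<le> b * dist y x"
        using d(2)[of y] n by (cases "y = x"; cases "dist y x < d") (simp, simp, blast, linarith)
    qed
    then show "x \<in> (\<Union>b\<in>{b. b \<in> \<rat> \<and> 0 \<le> b \<and> b < a}. \<Union>n. S n b)"
      using b local_lip_nonneg[of h x] by auto
  qed
  finally show "{x \<in> space borel. local_lip h x < a} \<in> sets borel" by simp
qed

definition lipschitz_functions :: "('a::metric_space \<Rightarrow> real) set" where
  "lipschitz_functions = {h. \<exists>C. C-lipschitz_on UNIV h}"

lemma lipschitz_functions_lincomb:
  assumes "f \<in> lipschitz_functions" "g \<in> lipschitz_functions"
  shows "(\<lambda>x. s * f x + t * g x) \<in> lipschitz_functions"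
proof -
  obtain A B where "A-lipschitz_on UNIV f" "B-lipschitz_on UNIV g"
    using assms by (auto simp: lipschitz_functions_def)
  then have "(\<bar>s\<bar> * A + \<bar>t\<bar> * B)-lipschitz_on UNIV (\<lambda>x. s *\<^sub>R f x + t *\<^sub>R g x)"
    by (intro lipschitz_intros)
  then show ?thesis by (auto simp: lipschitz_functions_def)
qed

lemma local_lip_lincomb:
  assumes "f \<in> lipschitz_functions" "g \<in> lipschitz_functions"
  shows "local_lip (\<lambda>x. s * f x + t * g x) x \<le> \<bar>s\<bar> * local_lip f x + \<bar>t\<bar> * local_lip g x"
  using assms local_lip_lincomb_le by (auto simp: lipschitz_functions_def)

section \<open>The slope as a strong relaxation\<close>

locale Lp_metric_space = Lp_space M p for M :: "'a::metric_space measure" and p +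
  assumes sets_M: "sets M = sets borel"
begin

lemma local_lip_Lp: "h \<in> lipschitz_functions \<Longrightarrow> local_lip h \<in> E"
proof -
  assume "h \<in> lipschitz_functions"
  then obtain C where C: "C-lipschitz_on UNIV h" by (auto simp: lipschitz_functions_def)
  show ?thesis
  proof (rule Lp_bounded)
    show "local_lip h \<in> borel_measurable M"
      using borel_measurable_local_lip[OF C] measurable_cong_sets[OF sets_M refl] by blast
    show "\<bar>local_lip h x\<bar> \<le> C" for x
      using local_lip_nonneg[of h x] local_lip_le_lipschitz[OF C, of x] by simp
  qed
qed

text \<open>A bound for the strong relaxation of h \<mapsto> \<open>N (local_lip h)\<close> over
  Lipschitz functions. Stating it as a bound avoids infinite values; finiteness is membership in
  \<open>slope_dom\<close>.\<close>

definition slope_le :: "('a \<Rightarrow> real) \<Rightarrow> real \<Rightarrow> bool" where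
  "slope_le f a \<longleftrightarrow> f \<in> E \<and>
     (\<forall>e>0. \<exists>h \<in> E \<inter> lipschitz_functions. N (\<lambda>x. h x - f x) < e \<and> N (local_lip h) < a + e)"

definition slope_dom :: "('a \<Rightarrow> real) set" where
  "slope_dom = {f. \<exists>a. slope_le f a}"

definition slope :: "('a \<Rightarrow> real) \<Rightarrow> real" where
  "slope f = Inf {a. slope_le f a}"

lemma slope_leD: "slope_le f a \<Longrightarrow> f \<in> E"
  by (simp add: slope_le_def)

lemma slope_leE:
  assumes "slope_le f a" "0 < e"
  obtains h where "h \<in> E" "h \<in> lipschitz_functions" "N (\<lambda>x. h x - f x) < e" "N (local_lip h) < a + e"
  using assms unfolding slope_le_def by blast

lemma slope_le_nonneg:
  assumes "slope_le f a" shows "0 \<le> a"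
proof (rule field_le_epsilon)
  fix e :: real assume "0 < e"
  then obtain h where "N (local_lip h) < a + e" using assms by (auto simp: slope_le_def)
  then show "0 \<le> a + e" using Lp_norm_nonneg[of M p "local_lip h"] by linarith
qed

lemma slope_le_limit:
  assumes u: "\<And>n. slope_le (u n) (a n)" and a: "a \<longlonglongrightarrow> b"
    and f: "f \<in> E" and lim: "(\<lambda>n. N (\<lambda>x. u n x - f x)) \<longlonglongrightarrow> 0"
  shows "slope_le f b"
  unfolding slope_le_def
proof (intro conjI allI impI f)
  fix e :: real assume e: "0 < e"
  have "\<forall>\<^sub>F n in sequentially. N (\<lambda>x. u n x - f x) < e / 2 \<and> a n < b + e / 2"
    using e by (intro eventually_conj order_tendstoD(2)[OF lim] order_tendstoD(2)[OF a]) auto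
  then obtain n where n: "N (\<lambda>x. u n x - f x) < e / 2" "a n < b + e / 2"
    using eventually_happens'[OF sequentially_bot] by blast
  obtain h where h: "h \<in> E" "h \<in> lipschitz_functions" "N (\<lambda>x. h x - u n x) < e / 2" "N (local_lip h) < a n + e / 2"
    by (rule slope_leE[OF u[of n] half_gt_zero[OF e]])
  have "N (\<lambda>x. h x - f x) < e"
    using N_triangle[OF h(1) slope_leD[OF u] f, of n] h(3) n by linarith
  then show "\<exists>h\<in>E \<inter> lipschitz_functions. N (\<lambda>x. h x - f x) < e \<and> N (local_lip h) < b + e"
    using h n by (intro bexI[of _ h]) auto
qed

lemma slope_le_lincomb:
  assumes f: "slope_le f a" and g: "slope_le g b"
  shows "slope_le (\<lambda>x. s * f x + t * g x) (\<bar>s\<bar> * a + \<bar>t\<bar> * b)"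
  unfolding slope_le_def
proof (intro conjI allI impI)
  show "(\<lambda>x. s * f x + t * g x) \<in> E" using slope_leD[OF f] slope_leD[OF g] by (intro Lp_intros)
  fix e :: real assume e: "0 < e"
  define d where "d = e / (\<bar>s\<bar> + \<bar>t\<bar> + 1)"
  have d: "0 < d" using e by (simp add: d_def add_nonneg_pos)
  have "(\<bar>s\<bar> + \<bar>t\<bar> + 1) * d = e" by (simp add: d_def add_nonneg_pos)
  then have de: "\<bar>s\<bar> * d + \<bar>t\<bar> * d < e" using d by (simp add: distrib_right)
  obtain h where h: "h \<in> E" "h \<in> lipschitz_functions" "N (\<lambda>x. h x - f x) < d" "N (local_lip h) < a + d"
    by (rule slope_leE[OF f d])
  obtain k where k: "k \<in> E" "k \<in> lipschitz_functions" "N (\<lambda>x. k x - g x) < d" "N (local_lip k) < b + d"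
    by (rule slope_leE[OF g d])
  define w where "w = (\<lambda>x. s * h x + t * k x)"
  have w: "w \<in> E" "w \<in> lipschitz_functions"
    using h k by (auto simp: w_def intro!: Lp_intros lipschitz_functions_lincomb)
  have lin: "N (\<lambda>x. s * u x + t * v x) \<le> \<bar>s\<bar> * N u + \<bar>t\<bar> * N v" if "u \<in> E" "v \<in> E" for u v s t
    using N_add_le[of "\<lambda>x. s * u x" "\<lambda>x. t * v x"] that by (simp add: N_cmult Lp_intros)
  have "N (\<lambda>x. w x - (s * f x + t * g x)) = N (\<lambda>x. s * (h x - f x) + t * (k x - g x))"
    by (simp add: w_def algebra_simps)
  also have "\<dots> \<le> \<bar>s\<bar> * N (\<lambda>x. h x - f x) + \<bar>t\<bar> * N (\<lambda>x. k x - g x)"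
    using h k slope_leD[OF f] slope_leD[OF g] by (intro lin Lp_intros)
  also have "\<dots> \<le> \<bar>s\<bar> * d + \<bar>t\<bar> * d" using h k by (intro add_mono mult_left_mono) auto
  finally have 1: "N (\<lambda>x. w x - (s * f x + t * g x)) < e" using de by linarith
  have "N (local_lip w) \<le> N (\<lambda>x. \<bar>s\<bar> * local_lip h x + \<bar>t\<bar> * local_lip k x)"
  proof (intro Lp_mono(2) Lp_intros AE_I2)
    show "\<bar>local_lip w x\<bar> \<le> \<bar>\<bar>s\<bar> * local_lip h x + \<bar>t\<bar> * local_lip k x\<bar>" for x
      using local_lip_nonneg[of w x] local_lip_lincomb[OF h(2) k(2), of s t x] by (simp add: w_def)
  qed (use local_lip_Lp[OF w(2)] local_lip_Lp[OF h(2)] local_lip_Lp[OF k(2)] in auto)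
  also have "\<dots> \<le> \<bar>\<bar>s\<bar>\<bar> * N (local_lip h) + \<bar>\<bar>t\<bar>\<bar> * N (local_lip k)"
    using h k by (intro lin local_lip_Lp)
  also have "\<dots> \<le> \<bar>s\<bar> * (a + d) + \<bar>t\<bar> * (b + d)"
    unfolding abs_abs using h k by (intro add_mono mult_left_mono) auto
  also have "\<dots> < \<bar>s\<bar> * a + \<bar>t\<bar> * b + e" using de by (simp add: distrib_left)
  finally show "\<exists>h\<in>E \<inter> lipschitz_functions. N (\<lambda>x. h x - (s * f x + t * g x)) < e \<and> N (local_lip h) < \<bar>s\<bar> * a + \<bar>t\<bar> * b + e"
    using 1 w by blast
qed

lemma slope_le_mono: "slope_le f a \<Longrightarrow> a \<le> b \<Longrightarrow> slope_le f b"
  unfolding slope_le_def by (meson add_right_mono less_le_trans)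

text \<open>The infimum is attained because bounds are stable under limits:
  \<open>slope_le_limit\<close> is applied to the constant sequence f with bounds decreasing to the
  infimum.\<close>

lemma slope_le_slope:
  assumes "f \<in> slope_dom" shows "slope_le f (slope f)"
proof -
  obtain a where a: "slope_le f a" using assms by (auto simp: slope_dom_def)
  have "slope_le f (slope f + 1 / real (Suc n))" for n
  proof -
    have "\<exists>b\<in>{a. slope_le f a}. b < slope f + 1 / real (Suc n)"
      using a slope_le_nonneg by (subst cInf_less_iff[symmetric]) (auto simp: slope_def intro!: bdd_belowI[of _ 0])
    then show ?thesis using slope_le_mono less_imp_le by blast
  qed
  moreover have "(\<lambda>n. slope f + 1 / real (Suc n)) \<longlonglongrightarrow> slope f + 0" by (intro tendsto_intros LIMSEQ_Suc lim_1_over_n)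
  then have "(\<lambda>n. slope f + 1 / real (Suc n)) \<longlonglongrightarrow> slope f" by (simp only: add_0_right)
  ultimately show ?thesis
    using slope_leD[OF a] by (rule slope_le_limit[where u="\<lambda>_. f"]) (simp add: N_zero)
qed

lemma slope_le_iff: "slope_le f a \<longleftrightarrow> f \<in> slope_dom \<and> slope f \<le> a"
proof
  assume a: "slope_le f a"
  then have "slope f \<le> a"
    unfolding slope_def using slope_le_nonneg by (intro cInf_lower) (auto intro!: bdd_belowI[of _ 0])
  then show "f \<in> slope_dom \<and> slope f \<le> a" using a by (auto simp: slope_dom_def)
qed (use slope_le_slope slope_le_mono in blast)

section \<open>Identification with the Cheeger energy\<close>

lemma N_local_lip_mono:
  assumes k: "k \<in> lipschitz_functions" and g: "g \<in> E" and le: "\<And>x. local_lip k x \<le> g x"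
  shows "N (local_lip k) \<le> N g"
  using local_lip_Lp[OF k] g le local_lip_nonneg[of k]
  by (intro Lp_mono(2) AE_I2) (auto intro: order_trans[OF _ abs_ge_self])

text \<open>The limit is tested with the indicator of the set where it is negative, which lies in
  L^q because the measure is finite.\<close>

lemma weak_limit_nonneg:
  assumes w: "Lp_converges_weakly M p u f" and nn: "\<And>n x. 0 \<le> u n x"
  shows "AE x in M. 0 \<le> f x"
proof -
  define v :: "'a \<Rightarrow> real" where "v = indicator {x \<in> space M. f x < 0}"
  have f: "f \<in> E" using w by (simp add: Lp_converges_weakly_def)
  then have [measurable]: "f \<in> borel_measurable M" by auto
  have vb: "\<bar>v x\<bar> powr q \<le> 1" for x q by (auto simp: v_def indicator_def)
  have [measurable]: "v \<in> borel_measurable M" unfolding v_def by measurable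
  have "integrable M (\<lambda>x. \<bar>v x\<bar> powr hoelder_conjugate p)"
    using vb by (intro integrable_const_bound[where B=1]) auto
  then have v: "v \<in> Lp M (hoelder_conjugate p)" by (simp add: Lp_def)
  then have "(\<lambda>n. \<integral>x. u n x * v x \<partial>M) \<longlonglongrightarrow> (\<integral>x. f x * v x \<partial>M)"
    using w by (simp add: Lp_converges_weakly_def)
  moreover have "0 \<le> (\<integral>x. u n x * v x \<partial>M)" for n
    using nn by (intro integral_nonneg_AE) (auto simp: v_def)
  ultimately have "0 \<le> (\<integral>x. f x * v x \<partial>M)" by (intro LIMSEQ_le_const) auto
  moreover have le: "f x * v x \<le> 0" for x by (auto simp: v_def indicator_def)
  moreover have int: "integrable M (\<lambda>x. f x * v x)"
    using Lp_Hoelder(1)[OF p_pos(2) v f] by (simp add: mult.commute)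
  ultimately have "(\<integral>x. - (f x * v x) \<partial>M) = 0"
    using integral_nonneg_AE[of "\<lambda>x. - (f x * v x)" M] by simp
  then have "AE x in M. - (f x * v x) = 0"
    using int le by (subst (asm) integral_nonneg_eq_0_iff_AE) auto
  then show ?thesis using AE_space
    by eventually_elim (auto simp: v_def indicator_def split: if_splits)
qed

text \<open>Instead of Mazur's lemma one uses the element of minimal norm in the convex set of all upper
  bounds of slopes of Lipschitz functions close to \<open>f\<close>.\<close>

lemma slope_le_weak_limit:
  assumes h: "\<And>n. h n \<in> lipschitz_functions" and lim: "Lp_converges M p h f"
    and w: "Lp_converges_weakly M p (\<lambda>n. local_lip (h n)) G"
  shows "slope_le f (N G)"
  unfolding slope_le_def
proof (intro conjI allI impI)
  show f: "f \<in> E" using lim by (simp add: Lp_converges_def)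
  have hE: "h n \<in> E" for n using lim by (simp add: Lp_converges_def)
  have G: "G \<in> E" using w by (simp add: Lp_converges_weakly_def)
  have lim: "(\<lambda>n. N (\<lambda>x. h n x - f x)) \<longlonglongrightarrow> 0" using lim by (simp add: Lp_converges_def Lp_dist_def)
  fix e :: real assume e: "0 < e"
  \<comment> \<open>Upper bounds enter because slopes alone are not convex: the slope of a
    combination is only dominated by the combination of the slopes.\<close>
  define R where "R = {g \<in> E. \<exists>k \<in> E \<inter> lipschitz_functions. N (\<lambda>x. k x - f x) < e \<and> (\<forall>x. local_lip k x \<le> g x)}"
  have ev: "\<forall>\<^sub>F n in sequentially. local_lip (h n) \<in> R"
    using order_tendstoD(2)[OF lim e]
  proof eventually_elim
    case (elim n)
    then show ?case unfolding R_def using h hE local_lip_Lp[OF h] by blast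
  qed
  have ne: "R \<noteq> {}" using eventually_happens'[OF sequentially_bot ev] by blast
  have conv: "(\<lambda>x. (1 - t) * u x + t * v x) \<in> R" if u: "u \<in> R" and v: "v \<in> R" and t: "0 \<le> t" "t \<le> 1" for u v t
  proof -
    obtain k where k: "k \<in> E" "k \<in> lipschitz_functions" "N (\<lambda>x. k x - f x) < e" "\<And>x. local_lip k x \<le> u x"
      using u by (auto simp: R_def)
    obtain l where l: "l \<in> E" "l \<in> lipschitz_functions" "N (\<lambda>x. l x - f x) < e" "\<And>x. local_lip l x \<le> v x"
      using v by (auto simp: R_def)
    have "N (\<lambda>x. (1 - t) * k x + t * l x - f x) = N (\<lambda>x. (1 - t) * (k x - f x) + t * (l x - f x))"
      by (simp add: algebra_simps)
    also have "\<dots> \<le> N (\<lambda>x. (1 - t) * (k x - f x)) + N (\<lambda>x. t * (l x - f x))"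
      using k l f by (intro N_add_le Lp_intros)
    also have "\<dots> = (1 - t) * N (\<lambda>x. k x - f x) + t * N (\<lambda>x. l x - f x)"
      using t by (simp add: N_cmult)
    also have "\<dots> < e"
      using convex_bound_lt[OF k(3) l(3), of "1 - t" t] t by simp
    finally have 1: "N (\<lambda>x. (1 - t) * k x + t * l x - f x) < e" .
    have 2: "local_lip (\<lambda>x. (1 - t) * k x + t * l x) x \<le> (1 - t) * u x + t * v x" for x
    proof -
      have "local_lip (\<lambda>x. (1 - t) * k x + t * l x) x \<le> \<bar>1 - t\<bar> * local_lip k x + \<bar>t\<bar> * local_lip l x"
        by (rule local_lip_lincomb[OF k(2) l(2)])
      also have "\<dots> \<le> (1 - t) * u x + t * v x"
        using t k l by (simp add: add_mono mult_left_mono)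
      finally show ?thesis .
    qed
    have "(\<lambda>x. (1 - t) * u x + t * v x) \<in> E" using u v by (auto simp: R_def intro!: Lp_intros)
    moreover have "(\<lambda>x. (1 - t) * k x + t * l x) \<in> E \<inter> lipschitz_functions"
      using k l by (auto intro!: Lp_intros lipschitz_functions_lincomb)
    ultimately show ?thesis using 1 2
      unfolding R_def by (intro CollectI conjI bexI[of _ "\<lambda>x. (1 - t) * k x + t * l x"] allI) auto
  qed
  have RE: "R \<subseteq> E" by (auto simp: R_def)
  obtain g u where g: "g \<in> E" and u: "\<And>n::nat. u n \<in> R" and ug: "(\<lambda>n. N (\<lambda>x. u n x - g x)) \<longlonglongrightarrow> 0"
    and var: "\<And>w. w \<in> R \<Longrightarrow> N g powr p \<le> (\<integral>x. J g x * w x \<partial>M)"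
    by (rule convex_min_norm[OF RE ne conv]) blast+
  \<comment> \<open>J g is an admissible test function, so the variational inequality for g passes
    to the weak limit and compares the norms of g and G.\<close>
  have "(\<lambda>n. \<integral>x. local_lip (h n) x * J g x \<partial>M) \<longlonglongrightarrow> (\<integral>x. G x * J g x \<partial>M)"
    using w duality_map_in_Lp[OF p_pos(2) g] by (simp add: Lp_converges_weakly_def)
  moreover have "\<forall>\<^sub>F n in sequentially. N g powr p \<le> (\<integral>x. local_lip (h n) x * J g x \<partial>M)"
    using ev by eventually_elim (subst mult.commute, rule var)
  ultimately have "N g powr p \<le> (\<integral>x. G x * J g x \<partial>M)"
    by (intro tendsto_lowerbound) auto
  also have "\<dots> \<le> N g powr (p - 1) * N G"
    using J_Hoelder[OF g G] by (simp add: mult.commute)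
  finally have *: "N g powr p \<le> N g powr (p - 1) * N G" .
  have "N g \<le> N G"
  proof (cases "N g = 0")
    case False
    then have "0 < N g" using Lp_norm_nonneg[of M p g] by linarith
    then have "N g powr p = N g powr (p - 1) * N g" "0 < N g powr (p - 1)"
      by (auto simp: powr_diff)
    then show ?thesis using * by simp
  qed simp
  moreover have "(\<lambda>n. N (u n)) \<longlonglongrightarrow> N g" using u RE by (intro N_tendsto g ug) auto
  ultimately have "\<forall>\<^sub>F n in sequentially. N (u n) < N G + e"
    using e by (intro order_tendstoD(2)) auto
  then obtain n where n: "N (u n) < N G + e" using eventually_happens'[OF sequentially_bot] by blast
  obtain k where k: "k \<in> E" "k \<in> lipschitz_functions" "N (\<lambda>x. k x - f x) < e" "\<And>x. local_lip k x \<le> u n x"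
    using u[of n] by (auto simp: R_def)
  have "N (local_lip k) \<le> N (u n)"
    using k u[of n] RE by (intro N_local_lip_mono) auto
  then show "\<exists>h\<in>E \<inter> lipschitz_functions. N (\<lambda>x. h x - f x) < e \<and> N (local_lip h) < N G + e"
    using k n by force
qed

lemma relaxed_slope_imp_slope_le:
  assumes "relaxed_slope M p f G"
  shows "slope_le f (N G)" "AE x in M. 0 \<le> G x"
proof -
  from assms obtain G' h where G: "G \<in> E" and lip: "\<forall>n::nat. \<exists>C. C-lipschitz_on UNIV (h n)"
    and c: "Lp_converges M p h f" and w: "Lp_converges_weakly M p (\<lambda>n. local_lip (h n)) G'"
    and le: "AE x in M. G' x \<le> G x" unfolding relaxed_slope_def by auto
  have G': "G' \<in> E" using w by (simp add: Lp_converges_weakly_def)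
  have nn: "AE x in M. 0 \<le> G' x" by (rule weak_limit_nonneg[OF w]) (rule local_lip_nonneg)
  then show "AE x in M. 0 \<le> G x" using le by eventually_elim auto
  have "slope_le f (N G')" using lip by (intro slope_le_weak_limit[OF _ c w]) (auto simp: lipschitz_functions_def)
  moreover have "N G' \<le> N G"
    using G G' le nn by (intro Lp_mono(2)) (auto elim!: AE_mp)
  ultimately show "slope_le f (N G)" by (rule slope_le_mono)
qed

lemma Lp_converges_imp_weakly:
  assumes u: "\<And>n. u n \<in> E" and f: "f \<in> E" and lim: "(\<lambda>n. N (\<lambda>x. u n x - f x)) \<longlonglongrightarrow> 0"
  shows "Lp_converges_weakly M p u f"
  unfolding Lp_converges_weakly_def
proof (intro conjI allI ballI u f)
  fix v assume v: "v \<in> Lp M (hoelder_conjugate p)"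
  note i = Lp_Hoelder[OF p_pos(2) v]
  let ?c = "Lp_norm M (hoelder_conjugate p) v"
  have "(\<lambda>n. (\<integral>x. u n x * v x \<partial>M) - (\<integral>x. f x * v x \<partial>M)) \<longlonglongrightarrow> 0"
  proof (rule Lim_null_comparison[OF always_eventually, rule_format])
    show "(\<lambda>n. ?c * N (\<lambda>x. u n x - f x)) \<longlonglongrightarrow> 0" using tendsto_mult_left[OF lim, of ?c] by simp
    fix n
    have "(\<integral>x. u n x * v x \<partial>M) - (\<integral>x. f x * v x \<partial>M) = (\<integral>x. v x * (u n x - f x) \<partial>M)"
      using i(1)[OF u] i(1)[OF f] by (simp add: right_diff_distrib mult.commute)
    then show "norm ((\<integral>x. u n x * v x \<partial>M) - (\<integral>x. f x * v x \<partial>M)) \<le> ?c * N (\<lambda>x. u n x - f x)"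
      using i(2)[OF Lp_diff[OF u f]] by simp
  qed
  then show "(\<lambda>n. \<integral>x. u n x * v x \<partial>M) \<longlonglongrightarrow> (\<integral>x. f x * v x \<partial>M)" by (simp add: LIM_zero_iff)
qed

text \<open>Slopes of nearly optimal Lipschitz approximants converge strongly by uniform convexity,
  hence weakly; the limit is a relaxed slope that attains the bound of
  \<open>relaxed_slope_imp_slope_le\<close>.\<close>

lemma relaxed_slope_exists:
  assumes f: "f \<in> slope_dom"
  obtains G where "relaxed_slope M p f G" "N G = slope f"
proof -
  let ?e = "\<lambda>n. 1 / real (Suc n)"
  let ?S = "\<lambda>e. {h \<in> E \<inter> lipschitz_functions. N (\<lambda>x. h x - f x) < e}"
  have fE: "f \<in> E" using slope_leD[OF slope_le_slope[OF f]] .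
  have "\<exists>h. h \<in> ?S (?e n) \<and> N (local_lip h) < slope f + ?e n" for n
    by (rule slope_leE[OF slope_le_slope[OF f], of "?e n"]) auto
  then have "\<exists>h. \<forall>n. h n \<in> ?S (?e n) \<and> N (local_lip (h n)) < slope f + ?e n"
    by (intro choice allI)
  then obtain h where h: "\<And>n. h n \<in> ?S (?e n)" "\<And>n. N (local_lip (h n)) < slope f + ?e n" by blast
  have hL: "h n \<in> E" "h n \<in> lipschitz_functions" "N (\<lambda>x. h n x - f x) < ?e n" for n using h(1)[of n] by auto
  \<comment> \<open>Infimum of the slope norms over the Lipschitz functions within 1/(n+1) of f.
    These balls are convex, so b k bounds the midpoint norms from below for indices beyond
    k.\<close>
  define b where "b = (\<lambda>n. Inf ((\<lambda>h. N (local_lip h)) ` ?S (?e n)))"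
  have bdd: "bdd_below ((\<lambda>h. N (local_lip h)) ` A)" for A by (auto intro!: bdd_belowI[of _ 0])
  have b_le: "b n \<le> N (local_lip k)" if "k \<in> ?S (?e n)" for n k
    unfolding b_def using that bdd by (intro cInf_lower) auto
  have e0: "?e \<longlonglongrightarrow> 0" by (intro LIMSEQ_Suc lim_1_over_n)
  have "(\<lambda>n. slope f + ?e n) \<longlonglongrightarrow> slope f + 0" by (intro tendsto_add tendsto_const e0)
  then have up: "(\<lambda>n. slope f + ?e n) \<longlonglongrightarrow> slope f" by simp
  have b: "b \<longlonglongrightarrow> slope f"
  proof (rule order_tendstoI)
    fix a assume a: "slope f < a"
    then have "\<forall>\<^sub>F n in sequentially. slope f + ?e n < a" by (rule order_tendstoD(2)[OF up])
    then show "\<forall>\<^sub>F n in sequentially. b n < a"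
      by eventually_elim (rule le_less_trans[OF b_le[OF h(1)] less_trans[OF h(2)]])
  next
    fix a assume a: "a < slope f"
    \<comment> \<open>A level below \<open>slope f\<close> is not admissible, so on some whole ball
      around f all slope norms stay at least a + e.\<close>
    then have "\<not> slope_le f a" by (simp add: slope_le_iff)
    then obtain e where e: "0 < e" "\<And>k. k \<in> ?S e \<Longrightarrow> a + e \<le> N (local_lip k)"
      using fE unfolding slope_le_def by force
    have "\<forall>\<^sub>F n in sequentially. ?e n < e" by (rule order_tendstoD(2)[OF e0 e(1)])
    then show "\<forall>\<^sub>F n in sequentially. a < b n"
    proof eventually_elim
      case (elim n)
      have "a + e \<le> b n" unfolding b_def
      proof (rule cInf_greatest)
        show "(\<lambda>h. N (local_lip h)) ` ?S (?e n) \<noteq> {}" using h(1)[of n] by blast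
        fix y assume "y \<in> (\<lambda>h. N (local_lip h)) ` ?S (?e n)"
        then show "a + e \<le> y" using e(2) elim by force
      qed
      then show ?case using e(1) by linarith
    qed
  qed
  have lim: "(\<lambda>n. N (local_lip (h n))) \<longlonglongrightarrow> slope f"
    by (rule tendsto_sandwich[OF _ _ b up])
      (intro always_eventually allI b_le h(1) less_imp_le[OF h(2)])+
  have mid: "b k \<le> N (\<lambda>x. (local_lip (h m) x + local_lip (h n) x) / 2)" if "k \<le> m" "k \<le> n" for k m n
  proof -
    define w where "w = (\<lambda>x. 1/2 * h m x + 1/2 * h n x)"
    have w: "w \<in> E" "w \<in> lipschitz_functions"
      using hL by (auto simp: w_def simp del: times_divide_eq_left intro!: Lp_intros lipschitz_functions_lincomb)
    have "?e m \<le> ?e k" "?e n \<le> ?e k" using that by (auto intro!: divide_left_mono)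
    then have d: "N (\<lambda>x. h m x - f x) < ?e k" "N (\<lambda>x. h n x - f x) < ?e k"
      using hL(3)[of m] hL(3)[of n] by linarith+
    have "N (\<lambda>x. w x - f x) = N (\<lambda>x. 1/2 * (h m x - f x) + 1/2 * (h n x - f x))"
      by (simp add: w_def algebra_simps)
    also have "\<dots> \<le> N (\<lambda>x. 1/2 * (h m x - f x)) + N (\<lambda>x. 1/2 * (h n x - f x))"
      by (intro N_add_le Lp_cmult Lp_diff hL fE)
    also have "\<dots> = 1/2 * N (\<lambda>x. h m x - f x) + 1/2 * N (\<lambda>x. h n x - f x)"
      unfolding N_cmult by simp
    also have "\<dots> < ?e k" using d by linarith
    finally have "b k \<le> N (local_lip w)" using w by (intro b_le) auto
    also have "\<dots> \<le> N (\<lambda>x. 1/2 * local_lip (h m) x + 1/2 * local_lip (h n) x)"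
    proof (rule N_local_lip_mono[OF w(2)])
      show "local_lip w x \<le> 1/2 * local_lip (h m) x + 1/2 * local_lip (h n) x" for x
        using local_lip_lincomb[OF hL(2) hL(2), of "1/2" m "1/2" n x] by (simp add: w_def)
    qed (intro Lp_add Lp_cmult local_lip_Lp hL)
    finally show ?thesis by (simp add: add_divide_distrib)
  qed
  obtain G where G: "G \<in> E" "(\<lambda>n. N (\<lambda>x. local_lip (h n) x - G x)) \<longlonglongrightarrow> 0" "N G = slope f"
    by (rule N_midpoint_converges[OF local_lip_Lp[OF hL(2)] lim b mid])
  have "(\<lambda>n. N (\<lambda>x. h n x - f x)) \<longlonglongrightarrow> 0"
    by (rule tendsto_sandwich[OF _ _ tendsto_const e0])
      (intro always_eventually allI Lp_norm_nonneg less_imp_le[OF hL(3)])+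
  then have "Lp_converges M p h f" using hL fE by (simp add: Lp_converges_def Lp_dist_def)
  moreover have "Lp_converges_weakly M p (\<lambda>n. local_lip (h n)) G"
    by (rule Lp_converges_imp_weakly[OF local_lip_Lp[OF hL(2)] G(1,2)])
  ultimately have "relaxed_slope M p f G"
    unfolding relaxed_slope_def using fE G hL(2) unfolding lipschitz_functions_def by auto
  then show thesis using G(3) by (rule that)
qed

text \<open>Every minimal relaxed slope has norm \<open>slope f\<close> and is nonnegative almost
  everywhere, so neither the choice inside \<open>cheeger\<close> nor its power without absolute
  value affects the integral.\<close>

lemma cheeger_eq:
  "cheeger M p f = (if f \<in> slope_dom then ereal (slope f powr p / p) else \<infinity>)"
proof (cases "f \<in> slope_dom")
  case True
  have min: "slope f \<le> N G" if "relaxed_slope M p f G" for G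
    using relaxed_slope_imp_slope_le(1)[OF that] by (simp add: slope_le_iff)
  obtain G where G: "relaxed_slope M p f G" "N G = slope f" by (rule relaxed_slope_exists[OF True])
  then have ex: "\<exists>G. minimal_relaxed_slope M p f G"
    unfolding minimal_relaxed_slope_def using min by auto
  define H where "H = (SOME G. minimal_relaxed_slope M p f G)"
  have H: "minimal_relaxed_slope M p f H" unfolding H_def using ex by (rule someI_ex)
  then have Hr: "relaxed_slope M p f H" and "N H \<le> N G"
    using G(1) unfolding minimal_relaxed_slope_def by blast+
  then have HN: "N H = slope f" using G(2) min[OF Hr] by simp
  have [measurable]: "H \<in> borel_measurable M" using Hr by (auto simp: relaxed_slope_def)
  have "(\<integral>x. H x powr p \<partial>M) = (\<integral>x. \<bar>H x\<bar> powr p \<partial>M)"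
    using relaxed_slope_imp_slope_le(2)[OF Hr] by (intro integral_cong_AE) (auto elim!: AE_mp)
  also have "\<dots> = slope f powr p" using HN Lp_norm_powr[OF p_pos(1), of M H] by simp
  finally show ?thesis using ex True unfolding cheeger_def H_def by simp
next
  case False
  then have "\<not> (\<exists>G. minimal_relaxed_slope M p f G)"
    using relaxed_slope_imp_slope_le(1) by (auto simp: minimal_relaxed_slope_def slope_dom_def)
  then show ?thesis using False by (simp add: cheeger_def)
qed

section \<open>Seminorm properties and compactness\<close>

lemma slope_dom_Lp: "f \<in> slope_dom \<Longrightarrow> f \<in> E"
  using slope_leD slope_le_slope by blast

lemma slope_nonneg: "f \<in> slope_dom \<Longrightarrow> 0 \<le> slope f"
  using slope_le_nonneg slope_le_slope by blast

lemma sobolev_eq: "sobolev M p = slope_dom"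
  by (auto simp: sobolev_def cheeger_eq slope_dom_Lp split: if_splits)

lemma slope_lincomb:
  assumes "f \<in> slope_dom" "g \<in> slope_dom"
  shows "(\<lambda>x. s * f x + t * g x) \<in> slope_dom"
    and "slope (\<lambda>x. s * f x + t * g x) \<le> \<bar>s\<bar> * slope f + \<bar>t\<bar> * slope g"
  using slope_le_lincomb[OF slope_le_slope slope_le_slope, OF assms, of s t] by (auto simp: slope_le_iff)

lemma slope_cmult_le:
  assumes "f \<in> slope_dom"
  shows "(\<lambda>x. c * f x) \<in> slope_dom" "slope (\<lambda>x. c * f x) \<le> \<bar>c\<bar> * slope f"
  using slope_lincomb[OF assms assms, of c 0] by auto

lemma slope_cmult:
  assumes f: "f \<in> slope_dom"
  shows "slope (\<lambda>x. c * f x) = \<bar>c\<bar> * slope f"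
proof (cases "c = 0")
  case True
  then show ?thesis using slope_cmult_le[OF f, of 0] slope_nonneg[OF slope_cmult_le(1)[OF f], of 0] by simp
next
  case False
  have "slope (\<lambda>x. (1 / c) * (c * f x)) \<le> \<bar>1 / c\<bar> * slope (\<lambda>x. c * f x)"
    by (intro slope_cmult_le f)
  then have "\<bar>c\<bar> * slope f \<le> slope (\<lambda>x. c * f x)" using False by (simp add: field_simps)
  then show ?thesis using slope_cmult_le(2)[OF f, of c] by simp
qed

lemma slope_uminus:
  assumes "f \<in> slope_dom"
  shows "(\<lambda>x. - f x) \<in> slope_dom" "slope (\<lambda>x. - f x) = slope f"
  using slope_cmult_le(1)[OF assms, of "-1"] slope_cmult[OF assms, of "-1"] by auto

text \<open>The lower limit is replaced by a convergent majorant, which matches the explicit slope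
  bounds of the later arguments.\<close>

lemma slope_lower_semicontinuous:
  assumes "\<And>n. u n \<in> slope_dom" "\<And>n. slope (u n) \<le> a n" "a \<longlonglongrightarrow> b"
    and "f \<in> E" "(\<lambda>n. N (\<lambda>x. u n x - f x)) \<longlonglongrightarrow> 0"
  shows "f \<in> slope_dom" "slope f \<le> b"
  using slope_le_limit[of u a b f] assms by (auto simp: slope_le_iff)

lemma slope_compact:
  assumes ce: "compactly_embedded M p"
    and u: "\<And>n::nat. u n \<in> slope_dom" "\<And>n. N (u n) \<le> R" "\<And>n. slope (u n) \<le> C"
  obtains r f where "strict_mono (r :: nat \<Rightarrow> nat)" "f \<in> slope_dom" "slope f \<le> C"
    "(\<lambda>n. N (\<lambda>x. u (r n) x - f x)) \<longlonglongrightarrow> 0"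
proof -
  have "ereal (N (u n)) + cheeger M p (u n) \<le> ereal (R + C powr p / p)" for n
    using u(1,2,3)[of n] slope_nonneg[OF u(1), of n] p_pos
    by (auto simp: cheeger_eq intro!: add_mono divide_right_mono powr_mono2)
  then have "(SUP n. ereal (N (u n)) + cheeger M p (u n)) \<le> ereal (R + C powr p / p)" by (intro SUP_least)
  then have "(SUP n. ereal (N (u n)) + cheeger M p (u n)) < \<infinity>" by (rule le_less_trans) simp
  then obtain r f where r: "strict_mono (r :: nat \<Rightarrow> nat)" and c: "Lp_converges M p (u \<circ> r) f"
    using ce slope_dom_Lp[OF u(1)] unfolding compactly_embedded_def by blast
  have f: "f \<in> E" and lim: "(\<lambda>n. N (\<lambda>x. u (r n) x - f x)) \<longlonglongrightarrow> 0"
    using c by (auto simp: Lp_converges_def Lp_dist_def)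
  have "f \<in> slope_dom" "slope f \<le> C"
    using slope_lower_semicontinuous[OF u(1) u(3) tendsto_const f lim] by auto
  then show thesis using that r lim by blast
qed

end

section \<open>The topology of \<open>L\<^sup>p\<close> and the genus\<close>

lemma fun_symmetricD:
  assumes "fun_symmetric A" "f \<in> A"
  shows "(\<lambda>x. - f x) \<in> A"
proof -
  have "(\<lambda>x. - f x) \<in> (\<lambda>f x. - f x) ` A" using assms(2) by blast
  then show ?thesis using assms(1) by (simp add: fun_symmetric_def)
qed

lemma fun_symmetricI:
  assumes "\<And>f. f \<in> A \<Longrightarrow> (\<lambda>x. - f x) \<in> A"
  shows "fun_symmetric A"
  unfolding fun_symmetric_def
proof (intro equalityI subsetI)
  fix f assume f: "f \<in> A"
  then have "(\<lambda>x. - (\<lambda>x. - f x) x) \<in> (\<lambda>f x. - f x) ` A" using assms by (intro imageI)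
  then show "f \<in> (\<lambda>f x. - f x) ` A" by simp
qed (use assms in auto)

context Lp_space
begin

abbreviation converges :: "(nat \<Rightarrow> 'a \<Rightarrow> real) \<Rightarrow> ('a \<Rightarrow> real) \<Rightarrow> bool" where
  "converges u f \<equiv> (\<lambda>n. N (\<lambda>x. u n x - f x)) \<longlonglongrightarrow> 0"

abbreviation T :: "('a \<Rightarrow> real) topology" where "T \<equiv> Lp_topology M p"

lemma converges_uminus: "converges u f \<Longrightarrow> converges (\<lambda>n x. - u n x) (\<lambda>x. - f x)"
proof -
  have "(\<lambda>x. - u n x - - f x) = (\<lambda>x. - (u n x - f x))" for n by auto
  then show "converges u f \<Longrightarrow> ?thesis" by (simp only: N_uminus)
qed

lemma converges_unique:
  assumes "\<And>n. u n \<in> E" "f \<in> E" "g \<in> E" "converges u f" "converges u g"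
  shows "N (\<lambda>x. f x - g x) = 0"
proof -
  have "(\<lambda>n. N (\<lambda>x. u n x - f x) + N (\<lambda>x. u n x - g x)) \<longlonglongrightarrow> 0 + 0"
    by (intro tendsto_add assms)
  then have "N (\<lambda>x. f x - g x) \<le> 0 + 0"
  proof (rule LIMSEQ_le_const, intro exI allI impI)
    show "N (\<lambda>x. f x - g x) \<le> N (\<lambda>x. u n x - f x) + N (\<lambda>x. u n x - g x)" for n
      using N_triangle[of f "u n" g] assms(1-3) N_diff_commute[of f "u n"] by simp
  qed
  then show ?thesis using Lp_norm_nonneg[of M p "\<lambda>x. f x - g x"] by simp
qed

lemma converges_approx:
  assumes "\<And>e. 0 < e \<Longrightarrow> \<exists>g\<in>A. N (\<lambda>x. g x - f x) < e"
  obtains u where "\<And>n::nat. u n \<in> A" "converges u f"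
proof -
  have "\<exists>g. g \<in> A \<and> N (\<lambda>x. g x - f x) < 1 / real (Suc n)" for n
    using assms[of "1 / real (Suc n)"] by auto
  then have "\<exists>u. \<forall>n. u n \<in> A \<and> N (\<lambda>x. u n x - f x) < 1 / real (Suc n)" by (intro choice allI)
  then obtain u where u: "\<And>n. u n \<in> A" "\<And>n. N (\<lambda>x. u n x - f x) < 1 / real (Suc n)" by blast
  have "converges u f"
    by (rule tendsto_sandwich[OF _ _ tendsto_const LIMSEQ_Suc[OF lim_1_over_n]])
      (intro always_eventually allI Lp_norm_nonneg less_imp_le[OF u(2)])+
  then show thesis using that u(1) by blast
qed

lemma openin_ball:
  assumes f: "f \<in> E"
  shows "openin T {g \<in> E. N (\<lambda>x. g x - f x) < e}"
  unfolding openin_Lp_topology Lp_dist_def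
proof (intro conjI ballI)
  fix g assume g: "g \<in> {g \<in> E. N (\<lambda>x. g x - f x) < e}"
  then show "\<exists>d>0. \<forall>h\<in>E. N (\<lambda>x. h x - g x) < d \<longrightarrow> h \<in> {g \<in> E. N (\<lambda>x. g x - f x) < e}"
    using N_triangle[OF _ _ f, of _ g]
    by (intro exI[of _ "e - N (\<lambda>x. g x - f x)"]) fastforce
qed auto

lemma closedin_ball_avoids:
  assumes "closedin T A" "f \<in> E" "f \<notin> A"
  obtains e where "0 < e" "\<And>g. g \<in> A \<Longrightarrow> e \<le> N (\<lambda>x. g x - f x)"
proof -
  have A: "A \<subseteq> E" using assms(1) by (simp add: closedin_def topspace_Lp_topology)
  have "openin T (E - A)" using assms(1) by (simp add: closedin_def topspace_Lp_topology)
  then obtain e where "e > 0" "\<forall>g\<in>E. N (\<lambda>x. g x - f x) < e \<longrightarrow> g \<in> E - A"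
    using assms unfolding openin_Lp_topology Lp_dist_def by blast
  then show thesis using that A by (meson DiffD2 not_le subsetD)
qed

lemma closedin_limit:
  assumes A: "closedin T A" and u: "\<And>n::nat. u n \<in> A" and f: "f \<in> E" and c: "converges u f"
  shows "f \<in> A"
proof (rule ccontr)
  assume "f \<notin> A"
  then obtain e where e: "0 < e" "\<And>g. g \<in> A \<Longrightarrow> e \<le> N (\<lambda>x. g x - f x)"
    using closedin_ball_avoids[OF A f] by blast
  have "e \<le> 0" by (rule LIMSEQ_le_const[OF c]) (use e u in auto)
  then show False using e by simp
qed

lemma closedin_sequentialI:
  assumes A: "A \<subseteq> E"
    and lim: "\<And>u f. (\<And>n::nat. u n \<in> A) \<Longrightarrow> f \<in> E \<Longrightarrow> converges u f \<Longrightarrow> f \<in> A"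
  shows "closedin T A"
  unfolding closedin_def topspace_Lp_topology openin_Lp_topology Lp_dist_def
proof (intro conjI ballI A)
  fix f assume f: "f \<in> E - A"
  show "\<exists>e>0. \<forall>g\<in>E. N (\<lambda>x. g x - f x) < e \<longrightarrow> g \<in> E - A"
  proof (rule ccontr)
    assume "\<not> ?thesis"
    then have "\<exists>g\<in>A. N (\<lambda>x. g x - f x) < e" if "0 < e" for e using that by blast
    then obtain u where "\<And>n::nat. u n \<in> A" "converges u f" using converges_approx by blast
    then have "f \<in> A" using lim f by blast
    then show False using f by blast
  qed
qed auto

text \<open>Each closed set is covered by balls of radius at most half the distance of the centre to
  the other set, and the triangle inequality separates the two unions. The argument fits the
  pseudometric topology on functions; normality is what Tietze's theorem asks for.\<close>

lemma normal_space_Lp_topology: "normal_space T"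
  unfolding normal_space_def
proof (intro allI impI, elim conjE)
  fix A B assume A: "closedin T A" and B: "closedin T B" and AB: "disjnt A B"
  have sub: "A \<subseteq> E" "B \<subseteq> E" using A B by (auto simp: closedin_def topspace_Lp_topology)
  define V where "V = (\<lambda>A B. \<Union>{{g \<in> E. N (\<lambda>x. g x - s x) < r} | s r. s \<in> A \<and> 0 < r \<and> (\<forall>t\<in>B. 2 * r \<le> N (\<lambda>x. t x - s x))})"
  have op: "openin T (V A B)" if "A \<subseteq> E" for A B
    unfolding V_def using that openin_ball by (intro openin_Union) blast
  have cov: "A \<subseteq> V A B" if sep: "A \<subseteq> E" "closedin T B" "disjnt A B" for A B
  proof
    fix s assume s: "s \<in> A"
    then have "s \<in> E" "s \<notin> B" using sep by (auto simp: disjnt_iff)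
    then obtain e where e: "0 < e" "\<And>g. g \<in> B \<Longrightarrow> e \<le> N (\<lambda>x. g x - s x)"
      using closedin_ball_avoids[OF sep(2)] by blast
    have "s \<in> {g \<in> E. N (\<lambda>x. g x - s x) < e / 2}" using \<open>s \<in> E\<close> e by (simp add: N_zero)
    moreover have "0 < e / 2" "\<forall>t\<in>B. 2 * (e / 2) \<le> N (\<lambda>x. t x - s x)" using e by auto
    ultimately show "s \<in> V A B" unfolding V_def using s by blast
  qed
  have "disjnt (V A B) (V B A)"
    unfolding disjnt_iff
  proof (intro allI notI, elim conjE)
    fix g assume "g \<in> V A B" "g \<in> V B A"
    then obtain s r t r' where st: "s \<in> A" "t \<in> B" "g \<in> E" "N (\<lambda>x. g x - s x) < r" "N (\<lambda>x. g x - t x) < r'"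
      "2 * r \<le> N (\<lambda>x. t x - s x)" "2 * r' \<le> N (\<lambda>x. s x - t x)"
      unfolding V_def by blast
    then have "N (\<lambda>x. t x - s x) \<le> N (\<lambda>x. t x - g x) + N (\<lambda>x. g x - s x)"
      using sub by (intro N_triangle) auto
    then show False
      using st(4-7) N_diff_commute[of t g] N_diff_commute[of s t] by linarith
  qed
  then show "\<exists>U V. openin T U \<and> openin T V \<and> A \<subseteq> U \<and> B \<subseteq> V \<and> disjnt U V"
    using op[OF sub(1)] op[OF sub(2)] cov[OF sub(1) B AB] cov[OF sub(2) A] AB
    by (intro exI[of _ "V A B"] exI[of _ "V B A"]) (auto simp: disjnt_sym)
qed

lemma continuous_map_limit_sequence:
  assumes A: "A \<subseteq> E" and c: "continuous_map (subtopology T A) euclideanreal \<phi>"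
    and u: "\<And>n::nat. u n \<in> A" and f: "f \<in> A" and lim: "converges u f"
  shows "(\<lambda>n. \<phi> (u n)) \<longlonglongrightarrow> \<phi> f"
proof (rule topological_tendstoI)
  fix S :: "real set" assume S: "open S" "\<phi> f \<in> S"
  have ts: "topspace (subtopology T A) = A" using A by (auto simp: topspace_Lp_topology)
  have "openin (subtopology T A) {x \<in> A. \<phi> x \<in> S}"
    using c S unfolding continuous_map_def ts by auto
  then obtain U where U: "openin T U" "{x \<in> A. \<phi> x \<in> S} = U \<inter> A" unfolding openin_subtopology by blast
  have "f \<in> U" using U(2) S(2) f by blast
  then obtain e where e: "e > 0" "\<forall>g\<in>E. N (\<lambda>x. g x - f x) < e \<longrightarrow> g \<in> U"
    using U(1) unfolding openin_Lp_topology Lp_dist_def by blast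
  show "\<forall>\<^sub>F n in sequentially. \<phi> (u n) \<in> S"
    using order_tendstoD(2)[OF lim e(1)] by eventually_elim (use e(2) u A U(2) in blast)
qed

text \<open>Sequences detect continuity in a pseudometric topology; all later continuity proofs can
  thus be carried out with norm convergence.\<close>

lemma continuous_map_sequentialI:
  assumes A: "A \<subseteq> E"
    and lim: "\<And>u f. (\<And>n::nat. u n \<in> A) \<Longrightarrow> f \<in> A \<Longrightarrow> converges u f \<Longrightarrow> (\<lambda>n. \<phi> (u n)) \<longlonglongrightarrow> \<phi> f"
  shows "continuous_map (subtopology T A) euclideanreal \<phi>"
  unfolding continuous_map_def
proof (intro conjI allI impI)
  have ts: "topspace (subtopology T A) = A" using A by (auto simp: topspace_Lp_topology)
  fix S :: "real set" assume S: "openin euclideanreal S"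
  show "openin (subtopology T A) {f \<in> topspace (subtopology T A). \<phi> f \<in> S}"
    unfolding ts
  proof (subst openin_subopen, intro ballI)
    fix f assume f: "f \<in> {f \<in> A. \<phi> f \<in> S}"
    have "\<exists>e>0. \<forall>g\<in>A. N (\<lambda>x. g x - f x) < e \<longrightarrow> \<phi> g \<in> S"
    proof (rule ccontr)
      assume "\<not> ?thesis"
      then have "\<exists>g\<in>{g \<in> A. \<phi> g \<notin> S}. N (\<lambda>x. g x - f x) < e" if "0 < e" for e using that by blast
      then obtain u where u: "\<And>n::nat. u n \<in> {g \<in> A. \<phi> g \<notin> S}" "converges u f"
        using converges_approx by blast
      then have "(\<lambda>n. \<phi> (u n)) \<longlonglongrightarrow> \<phi> f" using f by (intro lim) auto
      then have "\<forall>\<^sub>F n in sequentially. \<phi> (u n) \<in> S" using S f by (auto dest: topological_tendstoD)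
      then show False using u(1) eventually_happens'[OF sequentially_bot] by blast
    qed
    then obtain e where e: "e > 0" "\<And>g. g \<in> A \<Longrightarrow> N (\<lambda>x. g x - f x) < e \<Longrightarrow> \<phi> g \<in> S" by blast
    have "openin (subtopology T A) ({g \<in> E. N (\<lambda>x. g x - f x) < e} \<inter> A)"
      using openin_ball f A by (auto simp: openin_subtopology)
    moreover have "f \<in> {g \<in> E. N (\<lambda>x. g x - f x) < e} \<inter> A" using f A e(1) by (auto simp: N_zero)
    ultimately show "\<exists>U. openin (subtopology T A) U \<and> f \<in> U \<and> U \<subseteq> {f \<in> A. \<phi> f \<in> S}"
      using e(2) by (intro exI[of _ "{g \<in> E. N (\<lambda>x. g x - f x) < e} \<inter> A"]) auto
  qed
qed auto

section \<open>Odd maps and the genus\<close>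

lemma odd_map_to_puncturedI:
  assumes A: "A \<subseteq> E"
    and lim: "\<And>u f i. (\<And>n::nat. u n \<in> A) \<Longrightarrow> f \<in> A \<Longrightarrow> converges u f \<Longrightarrow> (\<lambda>n. h (u n) i) \<longlonglongrightarrow> h f i"
    and z: "\<And>f i. f \<in> A \<Longrightarrow> m \<le> i \<Longrightarrow> h f i = 0"
    and nz: "\<And>f. f \<in> A \<Longrightarrow> h f \<noteq> (\<lambda>i. 0)"
    and od: "\<And>f i. f \<in> A \<Longrightarrow> h (\<lambda>x. - f x) i = - h f i"
  shows "odd_map_to_punctured M p A m h"
  unfolding odd_map_to_punctured_def
proof (intro conjI ballI ext od)
  have ts: "topspace (subtopology T A) = A" using A by (auto simp: topspace_Lp_topology)
  have "continuous_map (subtopology T A) (powertop_real UNIV) h"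
    unfolding continuous_map_componentwise_UNIV using lim
    by (intro allI continuous_map_sequentialI A) auto
  then show "continuous_map (subtopology T A) (subtopology (Euclidean_space m) (- {\<lambda>i. 0})) h"
    using z nz unfolding Euclidean_space_def continuous_map_in_subtopology ts by auto
qed

lemma odd_map_to_puncturedD:
  assumes A: "A \<subseteq> E" and h: "odd_map_to_punctured M p A m h"
  shows "continuous_map (subtopology T A) euclideanreal (\<lambda>f. h f i)"
    and "f \<in> A \<Longrightarrow> m \<le> i \<Longrightarrow> h f i = 0"
    and "f \<in> A \<Longrightarrow> h f \<noteq> (\<lambda>i. 0)"
    and "f \<in> A \<Longrightarrow> h (\<lambda>x. - f x) = (\<lambda>i. - h f i)"
proof -
  have ts: "topspace (subtopology T A) = A" using A by (auto simp: topspace_Lp_topology)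
  have c: "continuous_map (subtopology T A) (subtopology (Euclidean_space m) (- {\<lambda>i. 0})) h"
    and o: "\<And>f. f \<in> A \<Longrightarrow> h (\<lambda>x. - f x) = (\<lambda>i. - h f i)"
    using h unfolding odd_map_to_punctured_def by auto
  then show "f \<in> A \<Longrightarrow> h (\<lambda>x. - f x) = (\<lambda>i. - h f i)" by blast
  have c': "continuous_map (subtopology T A) (powertop_real UNIV) h" "h ` A \<subseteq> {x. \<forall>i\<ge>m. x i = 0}"
    "h ` A \<subseteq> - {\<lambda>i. 0}"
    using c unfolding Euclidean_space_def continuous_map_in_subtopology ts by auto
  show "continuous_map (subtopology T A) euclideanreal (\<lambda>f. h f i)"
    using c'(1) unfolding continuous_map_componentwise_UNIV by blast
  show "f \<in> A \<Longrightarrow> m \<le> i \<Longrightarrow> h f i = 0" "f \<in> A \<Longrightarrow> h f \<noteq> (\<lambda>i. 0)"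
    using c'(2,3) unfolding image_subset_iff by auto
qed

text \<open>Tietze extends each coordinate, and taking the odd part restores the symmetry without
  changing the values on A. Outside A the extension may vanish.\<close>

lemma odd_extension:
  assumes A: "closedin T A" and h: "odd_map_to_punctured M p A m h" and sym: "fun_symmetric A"
  obtains H where "\<And>u f i. (\<And>n::nat. u n \<in> E) \<Longrightarrow> f \<in> E \<Longrightarrow> converges u f \<Longrightarrow> (\<lambda>n. H (u n) i) \<longlonglongrightarrow> H f i"
    "\<And>f i. H (\<lambda>x. - f x) i = - H f i" "\<And>f i. m \<le> i \<Longrightarrow> H f i = (0::real)" "\<And>f. f \<in> A \<Longrightarrow> H f = h f"
proof -
  have AE: "A \<subseteq> E" using A by (simp add: closedin_def topspace_Lp_topology)
  note hD = odd_map_to_puncturedD[OF AE h]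
  have "\<exists>g. continuous_map T euclideanreal g \<and> (\<forall>f\<in>A. g f = h f i)" for i
    by (rule Tietze_extension_realinterval[OF normal_space_Lp_topology A is_interval_univ UNIV_not_empty hD(1)[of i] subset_UNIV])
      (intro exI conjI ballI)
  then have "\<exists>g. \<forall>i. continuous_map T euclideanreal (g i) \<and> (\<forall>f\<in>A. g i f = h f i)" by (intro choice allI)
  then obtain g where g: "\<And>i. continuous_map T euclideanreal (g i)" "\<And>i f. f \<in> A \<Longrightarrow> g i f = h f i" by blast
  have lim: "(\<lambda>n. g i (u n)) \<longlonglongrightarrow> g i f" if "\<And>n::nat. u n \<in> E" "f \<in> E" "converges u f" for u f i
    by (rule continuous_map_limit_sequence[OF order_refl continuous_map_from_subtopology[OF g(1)] that])
  define H where "H = (\<lambda>f i. if m \<le> i then 0 else (g i f - g i (\<lambda>x. - f x)) / 2)"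
  show thesis
  proof (rule that[of H])
    fix u f i assume *: "\<And>n::nat. u n \<in> E" "f \<in> E" "converges u f"
    have "(\<lambda>n. g i (\<lambda>x. - u n x)) \<longlonglongrightarrow> g i (\<lambda>x. - f x)"
      using * by (intro lim Lp_uminus converges_uminus)
    then show "(\<lambda>n. H (u n) i) \<longlonglongrightarrow> H f i"
      using lim[OF *, of i] by (auto simp: H_def intro!: tendsto_intros)
  next
    fix f assume f: "f \<in> A"
    show "H f = h f"
    proof
      fix i show "H f i = h f i"
        using f fun_symmetricD[OF sym f] by (simp add: H_def hD(2) g(2) hD(4))
    qed
  qed (simp_all add: H_def field_simps)
qed

text \<open>Absorbs the special case of the empty set in \<open>genus\<close>: the punctured space
  of dimension 0 is empty and receives an odd map from the empty set.\<close>

lemma genus_less_iff: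
  assumes A: "A \<subseteq> E" and n: "0 < n"
  shows "genus M p A < enat n \<longleftrightarrow> (\<exists>m<n. \<exists>h. odd_map_to_punctured M p A m h)"
proof (cases "A = {}")
  case True
  then have "odd_map_to_punctured M p A 0 (\<lambda>_ _. 0)" by (intro odd_map_to_puncturedI) auto
  then have "\<exists>m<n. \<exists>h. odd_map_to_punctured M p A m h" using n by blast
  then show ?thesis using True n by (simp add: genus_def zero_enat_def)
next
  case False
  then have "genus M p A < enat n \<longleftrightarrow> (\<exists>a\<in>{enat m | m. \<exists>h. odd_map_to_punctured M p A m h}. a < enat n)"
    by (simp add: genus_def Inf_less_iff)
  also have "\<dots> \<longleftrightarrow> (\<exists>m<n. \<exists>h. odd_map_to_punctured M p A m h)"
    using enat_ord_simps(2)[of _ n] by blast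
  finally show ?thesis .
qed

lemma genus_mono:
  assumes AB: "A \<subseteq> B" and B: "B \<subseteq> E"
  shows "genus M p A \<le> genus M p B"
proof (rule ccontr)
  assume "\<not> ?thesis"
  then have less: "genus M p B < genus M p A" by simp
  then obtain n where n: "genus M p B = enat n" by (cases "genus M p B") auto
  have "genus M p B < enat (Suc n)" by (simp add: n)
  then obtain m h where m: "m < Suc n" "odd_map_to_punctured M p B m h"
    using genus_less_iff[OF B, of "Suc n"] by auto
  have "odd_map_to_punctured M p A m h"
    using m(2) AB continuous_map_from_subtopology_mono[of T B _ h A] unfolding odd_map_to_punctured_def by blast
  then have "genus M p A < enat (Suc n)"
    using genus_less_iff[OF order_trans[OF AB B], of "Suc n"] m(1) by auto
  then show False using less n by (cases "genus M p A") auto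
qed

lemma N_cong:
  assumes "f \<in> E" "g \<in> E" "N (\<lambda>x. f x - g x) = 0"
  shows "N f = N g"
  using N_diff_ge[OF assms(1,2)] assms(3) by simp

text \<open>The constant sequence f converges to every g at distance 0, so continuity identifies the
  two values.\<close>

lemma odd_map_congruent:
  assumes A: "A \<subseteq> E" and h: "odd_map_to_punctured M p A m h"
    and f: "f \<in> A" "g \<in> A" "N (\<lambda>x. f x - g x) = 0"
  shows "h f = h g"
proof
  fix i
  have "(\<lambda>n::nat. h f i) \<longlonglongrightarrow> h g i"
    using f by (intro continuous_map_limit_sequence[OF A odd_map_to_puncturedD(1)[OF A h]]) auto
  then show "h f i = h g i" by (simp add: LIMSEQ_const_iff)
qed

lemma Lp_class_eqI:
  assumes "f \<in> E" "g \<in> E" "N (\<lambda>x. f x - g x) = 0"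
  shows "Lp_class M p f = Lp_class M p g"
proof -
  have "AE x in M. f x - g x = 0" using N_eq_0_iff[OF Lp_diff[OF assms(1,2)]] assms(3) by simp
  then have ae: "AE x in M. f x = g x" by eventually_elim simp
  have "(AE x in M. h x = f x) \<longleftrightarrow> (AE x in M. h x = g x)" for h
  proof
    assume "AE x in M. h x = f x"
    then show "AE x in M. h x = g x" using ae by eventually_elim simp
  next
    assume "AE x in M. h x = g x"
    then show "AE x in M. h x = f x" using ae by eventually_elim simp
  qed
  then show ?thesis by (simp add: Lp_class_def)
qed

lemma Lp_class_eqD:
  assumes f: "f \<in> E" and g: "g \<in> E" and eq: "Lp_class M p f = Lp_class M p g"
  shows "N (\<lambda>x. f x - g x) = 0"
proof -
  have "f \<in> Lp_class M p f" using f by (simp add: Lp_class_def)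
  then have "f \<in> Lp_class M p g" unfolding eq .
  then have "AE x in M. f x = g x" by (simp add: Lp_class_def)
  then have "AE x in M. f x - g x = 0" by eventually_elim simp
  then show ?thesis using N_eq_0_iff[OF Lp_diff[OF f g]] by simp
qed

text \<open>With finitely many classes the set is discrete up to null modifications, so a sign can
  be chosen oddly and continuously; this is an odd map into the nonzero reals.\<close>

lemma genus_finite_classes:
  assumes K: "K \<subseteq> E" and sym: "\<And>f. f \<in> K \<Longrightarrow> (\<lambda>x. - f x) \<in> K" and nz: "\<And>f. f \<in> K \<Longrightarrow> N f \<noteq> 0"
    and fin: "finite (Lp_class M p ` K)"
  shows "genus M p K < enat 2"
proof -
  let ?c = "Lp_class M p"
  obtain idx :: "('a \<Rightarrow> real) set \<Rightarrow> nat" where inj: "inj_on idx (?c ` K)"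
    using finite_imp_inj_to_nat_seg[OF fin] by blast
  \<comment> \<open>Comparing the indices of the classes of f and -f picks the sign. It flips under
    f \<mapsto> -f because the two classes, hence their indices, differ.\<close>
  define s where "s = (\<lambda>f. if idx (?c f) < idx (?c (\<lambda>x. - f x)) then 1 else (-1::real))"
  define h where "h = (\<lambda>f (i::nat). if i = 0 then s f else 0)"
  have ne: "idx (?c f) \<noteq> idx (?c (\<lambda>x. - f x))" if f: "f \<in> K" for f
  proof
    assume "idx (?c f) = idx (?c (\<lambda>x. - f x))"
    then have "?c f = ?c (\<lambda>x. - f x)" using inj f sym[OF f] by (auto dest: inj_onD)
    then have "N (\<lambda>x. f x - - f x) = 0" using f K sym[OF f] by (intro Lp_class_eqD) auto
    moreover have "N (\<lambda>x. f x - - f x) = 2 * N f" using N_cmult[of 2 f] by simp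
    ultimately show False using nz[OF f] by simp
  qed
  have isolated: "\<exists>d>0. \<forall>g\<in>K. N (\<lambda>x. g x - f x) < d \<longrightarrow> N (\<lambda>x. g x - f x) = 0" if f: "f \<in> K" for f
  proof -
    let ?D = "(\<lambda>g. N (\<lambda>x. g x - f x)) ` K"
    \<comment> \<open>A distance to f depends only on the class, so finitely many values occur and
      the positive ones have a minimum.\<close>
    have "?D \<subseteq> (\<lambda>X. N (\<lambda>x. (SOME g. g \<in> X) x - f x)) ` (?c ` K)"
    proof
      fix d assume "d \<in> ?D"
      then obtain g where g: "g \<in> K" "d = N (\<lambda>x. g x - f x)" by blast
      define g' where "g' = (SOME g'. g' \<in> ?c g)"
      have "g \<in> ?c g" using g(1) K by (auto simp: Lp_class_def)
      then have "g' \<in> ?c g" unfolding g'_def by (rule someI[where P="\<lambda>g'. g' \<in> ?c g"])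
      then have g': "g' \<in> E" "AE x in M. g' x = g x" by (auto simp: Lp_class_def)
      have "AE x in M. g' x - f x = g x - f x" using g'(2) by eventually_elim simp
      then have "N (\<lambda>x. g' x - f x) = d"
        unfolding g(2) using g' g(1) f K by (intro Lp_norm_cong_AE) (auto intro!: Lp_measurable Lp_diff)
      then show "d \<in> (\<lambda>X. N (\<lambda>x. (SOME g. g \<in> X) x - f x)) ` (?c ` K)"
        using g(1) unfolding g'_def by blast
    qed
    then have finD: "finite ?D" using fin by (meson finite_imageI finite_subset)
    \<comment> \<open>The inserted 1 covers the case without positive distances.\<close>
    define d where "d = Min (insert 1 {d \<in> ?D. 0 < d})"
    have "0 < d" unfolding d_def using finD by (subst Min_gr_iff) auto
    moreover have "N (\<lambda>x. g x - f x) = 0" if g: "g \<in> K" "N (\<lambda>x. g x - f x) < d" for g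
    proof (rule ccontr)
      assume "N (\<lambda>x. g x - f x) \<noteq> 0"
      then have "0 < N (\<lambda>x. g x - f x)" using Lp_norm_nonneg[of M p "\<lambda>x. g x - f x"] by linarith
      then have "d \<le> N (\<lambda>x. g x - f x)" unfolding d_def using finD g(1) by (intro Min_le) auto
      then show False using g(2) by linarith
    qed
    ultimately show ?thesis by blast
  qed
  have "odd_map_to_punctured M p K 1 h"
  proof (rule odd_map_to_puncturedI[OF K])
    fix u f i assume u: "\<And>n::nat. u n \<in> K" and f: "f \<in> K" and lim: "converges u f"
    obtain d where d: "0 < d" "\<And>g. g \<in> K \<Longrightarrow> N (\<lambda>x. g x - f x) < d \<Longrightarrow> N (\<lambda>x. g x - f x) = 0"
      using isolated[OF f] by blast
    have "\<forall>\<^sub>F n in sequentially. h (u n) i = h f i"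
      using order_tendstoD(2)[OF lim d(1)]
    proof eventually_elim
      case (elim n)
      have 0: "N (\<lambda>x. u n x - f x) = 0" by (rule d(2)[OF u elim])
      then have 1: "N (\<lambda>x. - u n x - - f x) = 0"
        using N_uminus[of "\<lambda>x. u n x - f x"] by simp
      have "?c (u n) = ?c f" using u f K 0 by (intro Lp_class_eqI) auto
      moreover have "?c (\<lambda>x. - u n x) = ?c (\<lambda>x. - f x)" using u f K 1 sym by (intro Lp_class_eqI) auto
      ultimately show ?case by (simp add: h_def s_def)
    qed
    then show "(\<lambda>n. h (u n) i) \<longlonglongrightarrow> h f i" by (rule tendsto_eventually)
  next
    fix f show "h f \<noteq> (\<lambda>i. 0)" by (auto simp: h_def s_def fun_eq_iff)
  next
    fix f i assume "f \<in> K"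
    then show "h (\<lambda>x. - f x) i = - h f i" using ne[of f] by (auto simp: h_def s_def)
  qed (auto simp: h_def)
  then show ?thesis using genus_less_iff[OF K, of 2] by (meson one_less_numeral_iff semiring_norm(76) zero_less_numeral)
qed

end

section \<open>The proximal map\<close>

context Lp_metric_space
begin

definition energy :: "('a \<Rightarrow> real) \<Rightarrow> ('a \<Rightarrow> real) \<Rightarrow> real" where
  "energy f g = slope g powr p + N (\<lambda>x. g x - f x) powr p"

text \<open>A predicate and not a function, since minimizers are determined only up to null
  sets.\<close>

definition is_prox :: "('a \<Rightarrow> real) \<Rightarrow> ('a \<Rightarrow> real) \<Rightarrow> bool" where
  "is_prox f g \<longleftrightarrow> g \<in> slope_dom \<and> (\<forall>h\<in>slope_dom. energy f g \<le> energy f h)"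

lemma is_proxD: "is_prox f g \<Longrightarrow> g \<in> slope_dom" "is_prox f g \<Longrightarrow> h \<in> slope_dom \<Longrightarrow> energy f g \<le> energy f h"
  by (auto simp: is_prox_def)

lemma energy_nonneg: "0 \<le> energy f g"
  by (simp add: energy_def)

lemma zero_slope_dom: "(\<lambda>x. 0) \<in> slope_dom" and slope_zero: "slope (\<lambda>x. 0) = 0"
proof -
  have "(0::real)-lipschitz_on UNIV (\<lambda>x::'a. 0::real)" by (simp add: lipschitz_on_def)
  then have z: "(\<lambda>x::'a. 0::real) \<in> lipschitz_functions" by (auto simp: lipschitz_functions_def)
  have "local_lip (\<lambda>x::'a. 0::real) x = 0" for x
    using local_lip_le_lipschitz[OF \<open>0-lipschitz_on UNIV (\<lambda>x::'a. 0::real)\<close>] local_lip_nonneg[of "\<lambda>x::'a. 0::real" x]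
    by (simp add: antisym)
  then have "local_lip (\<lambda>x::'a. 0::real) = (\<lambda>x. 0)" by auto
  then have "slope_le (\<lambda>x. 0) 0"
    unfolding slope_le_def using z by (auto simp: Lp_zero N_zero intro!: bexI[of _ "\<lambda>x::'a. 0::real"])
  then show "(\<lambda>x. 0) \<in> slope_dom" "slope (\<lambda>x. 0) = 0"
    using slope_nonneg[of "\<lambda>x. 0"] by (auto simp: slope_le_iff)
qed

text \<open>Clarkson acts on the distance term and convexity of z^p on the slope term. The gain is
  the uniform convexity behind existence, uniqueness and continuity of proximal points.\<close>

lemma energy_midpoint:
  assumes g: "g \<in> slope_dom" and h: "h \<in> slope_dom" and f: "f \<in> E"
  obtains w where "w \<in> slope_dom"
    "energy f w + N (\<lambda>x. (g x - h x) / 2) powr p \<le> (energy f g + energy f h) / 2"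
proof -
  define w where "w = (\<lambda>x. 1/2 * g x + 1/2 * h x)"
  have w: "w \<in> slope_dom" unfolding w_def by (intro slope_lincomb g h)
  have gh: "g \<in> E" "h \<in> E" using slope_dom_Lp g h by auto
  have "slope w \<le> \<bar>1/2\<bar> * slope g + \<bar>1/2\<bar> * slope h" unfolding w_def by (intro slope_lincomb g h)
  then have "slope w powr p \<le> (1/2 * slope g + (1 - 1/2) * slope h) powr p"
    using slope_nonneg[OF w] p_pos by (intro powr_mono2) auto
  also have "\<dots> \<le> 1/2 * slope g powr p + (1 - 1/2) * slope h powr p"
    using slope_nonneg[OF g] slope_nonneg[OF h] p_pos by (intro powr_convex_comb) auto
  finally have 1: "slope w powr p \<le> 1/2 * slope g powr p + 1/2 * slope h powr p" by simp
  have eq: "(\<lambda>x. (g x - f x + (h x - f x)) / 2) = (\<lambda>x. w x - f x)" "(\<lambda>x. (g x - f x - (h x - f x)) / 2) = (\<lambda>x. (g x - h x) / 2)"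
    by (auto simp: w_def field_simps)
  have 2: "N (\<lambda>x. w x - f x) powr p + N (\<lambda>x. (g x - h x) / 2) powr p
      \<le> (N (\<lambda>x. g x - f x) powr p + N (\<lambda>x. h x - f x) powr p) / 2"
    using N_Clarkson[OF Lp_diff[OF gh(1) f] Lp_diff[OF gh(2) f]] unfolding eq .
  have "energy f w + N (\<lambda>x. (g x - h x) / 2) powr p \<le> (energy f g + energy f h) / 2"
    using 1 2 unfolding energy_def by argo
  then show thesis using that w by blast
qed

text \<open>The midpoint cannot beat the minimizer, so the energy excess of a competitor controls
  its distance to the minimizer.\<close>

lemma prox_midpoint:
  assumes g: "is_prox f g" and h: "h \<in> slope_dom" and f: "f \<in> E"
  shows "N (\<lambda>x. (g x - h x) / 2) powr p \<le> (energy f h - energy f g) / 2"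
proof -
  obtain w where "w \<in> slope_dom" "energy f w + N (\<lambda>x. (g x - h x) / 2) powr p \<le> (energy f g + energy f h) / 2"
    by (rule energy_midpoint[OF is_proxD(1)[OF g] h f])
  moreover from this(1) have "energy f g \<le> energy f w" by (rule is_proxD(2)[OF g])
  ultimately show ?thesis by argo
qed

lemma N_half: "N (\<lambda>x. f x / 2) = N f / 2"
  using N_cmult[of "1/2" f] by simp

lemma prox_unique:
  assumes g: "is_prox f g" and h: "is_prox f h" and f: "f \<in> E"
  shows "N (\<lambda>x. g x - h x) = 0"
proof -
  have "energy f h \<le> energy f g" by (intro is_proxD(2)[OF h] is_proxD(1)[OF g])
  then have "N (\<lambda>x. (g x - h x) / 2) powr p \<le> 0" using prox_midpoint[OF g is_proxD(1)[OF h] f] by argo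
  then show ?thesis using powr_ge_zero[of "N (\<lambda>x. (g x - h x) / 2)" p] p_pos by (simp add: N_half)
qed

lemma slope_root_limit:
  assumes u: "\<And>n. u n \<in> slope_dom" and le: "\<And>n. slope (u n) powr p \<le> a n" and a: "a \<longlonglongrightarrow> b"
  shows "\<exists>c. (\<forall>n. slope (u n) \<le> c n) \<and> c \<longlonglongrightarrow> b powr (1 / p)"
proof (intro exI conjI allI)
  have a0: "0 \<le> a n" for n using le[of n] powr_ge_zero[of "slope (u n)" p] by linarith
  show "(\<lambda>n. a n powr (1 / p)) \<longlonglongrightarrow> b powr (1 / p)"
    using p_pos a0 by (intro tendsto_powr' a tendsto_const) auto
  fix n
  have "slope (u n) = (slope (u n) powr p) powr (1 / p)" using slope_nonneg[OF u[of n]] p_pos by (simp add: powr_powr)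
  also have "\<dots> \<le> a n powr (1 / p)" using le[of n] p_pos by (intro powr_mono2) auto
  finally show "slope (u n) \<le> a n powr (1 / p)" .
qed

lemma prox_exists:
  assumes f: "f \<in> E"
  obtains g where "is_prox f g"
proof -
  define v where "v = Inf (energy f ` slope_dom)"
  have bdd: "bdd_below (energy f ` slope_dom)" by (auto intro!: bdd_belowI[of _ 0] energy_nonneg)
  have v: "v \<le> energy f h" if "h \<in> slope_dom" for h unfolding v_def using that bdd by (intro cInf_lower) auto
  let ?d = "\<lambda>n. 1 / real (Suc n)"
  have "\<exists>g. g \<in> slope_dom \<and> energy f g < v + ?d n" for n
  proof -
    have "v < v + ?d n" by simp
    then have "\<exists>y\<in>energy f ` slope_dom. y < v + ?d n"
      unfolding v_def using zero_slope_dom bdd by (subst (asm) cInf_less_iff) auto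
    then show ?thesis by blast
  qed
  then have "\<exists>u. \<forall>n. u n \<in> slope_dom \<and> energy f (u n) < v + ?d n" by (intro choice allI)
  then obtain u where u: "\<And>n. u n \<in> slope_dom" "\<And>n. energy f (u n) < v + ?d n" by blast
  have uE: "u n \<in> E" for n using u(1) by (rule slope_dom_Lp)
  have d0: "?d \<longlonglongrightarrow> 0" by (intro LIMSEQ_Suc lim_1_over_n)
  have "\<exists>k. \<forall>m\<ge>k. \<forall>n\<ge>k. N (\<lambda>x. u m x - u n x) < e" if e: "0 < e" for e
  proof -
    have "0 < (e / 2) powr p" using e by simp
    then have "\<forall>\<^sub>F n in sequentially. ?d n < (e / 2) powr p" by (rule order_tendstoD(2)[OF d0])
    then obtain k where k: "\<And>n. k \<le> n \<Longrightarrow> ?d n < (e / 2) powr p" unfolding eventually_sequentially by blast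
    have "N (\<lambda>x. u m x - u n x) < e" if mn: "k \<le> m" "k \<le> n" for m n
    proof -
      obtain w where w: "w \<in> slope_dom"
        "energy f w + N (\<lambda>x. (u m x - u n x) / 2) powr p \<le> (energy f (u m) + energy f (u n)) / 2"
        by (rule energy_midpoint[OF u(1) u(1) f])
      have "N (\<lambda>x. (u m x - u n x) / 2) powr p < (e / 2) powr p"
        using w(2) v[OF w(1)] u(2)[of m] u(2)[of n] k[OF mn(1)] k[OF mn(2)] by argo
      then have "N (\<lambda>x. (u m x - u n x) / 2) < e / 2"
        using powr_le_powr_iff[of p "e / 2" "N (\<lambda>x. (u m x - u n x) / 2)"] e p_pos by force
      then show ?thesis by (simp add: N_half)
    qed
    then show ?thesis by blast
  qed
  then obtain g where g: "g \<in> E" "converges u g" by (rule Lp_complete[OF uE])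
  have "converges (\<lambda>n x. u n x - f x) (\<lambda>x. g x - f x)" using g(2) by simp
  then have Nlim: "(\<lambda>n. N (\<lambda>x. u n x - f x)) \<longlonglongrightarrow> N (\<lambda>x. g x - f x)"
    by (intro N_tendsto Lp_diff uE f g(1))
  \<comment> \<open>The distance terms converge, so subtracting them from the energies leaves a
    convergent bound for the p-th powers of the slopes.\<close>
  let ?b = "v - N (\<lambda>x. g x - f x) powr p"
  have "(\<lambda>n. v + ?d n - N (\<lambda>x. u n x - f x) powr p) \<longlonglongrightarrow> v + 0 - N (\<lambda>x. g x - f x) powr p"
    using p_pos by (intro tendsto_intros d0 tendsto_powr' Nlim) auto
  then have alim: "(\<lambda>n. v + ?d n - N (\<lambda>x. u n x - f x) powr p) \<longlonglongrightarrow> ?b" by simp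
  have le: "slope (u n) powr p \<le> v + ?d n - N (\<lambda>x. u n x - f x) powr p" for n
    using u(2)[of n] unfolding energy_def by linarith
  obtain c where c: "\<And>n. slope (u n) \<le> c n" "c \<longlonglongrightarrow> ?b powr (1 / p)"
    using slope_root_limit[OF u(1) le alim] by blast
  have gd: "g \<in> slope_dom" "slope g \<le> ?b powr (1 / p)"
    using slope_lower_semicontinuous[OF u(1) c g] by auto
  have b0: "0 \<le> ?b"
    by (rule LIMSEQ_le_const[OF alim]) (use le powr_ge_zero order_trans in blast)
  have "slope g powr p \<le> (?b powr (1 / p)) powr p"
    using gd slope_nonneg p_pos by (intro powr_mono2) auto
  also have "\<dots> = ?b" using b0 p_pos by (simp add: powr_powr)
  finally have "energy f g \<le> v" by (simp add: energy_def)
  then have "is_prox f g" unfolding is_prox_def using gd(1) v by (auto intro: order_trans)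
  then show thesis by (rule that)
qed

lemma energy_uminus:
  assumes "g \<in> slope_dom"
  shows "energy (\<lambda>x. - f x) (\<lambda>x. - g x) = energy f g"
proof -
  have "N (\<lambda>x. - g x - - f x) = N (\<lambda>x. g x - f x)" using N_uminus[of "\<lambda>x. g x - f x"] by simp
  then show ?thesis using slope_uminus[OF assms] by (simp add: energy_def)
qed

lemma is_prox_uminus:
  assumes "is_prox f g"
  shows "is_prox (\<lambda>x. - f x) (\<lambda>x. - g x)"
  unfolding is_prox_def
proof (intro conjI ballI)
  have g: "g \<in> slope_dom" using assms by (rule is_proxD)
  then show "(\<lambda>x. - g x) \<in> slope_dom" by (rule slope_uminus)
  fix h assume h: "h \<in> slope_dom"
  have "energy f g \<le> energy f (\<lambda>x. - h x)" by (intro is_proxD(2)[OF assms] slope_uminus h)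
  also have "energy f (\<lambda>x. - h x) = energy (\<lambda>x. - f x) h"
    using energy_uminus[OF slope_uminus(1)[OF h], of f] by simp
  finally show "energy (\<lambda>x. - f x) (\<lambda>x. - g x) \<le> energy (\<lambda>x. - f x) h" by (simp add: energy_uminus[OF g])
qed

text \<open>Replacing the datum u n by f changes the energy of b n by at most a multiple of their
  distance, so b n is nearly minimal for f and \<open>prox_midpoint\<close> applies. The second
  claim is upper semicontinuity of the slope along proximal points: convergence of the distance
  terms leaves the slopes no room to exceed \<open>slope a\<close> in the limit.\<close>

lemma prox_continuous:
  assumes u: "\<And>n. u n \<in> E" and f: "f \<in> E" and lim: "converges u f"
    and b: "\<And>n. is_prox (u n) (b n)" and a: "is_prox f a"
  shows "converges b a" "\<exists>c. (\<forall>n. slope (b n) \<le> c n) \<and> c \<longlonglongrightarrow> slope a"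
proof -
  have bD: "b n \<in> slope_dom" for n using b by (rule is_proxD)
  have bE: "b n \<in> E" for n using bD by (rule slope_dom_Lp)
  have aD: "a \<in> slope_dom" using a by (rule is_proxD)
  have aE: "a \<in> E" using aD by (rule slope_dom_Lp)
  let ?r = "\<lambda>n. N (\<lambda>x. u n x - f x)"
  obtain B where B: "\<And>n. \<bar>N (u n)\<bar> \<le> B"
    using convergent_imp_Bseq[OF convergentI[OF N_tendsto[OF u f lim]]] by (auto simp: Bseq_def)
  \<comment> \<open>Comparison with the competitor 0.\<close>
  have close: "N (\<lambda>x. b n x - u n x) \<le> B" for n
  proof -
    have "energy (u n) (b n) \<le> energy (u n) (\<lambda>x. 0)" by (rule is_proxD(2)[OF b zero_slope_dom])
    also have "\<dots> = N (u n) powr p" using N_uminus[of "u n"] p_pos by (simp add: energy_def slope_zero)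
    finally have "N (\<lambda>x. b n x - u n x) powr p \<le> N (u n) powr p"
      using powr_ge_zero[of "slope (b n)" p] unfolding energy_def by linarith
    then have "N (\<lambda>x. b n x - u n x) \<le> N (u n)" by (subst (asm) powr_le_powr_iff) (auto simp: p_pos)
    then show ?thesis using B[of n] by simp
  qed
  obtain B1 where B1: "\<And>n. ?r n \<le> B1" using convergent_imp_Bseq[OF convergentI[OF lim]] by (auto simp: Bseq_def)
  define K where "K = B + B1"
  have bf: "N (\<lambda>x. b n x - f x) \<le> K" for n
    using N_triangle[OF bE u f, of n n] close[of n] B1[of n] by (simp add: K_def)
  have "(\<lambda>n. N (\<lambda>x. a x - u n x)) \<longlonglongrightarrow> N (\<lambda>x. a x - f x)"
    using lim by (intro N_tendsto Lp_diff aE u f) (simp add: N_diff_commute[of _ f])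
  then have elim: "(\<lambda>n. energy (u n) a) \<longlonglongrightarrow> energy f a"
    unfolding energy_def using p_pos by (intro tendsto_intros tendsto_powr') auto
  have up: "N (\<lambda>x. (a x - b n x) / 2) powr p \<le> (energy (u n) a + p * K powr (p - 1) * ?r n - energy f a) / 2" for n
  proof -
    \<comment> \<open>The tangent inequality turns the triangle inequality into a bound on p-th
      powers that is linear in the distance of the data.\<close>
    have "N (\<lambda>x. b n x - f x) powr p - N (\<lambda>x. b n x - u n x) powr p
        \<le> p * N (\<lambda>x. b n x - f x) powr (p - 1) * (N (\<lambda>x. b n x - f x) - N (\<lambda>x. b n x - u n x))"
      using p_pos by (intro powr_tangent_le) auto
    also have "\<dots> \<le> p * N (\<lambda>x. b n x - f x) powr (p - 1) * ?r n"
      using N_triangle[OF bE u f, of n n] p_pos by (intro mult_left_mono) auto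
    also have "\<dots> \<le> p * K powr (p - 1) * ?r n"
      using bf[of n] p_pos by (intro mult_right_mono mult_left_mono powr_mono2) auto
    finally have "energy f (b n) \<le> energy (u n) (b n) + p * K powr (p - 1) * ?r n"
      unfolding energy_def by linarith
    also have "energy (u n) (b n) \<le> energy (u n) a" by (rule is_proxD(2)[OF b aD])
    finally have "energy f (b n) \<le> energy (u n) a + p * K powr (p - 1) * ?r n" by simp
    then show ?thesis using prox_midpoint[OF a bD f, of n] by argo
  qed
  have "(\<lambda>n. (energy (u n) a + p * K powr (p - 1) * ?r n - energy f a) / 2) \<longlonglongrightarrow> (energy f a + p * K powr (p - 1) * 0 - energy f a) / 2"
    by (intro tendsto_intros elim lim) simp
  then have "(\<lambda>n. (energy (u n) a + p * K powr (p - 1) * ?r n - energy f a) / 2) \<longlonglongrightarrow> 0" by simp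
  then have "(\<lambda>n. N (\<lambda>x. (a x - b n x) / 2) powr p) \<longlonglongrightarrow> 0"
    by (rule tendsto_sandwich[OF _ _ tendsto_const, rotated 2]) (use up in auto)
  then have "(\<lambda>n. (N (\<lambda>x. (a x - b n x) / 2) powr p) powr (1 / p)) \<longlonglongrightarrow> 0 powr (1 / p)"
    using p_pos by (intro tendsto_powr' tendsto_const) auto
  then have "(\<lambda>n. 2 * N (\<lambda>x. (a x - b n x) / 2)) \<longlonglongrightarrow> 2 * 0"
    using p_pos by (intro tendsto_intros) (simp add: powr_powr)
  then show conv: "converges b a" by (simp add: N_half N_diff_commute[of a])
  have "converges (\<lambda>n x. b n x - u n x) (\<lambda>x. a x - f x)"
  proof (rule tendsto_sandwich[OF _ _ tendsto_const])
    show "\<forall>\<^sub>F n in sequentially. N (\<lambda>x. b n x - u n x - (a x - f x)) \<le> N (\<lambda>x. b n x - a x) + ?r n"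
    proof (intro always_eventually allI)
      fix n
      have "(\<lambda>x. b n x - u n x - (a x - f x)) = (\<lambda>x. (b n x - a x) - (u n x - f x))" by auto
      then show "N (\<lambda>x. b n x - u n x - (a x - f x)) \<le> N (\<lambda>x. b n x - a x) + ?r n"
        by (simp only:) (intro N_diff_le Lp_diff bE aE u f)
    qed
    show "(\<lambda>n. N (\<lambda>x. b n x - a x) + ?r n) \<longlonglongrightarrow> 0" using tendsto_add[OF conv lim] by simp
  qed auto
  then have Nlim: "(\<lambda>n. N (\<lambda>x. b n x - u n x)) \<longlonglongrightarrow> N (\<lambda>x. a x - f x)"
    by (intro N_tendsto Lp_diff bE u aE f)
  have "(\<lambda>n. energy (u n) a - N (\<lambda>x. b n x - u n x) powr p) \<longlonglongrightarrow> energy f a - N (\<lambda>x. a x - f x) powr p"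
    using p_pos by (intro tendsto_intros elim tendsto_powr' Nlim) auto
  then have "(\<lambda>n. energy (u n) a - N (\<lambda>x. b n x - u n x) powr p) \<longlonglongrightarrow> slope a powr p"
    by (simp add: energy_def)
  moreover have "slope (b n) powr p \<le> energy (u n) a - N (\<lambda>x. b n x - u n x) powr p" for n
    using is_proxD(2)[OF b aD, of n] unfolding energy_def[of _ "b n"] by linarith
  ultimately have "\<exists>c. (\<forall>n. slope (b n) \<le> c n) \<and> c \<longlonglongrightarrow> (slope a powr p) powr (1 / p)"
    using bD by (intro slope_root_limit)
  then show "\<exists>c. (\<forall>n. slope (b n) \<le> c n) \<and> c \<longlonglongrightarrow> slope a"
    using slope_nonneg[OF aD] p_pos by (simp add: powr_powr)
qed

section \<open>Critical points\<close>

text \<open>The inequality makes c J f a subgradient of the slope seminorm at f. The parameter is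
  the slope c; the eigenvalue is its p-th power.\<close>

definition critical_points :: "real \<Rightarrow> ('a \<Rightarrow> real) set" where
  "critical_points c = {f \<in> slope_dom. N f = 1 \<and> slope f = c \<and>
     (\<forall>g\<in>slope_dom. c * (\<integral>x. J f x * g x \<partial>M) \<le> slope g)}"

lemma energy_multiple:
  assumes f: "f \<in> slope_dom" "N f = 1" and t: "0 \<le> t"
  shows "energy f (\<lambda>x. t * f x) = (t * slope f) powr p + \<bar>t - 1\<bar> powr p"
proof -
  have "N (\<lambda>x. t * f x - f x) = N (\<lambda>x. (t - 1) * f x)" by (simp add: left_diff_distrib)
  then show ?thesis using f t by (simp add: energy_def slope_cmult N_cmult)
qed

text \<open>A candidate of norm zero has energy at least 1, while a small multiple t f has less: the
  gain in distance is linear in t and the slope costs only order t^p.\<close>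

lemma prox_nonzero:
  assumes f: "f \<in> slope_dom" "N f = 1" and g: "is_prox f g"
  shows "0 < N g"
proof (rule ccontr)
  assume "\<not> 0 < N g"
  then have g0: "N g = 0" using Lp_norm_nonneg[of M p g] by linarith
  have gE: "g \<in> E" "f \<in> E" using slope_dom_Lp f is_proxD(1)[OF g] by auto
  have "1 \<le> N (\<lambda>x. g x - f x)" using N_diff_ge[OF gE] g0 f(2) by simp
  then have "1 powr p \<le> N (\<lambda>x. g x - f x) powr p" using p_pos by (intro powr_mono2) auto
  then have lower: "1 \<le> energy f g" using powr_ge_zero[of "slope g" p] unfolding energy_def powr_one_eq_one by linarith
  define l where "l = slope f powr p"
  have l: "0 \<le> l" by (simp add: l_def)
  \<comment> \<open>Chosen so that t l < 1; since p-th powers are at most squares on (0, 1), this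
    brings the energy of t f below 1.\<close>
  define t where "t = 1 / (l + 2)"
  have t: "0 < t" "t < 1" "t * l < 1" using l by (auto simp: t_def field_simps)
  have sq: "s powr p \<le> s\<^sup>2" if "0 < s" "s < 1" for s
    using powr_mono'[of 2 p s] that two_le_p by simp
  have "(t * slope f) powr p + \<bar>t - 1\<bar> powr p = t powr p * l + (1 - t) powr p"
    using t by (simp add: powr_mult l_def)
  also have "\<dots> \<le> t\<^sup>2 * l + (1 - t)\<^sup>2" using t l by (intro add_mono mult_right_mono sq) auto
  also have "\<dots> = 1 - t + t * (t * l - (1 - t))" by (simp add: power2_eq_square algebra_simps)
  also have "\<dots> < 1 - t + t * 1" using t by (intro add_strict_left_mono mult_strict_left_mono) auto
  finally have "energy f (\<lambda>x. t * f x) < 1" using t by (simp add: energy_multiple[OF f])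
  moreover have "energy f g \<le> energy f (\<lambda>x. t * f x)" by (intro is_proxD(2)[OF g] slope_cmult_le f)
  ultimately show False using lower by linarith
qed

text \<open>The multiple of f with the norm of g is at least as close to f as g is, so g must make
  up for it in slope. Equal slopes leave the multiple no worse than g.\<close>

lemma
  assumes f: "f \<in> slope_dom" "N f = 1" and g: "is_prox f g"
  shows prox_slope_le: "slope g \<le> N g * slope f"
    and prox_slope_eq: "N g * slope f \<le> slope g \<Longrightarrow> is_prox f (\<lambda>x. N g * f x)"
proof -
  have gD: "g \<in> slope_dom" using g by (rule is_proxD)
  have gE: "g \<in> E" "f \<in> E" using slope_dom_Lp f gD by auto
  have s0: "0 \<le> slope f" "0 \<le> slope g" by (intro slope_nonneg f gD)+
  have "\<bar>N g - 1\<bar> \<le> N (\<lambda>x. g x - f x)" using N_diff_ge[OF gE] f(2) by simp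
  then have d: "\<bar>N g - 1\<bar> powr p \<le> N (\<lambda>x. g x - f x) powr p" using p_pos by (intro powr_mono2) auto
  note em = energy_multiple[OF f Lp_norm_nonneg, of M p g]
  have "energy f g \<le> energy f (\<lambda>x. N g * f x)" by (intro is_proxD(2)[OF g] slope_cmult_le f)
  then have "energy f g \<le> (N g * slope f) powr p + \<bar>N g - 1\<bar> powr p" unfolding em .
  then have "slope g powr p \<le> (N g * slope f) powr p" using d unfolding energy_def by linarith
  then show "slope g \<le> N g * slope f"
    using s0 by (subst (asm) powr_le_powr_iff) (auto simp: p_pos)
  assume "N g * slope f \<le> slope g"
  then have "(N g * slope f) powr p \<le> slope g powr p" using s0 p_pos by (intro powr_mono2) auto
  then have "energy f (\<lambda>x. N g * f x) \<le> energy f g" using d unfolding em energy_def[of f g] by linarith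
  then show "is_prox f (\<lambda>x. N g * f x)"
    using is_proxD(2)[OF g] slope_cmult_le(1)[OF f(1)] unfolding is_prox_def by (blast intro: order_trans)
qed

text \<open>f minimizes the slope on the hyperplane <J f, h> = 1. Moving t f towards t h changes the
  distance term only to second order, since J f annihilates h - f, whereas a smaller slope of h
  would lower the energy to first order.\<close>

lemma prox_multiple_variational:
  assumes f: "f \<in> slope_dom" "N f = 1" and t: "0 < t" and prox: "is_prox f (\<lambda>x. t * f x)"
    and h: "h \<in> slope_dom" and Jh: "(\<integral>x. J f x * h x \<partial>M) = 1"
  shows "slope f \<le> slope h"
proof (rule ccontr)
  assume "\<not> slope f \<le> slope h"
  then have less: "slope h < slope f" by simp
  have s0: "0 \<le> slope h" by (intro slope_nonneg h)
  have E: "f \<in> E" "h \<in> E" using slope_dom_Lp f h by auto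
  define v where "v = (\<lambda>x. t * (h x - f x))"
  have v: "v \<in> E" using E by (auto simp: v_def intro!: Lp_intros)
  have "(\<integral>x. J f x * (h x - f x) \<partial>M) = (\<integral>x. J f x * h x \<partial>M) - (\<integral>x. J f x * f x \<partial>M)"
    using J_integrable[OF E(1) E(2)] J_integrable[OF E(1) E(1)] by (simp add: right_diff_distrib)
  then have J0: "(\<integral>x. J f x * (h x - f x) \<partial>M) = 0" using Jh f(2) by (simp add: J_self)
  have "J (\<lambda>x. (t - 1) * f x) x * v x = (\<bar>t - 1\<bar> powr (p - 2) * (t - 1) * t) * (J f x * (h x - f x))" for x
    unfolding duality_map_cmult v_def by (simp only: mult_ac)
  then have "(\<integral>x. J (\<lambda>x. (t - 1) * f x) x * v x \<partial>M)
      = (\<integral>x. (\<bar>t - 1\<bar> powr (p - 2) * (t - 1) * t) * (J f x * (h x - f x)) \<partial>M)"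
    by (simp only:)
  also have "\<dots> = 0" unfolding integral_mult_right_zero J0 by simp
  finally have Jv: "(\<integral>x. J (\<lambda>x. (t - 1) * f x) x * v x \<partial>M) = 0" .
  obtain C where C: "\<And>s. 0 \<le> s \<Longrightarrow> s \<le> 1 \<Longrightarrow>
      N (\<lambda>x. (t - 1) * f x + s * v x) powr p \<le> N (\<lambda>x. (t - 1) * f x) powr p
        + s * (p * (\<integral>x. J (\<lambda>x. (t - 1) * f x) x * v x \<partial>M)) + s\<^sup>2 * C"
    using N_expansion_scaled[OF Lp_cmult[OF E(1)] v] by blast
  define c where "c = t * slope f"
  have c: "0 < c" using t less s0 by (simp add: c_def)
  have "0 \<le> - (c powr (p - 1) * (t * (slope f - slope h)))"
  proof (rule nonneg_of_quadratic_perturbation[where C=C])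
    fix s :: real assume s: "0 < s" "s \<le> 1"
    define w where "w = (\<lambda>x. (t - s * t) * f x + (s * t) * h x)"
    have st: "s * t \<le> t" using s t by simp
    have w: "w \<in> slope_dom" unfolding w_def by (intro slope_lincomb f h)
    \<comment> \<open>The seminorm bound for the slope of the perturbed point, affine in s and equal
      to c at s = 0.\<close>
    define y where "y = c - s * (t * (slope f - slope h))"
    have "slope w \<le> \<bar>t - s * t\<bar> * slope f + \<bar>s * t\<bar> * slope h" unfolding w_def by (intro slope_lincomb f h)
    also have "\<dots> = y" using st s t by (simp add: y_def c_def algebra_simps)
    finally have wy: "slope w \<le> y" .
    have y: "0 \<le> y" "y \<le> c" using wy slope_nonneg[OF w] less s t by (auto simp: y_def)
    \<comment> \<open>Since 0 <= y <= c, bounding all but one power of y by c makes the estimate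
      affine in s.\<close>
    have "y powr p = y * y powr (p - 1)" using y(1) by (cases "y = 0") (auto simp: powr_diff)
    also have "\<dots> \<le> y * c powr (p - 1)" using y p_pos by (intro mult_left_mono powr_mono2) auto
    finally have yp: "y powr p \<le> y * c powr (p - 1)" .
    have cp: "c powr p = c * c powr (p - 1)" using c by (simp add: powr_diff)
    have "N (\<lambda>x. w x - f x) = N (\<lambda>x. (t - 1) * f x + s * v x)" by (simp add: w_def v_def algebra_simps)
    then have "N (\<lambda>x. w x - f x) powr p \<le> N (\<lambda>x. (t - 1) * f x) powr p + s\<^sup>2 * C"
      using C[of s] s unfolding Jv by simp
    also have "N (\<lambda>x. (t - 1) * f x) = \<bar>t - 1\<bar>" by (simp add: N_cmult f(2))
    finally have 1: "N (\<lambda>x. w x - f x) powr p \<le> \<bar>t - 1\<bar> powr p + s\<^sup>2 * C" .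
    have 2: "slope w powr p \<le> y powr p" using wy slope_nonneg[OF w] p_pos by (intro powr_mono2) auto
    have "c powr p + \<bar>t - 1\<bar> powr p = energy f (\<lambda>x. t * f x)"
      using t by (simp add: energy_multiple[OF f] c_def)
    also have "\<dots> \<le> energy f w" by (rule is_proxD(2)[OF prox w])
    also have "\<dots> \<le> y * c powr (p - 1) + \<bar>t - 1\<bar> powr p + s\<^sup>2 * C"
      using 1 2 yp unfolding energy_def by linarith
    finally have "0 \<le> (y - c) * c powr (p - 1) + s\<^sup>2 * C" unfolding cp by (simp add: left_diff_distrib)
    then show "0 \<le> s * - (c powr (p - 1) * (t * (slope f - slope h))) + s\<^sup>2 * C"
      by (simp add: y_def mult_ac)
  qed
  moreover have "0 < c powr (p - 1) * (t * (slope f - slope h))" using c t less by simp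
  ultimately show False by linarith
qed

text \<open>The hypotheses force equality in \<open>prox_slope_le\<close>, so a multiple of f is
  proximal. The hyperplane inequality extends to positive pairings by homogeneity and is immediate
  for the others.\<close>

lemma prox_imp_critical:
  assumes f: "f \<in> slope_dom" "N f = 1" "slope f \<le> c" and g: "is_prox f g" and ge: "c * N g \<le> slope g"
  shows "f \<in> critical_points c"
proof -
  have t: "0 < N g" by (rule prox_nonzero[OF f(1,2) g])
  have "c * N g \<le> N g * slope f" using prox_slope_le[OF f(1,2) g] ge by linarith
  then have sc: "slope f = c" using t f(3) by (simp add: mult.commute)
  have prox: "is_prox f (\<lambda>x. N g * f x)"
    using ge by (intro prox_slope_eq[OF f(1,2) g]) (simp add: sc mult.commute)
  have "c * (\<integral>x. J f x * h x \<partial>M) \<le> slope h" if h: "h \<in> slope_dom" for h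
  proof (cases "(\<integral>x. J f x * h x \<partial>M) \<le> 0")
    case True
    then have "c * (\<integral>x. J f x * h x \<partial>M) \<le> 0"
      using slope_nonneg[OF f(1)] sc by (simp add: mult_nonneg_nonpos)
    then show ?thesis using slope_nonneg[OF h] by linarith
  next
    case False
    define b where "b = (\<integral>x. J f x * h x \<partial>M)"
    have b: "0 < b" using False by (simp add: b_def)
    have "(\<integral>x. J f x * (1 / b * h x) \<partial>M) = 1 / b * (\<integral>x. J f x * h x \<partial>M)"
      using integral_mult_right_zero[of M "1 / b" "\<lambda>x. J f x * h x"] by (simp add: mult_ac)
    then have "(\<integral>x. J f x * (1 / b * h x) \<partial>M) = 1" using b by (simp add: b_def)
    then have "slope f \<le> slope (\<lambda>x. 1 / b * h x)"
      by (intro prox_multiple_variational[OF f(1,2) t prox] slope_cmult_le h)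
    also have "\<dots> = 1 / b * slope h" using b by (simp only: slope_cmult[OF h]) simp
    finally show ?thesis using b unfolding b_def[symmetric] sc by (simp add: field_simps)
  qed
  then show ?thesis using f(1,2) sc by (simp add: critical_points_def)
qed

text \<open>With b = <J f, g> the multiple b f has at most the energy of g: its slope is bounded by
  criticality and its distance by Hoelder. Uniqueness then gives \<open>N g\<close> = b.\<close>

lemma critical_imp_prox:
  assumes f: "f \<in> critical_points c" and g: "is_prox f g"
  shows "c * N g \<le> slope g"
proof -
  have fD: "f \<in> slope_dom" "N f = 1" "slope f = c"
    and var: "\<And>g. g \<in> slope_dom \<Longrightarrow> c * (\<integral>x. J f x * g x \<partial>M) \<le> slope g"
    using f by (auto simp: critical_points_def)
  have c: "0 \<le> c" using slope_nonneg[OF fD(1)] fD(3) by simp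
  have gD: "g \<in> slope_dom" using g by (rule is_proxD)
  have E: "f \<in> E" "g \<in> E" using slope_dom_Lp fD gD by auto
  define b where "b = (\<integral>x. J f x * g x \<partial>M)"
  have "(\<integral>x. J f x * (g x - f x) \<partial>M) = b - 1"
    using J_integrable[OF E(1) E(2)] J_integrable[OF E(1) E(1)] fD(2)
    by (simp add: right_diff_distrib b_def J_self)
  then have bN: "\<bar>b - 1\<bar> \<le> N (\<lambda>x. g x - f x)"
    using J_Hoelder[OF E(1) Lp_diff[OF E(2) E(1)]] fD(2) by simp
  then have bN': "\<bar>b - 1\<bar> powr p \<le> N (\<lambda>x. g x - f x) powr p" using p_pos by (intro powr_mono2) auto
  \<comment> \<open>Comparison with 0 places g within distance 1 of f, which makes b
    nonnegative.\<close>
  have "energy f g \<le> energy f (\<lambda>x. 0)" by (rule is_proxD(2)[OF g zero_slope_dom])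
  also have "\<dots> = 1" using N_uminus[of f] p_pos fD(2) by (simp add: energy_def slope_zero)
  finally have "N (\<lambda>x. g x - f x) powr p \<le> 1 powr p"
    using powr_ge_zero[of "slope g" p] unfolding energy_def powr_one_eq_one by linarith
  then have "N (\<lambda>x. g x - f x) \<le> 1" by (subst (asm) powr_le_powr_iff) (auto simp: p_pos)
  then have b0: "0 \<le> b" using bN by linarith
  have "energy f (\<lambda>x. b * f x) = (b * c) powr p + \<bar>b - 1\<bar> powr p"
    using energy_multiple[OF fD(1,2) b0] fD(3) by simp
  also have "(b * c) powr p \<le> slope g powr p"
    using var[OF gD] b0 c p_pos unfolding b_def[symmetric] by (intro powr_mono2) (auto simp: mult.commute)
  finally have "energy f (\<lambda>x. b * f x) \<le> energy f g" using bN' unfolding energy_def[of f g] by linarith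
  then have "is_prox f (\<lambda>x. b * f x)"
    using is_proxD(2)[OF g] slope_cmult_le(1)[OF fD(1)] unfolding is_prox_def by (blast intro: order_trans)
  then have "N (\<lambda>x. g x - b * f x) = 0" by (rule prox_unique[OF g _ E(1)])
  then have "N g = N (\<lambda>x. b * f x)" using N_diff_ge[OF E(2) Lp_cmult[OF E(1), of b]] by simp
  then have "N g = b" using b0 fD(2) by (simp add: N_cmult)
  then show ?thesis using var[OF gD] by (simp add: b_def)
qed

lemma critical_points_subset: "critical_points c \<subseteq> E"
  using slope_dom_Lp by (auto simp: critical_points_def)

lemma critical_points_uminus:
  assumes "f \<in> critical_points c"
  shows "(\<lambda>x. - f x) \<in> critical_points c"
proof -
  have f: "f \<in> slope_dom" "N f = 1" "slope f = c"
    and var: "\<And>g. g \<in> slope_dom \<Longrightarrow> c * (\<integral>x. J f x * g x \<partial>M) \<le> slope g"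
    using assms by (auto simp: critical_points_def)
  have "c * (\<integral>x. J (\<lambda>x. - f x) x * g x \<partial>M) \<le> slope g" if g: "g \<in> slope_dom" for g
    using var[OF slope_uminus(1)[OF g]] slope_uminus(2)[OF g] by (simp add: duality_map_def)
  then show ?thesis using f slope_uminus[OF f(1)] by (auto simp: critical_points_def N_uminus)
qed

text \<open>\<open>slope f = c\<close> does not pass to limits directly, as the slope is only lower
  semicontinuous. The equivalent condition c \<open>N g\<close> <= \<open>slope g\<close> on
  proximal points g does, by \<open>prox_continuous\<close>.\<close>

lemma closedin_critical_points: "closedin T (critical_points c)"
proof (rule closedin_sequentialI[OF critical_points_subset])
  fix u f assume u: "\<And>n::nat. u n \<in> critical_points c" and f: "f \<in> E" and lim: "converges u f"
  have uD: "u n \<in> slope_dom" "N (u n) = 1" "slope (u n) \<le> c" for n using u[of n] by (auto simp: critical_points_def)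
  have uE: "u n \<in> E" for n using uD(1) by (rule slope_dom_Lp)
  have fD: "f \<in> slope_dom" "slope f \<le> c"
    using slope_lower_semicontinuous[OF uD(1) uD(3) tendsto_const f lim] by auto
  have "(\<lambda>n. N (u n)) \<longlonglongrightarrow> N f" by (rule N_tendsto[OF uE f lim])
  then have Nf: "N f = 1" unfolding uD(2) by (simp add: LIMSEQ_const_iff)
  obtain g where g: "is_prox f g" by (rule prox_exists[OF f])
  have "\<exists>h. is_prox (u n) h" for n by (rule prox_exists[OF uE]) blast
  then have "\<exists>b. \<forall>n. is_prox (u n) (b n)" by (intro choice allI)
  then obtain b where b: "\<And>n. is_prox (u n) (b n)" by blast
  have conv: "converges b g" by (rule prox_continuous(1)[OF uE f lim b g])
  obtain a where a: "\<And>n. slope (b n) \<le> a n" "a \<longlonglongrightarrow> slope g"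
    using prox_continuous(2)[OF uE f lim b g] by blast
  have "(\<lambda>n. N (b n)) \<longlonglongrightarrow> N g"
    by (intro N_tendsto conv slope_dom_Lp is_proxD(1)[OF b] is_proxD(1)[OF g])
  then have "(\<lambda>n. c * N (b n)) \<longlonglongrightarrow> c * N g" by (rule tendsto_mult_left)
  then have "c * N g \<le> slope g"
    by (rule LIMSEQ_le[OF _ a(2)]) (use critical_imp_prox[OF u b] a(1) order_trans in blast)
  then show "f \<in> critical_points c" by (rule prox_imp_critical[OF fD(1) Nf fD(2) g])
qed

section \<open>Eigenfunctions and the slope of Phi\<close>

lemma critical_points_cheeger:
  assumes "f \<in> critical_points c" and "c powr p = l"
  shows "cheeger M p f = ereal (l / p)"
  using assms by (auto simp: critical_points_def cheeger_eq)

text \<open>Subgradient property of l J f for the Cheeger energy. The tangent of z^p at 1 lifts the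
  inequality for the seminorm to its p-th power; for negative pairings the left side is at most
  0.\<close>

lemma cheeger_subgradient:
  assumes f: "f \<in> critical_points c" and l: "c powr p = l" and g: "g \<in> slope_dom"
  shows "l / p + l * ((\<integral>x. J f x * g x \<partial>M) - 1) \<le> slope g powr p / p"
proof -
  define b where "b = (\<integral>x. J f x * g x \<partial>M)"
  have c: "0 \<le> c" using f slope_nonneg by (auto simp: critical_points_def)
  have l0: "0 \<le> l" using l by auto
  have cb: "c * b \<le> slope g" using f g by (auto simp: critical_points_def b_def)
  have "l * (1 + p * (b - 1)) \<le> slope g powr p"
  proof (cases "0 \<le> b")
    case True
    have "1 + p * (b - 1) \<le> b powr p" using powr_tangent_le[of 1 b p] True p_pos by (simp add: algebra_simps)
    then have "l * (1 + p * (b - 1)) \<le> l * b powr p" using l0 by (rule mult_left_mono)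
    also have "\<dots> = (c * b) powr p" by (simp add: powr_mult l)
    also have "\<dots> \<le> slope g powr p" using cb c True p_pos by (intro powr_mono2) auto
    finally show ?thesis .
  next
    case False
    then have "p * (b - 1) \<le> p * (- 1)" using p_pos by (intro mult_left_mono) auto
    then have "1 + p * (b - 1) \<le> 0" using p_pos by simp
    then have "l * (1 + p * (b - 1)) \<le> 0" using l0 by (simp add: mult_nonneg_nonpos)
    then show ?thesis using powr_ge_zero[of "slope g" p] by linarith
  qed
  then have "l * (1 + p * (b - 1)) / p \<le> slope g powr p / p" using p_pos by (intro divide_right_mono) auto
  then show ?thesis using p_pos by (simp add: b_def field_simps)
qed

text \<open>Minimality of l J f comes from homogeneity: testing a subgradient v with (1 - s) f gives
  <v, f> >= l, and by Hoelder with \<open>N f = 1\<close> the norm of v is at least l, the norm of l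
  J f.\<close>

lemma critical_points_eigenfunction:
  assumes f: "f \<in> critical_points c" and l: "c powr p = l"
  shows "eigenfunction M p l f"
proof -
  have fD: "f \<in> slope_dom" "N f = 1" "slope f = c" using f by (auto simp: critical_points_def)
  have fE: "f \<in> E" using fD(1) by (rule slope_dom_Lp)
  have l0: "0 \<le> l" using l by auto
  let ?q = "hoelder_conjugate p"
  have q: "0 < ?q" using p_pos by (simp add: hoelder_conjugate_def)
  define w where "w = (\<lambda>x. - l * J f x)"
  have nw: "(\<lambda>x. - w x) = (\<lambda>x. l * J f x)" by (simp add: w_def)
  have "(\<lambda>x. l * J f x) \<in> Lp M ?q"
    using duality_map_in_Lp[OF p_pos(2) fE] by (auto simp: Lp_def abs_mult powr_mult)
  moreover have "cheeger M p f + ereal (\<integral>x. l * J f x * (g x - f x) \<partial>M) \<le> cheeger M p g" if g: "g \<in> E" for g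
  proof (cases "g \<in> slope_dom")
    case True
    have "(\<integral>x. l * J f x * (g x - f x) \<partial>M) = l * (\<integral>x. J f x * (g x - f x) \<partial>M)"
      using integral_mult_right_zero[of M l "\<lambda>x. J f x * (g x - f x)"] by (simp add: mult.assoc)
    also have "(\<integral>x. J f x * (g x - f x) \<partial>M) = (\<integral>x. J f x * g x \<partial>M) - 1"
      using J_integrable[OF fE g] J_integrable[OF fE fE] fD(2) by (simp add: right_diff_distrib J_self)
    finally show ?thesis
      using cheeger_subgradient[OF f l True] critical_points_cheeger[OF f l] True by (simp add: cheeger_eq[of g])
  qed (simp add: cheeger_eq)
  ultimately have sub: "(\<lambda>x. - w x) \<in> cheeger_subdifferential M p f"
    unfolding nw cheeger_subdifferential_def using fD(1) by (simp add: sobolev_eq)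
  have Nw: "Lp_norm M ?q w = l"
  proof -
    have "\<bar>w x\<bar> powr ?q = l powr ?q * \<bar>J f x\<bar> powr ?q" for x
      using l0 by (simp add: w_def abs_mult powr_mult)
    then have "Lp_norm M ?q w = (l powr ?q * (\<integral>x. \<bar>J f x\<bar> powr ?q \<partial>M)) powr (1 / ?q)" by (simp add: Lp_norm_def)
    also have "\<dots> = l * Lp_norm M ?q (J f)"
      using q l0 by (simp add: powr_mult powr_powr Lp_norm_def)
    also have "Lp_norm M ?q (J f) = 1" using Lp_norm_duality_map[OF p_pos(2) fE] fD(2) by simp
    finally show ?thesis by simp
  qed
  have min: "l \<le> Lp_norm M ?q (\<lambda>x. - v x)" if v: "v \<in> cheeger_subdifferential M p f" for v
  proof -
    have vq: "v \<in> Lp M ?q"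
      and sg: "\<And>g. g \<in> E \<Longrightarrow> cheeger M p f + ereal (\<integral>x. v x * (g x - f x) \<partial>M) \<le> cheeger M p g"
      using v by (auto simp: cheeger_subdifferential_def)
    define k where "k = (\<integral>x. v x * f x \<partial>M)"
    have "0 \<le> k - l"
    proof (rule nonneg_of_quadratic_perturbation[where C="l * (p - 1)"])
      fix s :: real assume s: "0 < s" "s \<le> 1"
      have "cheeger M p f + ereal (\<integral>x. v x * ((1 - s) * f x - f x) \<partial>M) \<le> cheeger M p (\<lambda>x. (1 - s) * f x)"
        by (intro sg Lp_cmult fE)
      also have "cheeger M p (\<lambda>x. (1 - s) * f x) = ereal ((1 - s) powr p * l / p)"
        using s fD slope_cmult_le(1)[OF fD(1)] l by (simp add: cheeger_eq slope_cmult powr_mult)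
      also have "(\<integral>x. v x * ((1 - s) * f x - f x) \<partial>M) = - s * k"
        using integral_mult_right_zero[of M "- s" "\<lambda>x. v x * f x"] by (simp add: k_def algebra_simps)
      finally have "l / p - s * k \<le> (1 - s) powr p * l / p"
        using critical_points_cheeger[OF f l] by simp
      then have "p * (l / p - s * k) \<le> p * ((1 - s) powr p * l / p)" using p_pos by (intro mult_left_mono) auto
      then have "l - p * s * k \<le> (1 - s) powr p * l" using p_pos by (simp add: algebra_simps)
      moreover have "(1 - s) powr p * l \<le> (1 - p * s * (1 - s) powr (p - 1)) * l"
        using powr_tangent_le[of "1 - s" 1 p] s p_pos l0 by (intro mult_right_mono) (auto simp: algebra_simps)
      ultimately have "p * s * ((1 - s) powr (p - 1) * l) \<le> p * s * k" by (simp add: algebra_simps)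
      then have 1: "(1 - s) powr (p - 1) * l \<le> k" using p_pos s by simp
      \<comment> \<open>The tangent at 1 produces the linear correction, hence the constant l (p -
        1) of the quadratic term.\<close>
      have "1 - (p - 1) * s \<le> (1 - s) powr (p - 1)"
        using powr_tangent_le[of 1 "1 - s" "p - 1"] s two_le_p by simp
      then have "(1 - (p - 1) * s) * l \<le> (1 - s) powr (p - 1) * l" using l0 by (rule mult_right_mono)
      then have "(1 - (p - 1) * s) * l \<le> k" using 1 by linarith
      then have "0 \<le> s * (k - (1 - (p - 1) * s) * l)" using s by simp
      then show "0 \<le> s * (k - l) + s\<^sup>2 * (l * (p - 1))" by (simp add: algebra_simps power2_eq_square)
    qed
    also have "k \<le> Lp_norm M ?q v" using Lp_Hoelder(2)[OF p_pos(2) vq fE] fD(2) by (simp add: k_def)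
    also have "Lp_norm M ?q v = Lp_norm M ?q (\<lambda>x. - v x)" by (simp add: Lp_norm_def)
    finally show ?thesis by simp
  qed
  have "is_p_laplacian M p f w" unfolding is_p_laplacian_def using sub min Nw by simp
  moreover have "AE x in M. w x = - l * J f x" by (simp add: w_def)
  moreover have "\<not> (AE x in M. f x = 0)" using N_eq_0_iff[OF fE] fD(2) by simp
  ultimately show ?thesis unfolding eigenfunction_def using fD(1) by (auto simp: sobolev_eq)
qed

lemma eventually_Lp_atI:
  assumes "0 < e" "\<And>g. g \<in> E \<Longrightarrow> 0 < N (\<lambda>x. g x - f x) \<Longrightarrow> N (\<lambda>x. g x - f x) < e \<Longrightarrow> P g"
  shows "eventually P (Lp_at M p f)"
  unfolding Lp_at_def
  by (rule eventually_INF1[of e]) (use assms in \<open>auto simp: eventually_principal Lp_dist_def\<close>)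

text \<open>Multiples of f approach f. On an improper filter the upper limit in
  \<open>descending_slope\<close> would be -\<infinity>.\<close>

lemma Lp_at_nontrivial:
  assumes f: "f \<in> E" "N f = 1"
  shows "Lp_at M p f \<noteq> bot"
proof -
  let ?S = "\<lambda>e. {g \<in> E. 0 < Lp_dist M p g f \<and> Lp_dist M p g f < e}"
  have ne: "?S e \<noteq> {}" if "0 < e" for e
  proof -
    have eq: "(\<lambda>x. (1 + e / 2) * f x - f x) = (\<lambda>x. e / 2 * f x)" by (auto simp: algebra_simps)
    have "N (\<lambda>x. (1 + e / 2) * f x - f x) = e / 2" unfolding eq N_cmult using that f by simp
    then have "(\<lambda>x. (1 + e / 2) * f x) \<in> ?S e" using that f by (auto simp: Lp_dist_def intro!: Lp_cmult)
    then show ?thesis by blast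
  qed
  have "(\<forall>P. eventually P (Lp_at M p f) \<longrightarrow> (\<exists>g. P g))"
  proof (intro allI impI)
    fix P assume "eventually P (Lp_at M p f)"
    then have "\<exists>e\<in>{0<..}. eventually P (principal (?S e))"
      unfolding Lp_at_def
    proof (subst (asm) eventually_INF_base)
      fix a b :: real assume "a \<in> {0<..}" "b \<in> {0<..}"
      then show "\<exists>x\<in>{0<..}. principal (?S x) \<le> inf (principal (?S a)) (principal (?S b))"
        by (intro bexI[of _ "min a b"]) auto
    qed auto
    then obtain e where "0 < e" "\<forall>g\<in>?S e. P g" by (auto simp: eventually_principal)
    then show "\<exists>g. P g" using ne[of e] by blast
  qed
  then show ?thesis by (auto simp: trivial_limit_def)
qed

text \<open>\<open>Phi\<close> falls at most quadratically near f. With b = <J f, g>, its decrease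
  is at most (l + 2) (b - 1) from the norm term, minus l (b - 1) from the energy, plus a quadratic
  error. The linear part 2 (b - 1) is at most 0 because the domain of \<open>Phi\<close> lies in the
  unit ball.\<close>

lemma critical_points_subset_critical_set:
  assumes l: "c powr p = l"
  shows "critical_points c \<subseteq> critical_set M p l"
proof
  fix f assume f: "f \<in> critical_points c"
  then have fD: "f \<in> slope_dom" "N f = 1" "slope f = c" by (auto simp: critical_points_def)
  have fE: "f \<in> E" using fD(1) by (rule slope_dom_Lp)
  have l0: "0 \<le> l" using l by auto
  have ch: "cheeger M p f = ereal (l / p)" by (rule critical_points_cheeger[OF f l])
  have Phif: "Phi M p l f = ereal (l / p - (l + 2) / p)"
    using ch fD(2) p_pos by (simp add: Phi_def Let_def divide_right_mono)
  let ?d = "\<lambda>g. N (\<lambda>x. g x - f x)"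
  let ?Q = "\<lambda>g. max 0 (Phi M p l f - Phi M p l g) / ereal (Lp_dist M p g f)"
  \<comment> \<open>The remainder constant of \<open>N_expansion\<close> for distances at most 1,
    times (l + 2)/p.\<close>
  define C where "C = (l + 2) * (p - 1) * 2 powr (p - 2)"
  have C: "0 \<le> C" using l0 p_pos by (simp add: C_def)
  have diff: "Phi M p l f - Phi M p l g \<le> ereal (C * (?d g)\<^sup>2)" if g: "g \<in> E" "?d g \<le> 1" for g
  proof (cases "N g \<le> 1 \<and> cheeger M p g \<le> ereal ((l + 1) / p)")
    case False
    then show ?thesis using Phif by (auto simp: Phi_def Let_def)
  next
    case True
    then have gD: "g \<in> slope_dom" by (auto simp: cheeger_eq split: if_splits)
    define b where "b = (\<integral>x. J f x * g x \<partial>M)"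
    have "\<bar>b\<bar> \<le> N g" using J_Hoelder[OF fE g(1)] fD(2) by (simp add: b_def)
    then have "b \<le> 1" using conjunct1[OF True] by linarith
    have Jd: "(\<integral>x. J f x * (g x - f x) \<partial>M) = b - 1"
      using J_integrable[OF fE g(1)] J_integrable[OF fE fE] fD(2) by (simp add: right_diff_distrib J_self b_def)
    have "N g powr p \<le> 1 + p * (b - 1) + p * (p - 1) * ((1 + ?d g) powr (p - 2) * (?d g)\<^sup>2)"
      using N_expansion[OF fE Lp_diff[OF g(1) fE]] fD(2) Jd by simp
    also have "\<dots> \<le> 1 + p * (b - 1) + p * (p - 1) * (2 powr (p - 2) * (?d g)\<^sup>2)"
      using g(2) two_le_p by (intro add_left_mono mult_left_mono mult_right_mono powr_mono2) auto
    finally have "N g powr p - 1 \<le> p * ((b - 1) + (p - 1) * (2 powr (p - 2) * (?d g)\<^sup>2))"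
      by (simp add: algebra_simps)
    then have "(l + 2) / p * (N g powr p - 1) \<le> (l + 2) / p * (p * ((b - 1) + (p - 1) * (2 powr (p - 2) * (?d g)\<^sup>2)))"
      using l0 p_pos by (intro mult_left_mono) auto
    also have "\<dots> = (l + 2) * ((b - 1) + (p - 1) * (2 powr (p - 2) * (?d g)\<^sup>2))" using p_pos by simp
    also have "\<dots> = (l + 2) * (b - 1) + C * (?d g)\<^sup>2" by (simp add: C_def algebra_simps)
    also have "(l + 2) * (b - 1) \<le> l * (b - 1)" using \<open>b \<le> 1\<close> by (intro mult_right_mono_neg) auto
    finally have 1: "(l + 2) / p * (N g powr p - 1) \<le> l * (b - 1) + C * (?d g)\<^sup>2" by simp
    have "l / p + l * (b - 1) \<le> slope g powr p / p"
      using cheeger_subgradient[OF f l gD] by (simp add: b_def)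
    then have "l / p - (l + 2) / p - (slope g powr p / p - (l + 2) / p * N g powr p) \<le> C * (?d g)\<^sup>2"
      using 1 by (simp add: right_diff_distrib)
    moreover have "Phi M p l g = ereal (slope g powr p / p - (l + 2) / p * N g powr p)"
      using True gD by (simp add: Phi_def Let_def cheeger_eq)
    ultimately show ?thesis using Phif by simp
  qed
  have Q: "?Q g \<le> ereal (C * ?d g)" if g: "g \<in> E" "?d g \<le> 1" "0 < ?d g" for g
  proof -
    have "max 0 (Phi M p l f - Phi M p l g) \<le> ereal (C * (?d g)\<^sup>2)"
      using diff[OF g(1,2)] C by simp
    then have "?Q g \<le> ereal (C * (?d g)\<^sup>2) / ereal (?d g)"
      unfolding Lp_dist_def using g(3) by (intro ereal_divide_right_mono) auto
    also have "\<dots> = ereal (C * ?d g)" using g(3) by (simp add: power2_eq_square)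
    finally show ?thesis .
  qed
  have "Limsup (Lp_at M p f) ?Q \<le> 0"
  proof (rule ereal_le_epsilon2)
    fix e :: real assume e: "0 < e"
    have "\<forall>\<^sub>F g in Lp_at M p f. ?Q g \<le> ereal e"
    proof (rule eventually_Lp_atI)
      show "0 < min 1 (e / (C + 1))" using e C by simp
      fix g assume g: "g \<in> E" "0 < ?d g" "?d g < min 1 (e / (C + 1))"
      have "C * ?d g \<le> (C + 1) * ?d g" using g by (intro mult_right_mono) auto
      also have "\<dots> \<le> e" using g C by (simp add: field_simps)
      finally have "C * ?d g \<le> e" .
      then show "?Q g \<le> ereal e" using Q[of g] g by (auto intro: order_trans)
    qed
    then show "Limsup (Lp_at M p f) ?Q \<le> 0 + ereal e" using Limsup_bounded by fastforce
  qed
  moreover have "0 \<le> Limsup (Lp_at M p f) ?Q"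
    using Lp_at_nontrivial[OF fE fD(2)]
    by (rule le_Limsup) (auto intro!: always_eventually zero_le_divide_ereal)
  ultimately have "Limsup (Lp_at M p f) ?Q = 0" by (rule antisym)
  then have "descending_slope M p (Phi M p l) f = 0"
    using Phif by (simp add: descending_slope_def)
  then show "f \<in> critical_set M p l"
    using ch fD(2) fE by (simp add: critical_set_def Lp_sphere_def)
qed

end

section \<open>The minmax argument\<close>

locale compact_Lp_metric_space = Lp_metric_space M p for M :: "'a::metric_space measure" and p +
  assumes compact_embedding: "compactly_embedded M p"
begin

lemma prox_gap:
  assumes Z: "closedin T Z" and disj: "Z \<inter> critical_points c = {}"
  obtains e where "0 < e"
    "\<And>f g. f \<in> Z \<Longrightarrow> f \<in> slope_dom \<Longrightarrow> N f = 1 \<Longrightarrow> slope f \<le> c + e \<Longrightarrow> is_prox f g \<Longrightarrow> slope g < (c - e) * N g"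
proof (rule ccontr)
  assume "\<not> thesis"
  let ?e = "\<lambda>n. 1 / real (Suc n)"
  have "\<exists>f. f \<in> Z \<and> f \<in> slope_dom \<and> N f = 1 \<and> slope f \<le> c + ?e n \<and> (\<exists>g. is_prox f g \<and> (c - ?e n) * N g \<le> slope g)" for n
  proof (rule ccontr)
    assume "\<not> ?thesis"
    then have "f \<in> Z \<Longrightarrow> f \<in> slope_dom \<Longrightarrow> N f = 1 \<Longrightarrow> slope f \<le> c + ?e n \<Longrightarrow> is_prox f g \<Longrightarrow> slope g < (c - ?e n) * N g"
      for f g by (meson not_le)
    then show False using \<open>\<not> thesis\<close> that[of "?e n"] by simp
  qed
  then have "\<exists>u. \<forall>n. u n \<in> Z \<and> u n \<in> slope_dom \<and> N (u n) = 1 \<and> slope (u n) \<le> c + ?e n \<and> (\<exists>g. is_prox (u n) g \<and> (c - ?e n) * N g \<le> slope g)"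
    by (intro choice allI)
  then obtain u where u: "\<And>n. u n \<in> Z" "\<And>n. u n \<in> slope_dom" "\<And>n. N (u n) = 1" "\<And>n. slope (u n) \<le> c + ?e n"
    and "\<And>n. \<exists>g. is_prox (u n) g \<and> (c - ?e n) * N g \<le> slope g" by blast
  from this(5) have "\<exists>b. \<forall>n. is_prox (u n) (b n) \<and> (c - ?e n) * N (b n) \<le> slope (b n)" by (intro choice allI)
  then obtain b where b: "\<And>n. is_prox (u n) (b n)" "\<And>n. (c - ?e n) * N (b n) \<le> slope (b n)" by blast
  have uc: "slope (u n) \<le> c + 1" for n using u(4)[of n] by (rule order_trans) simp
  have uN: "N (u n) \<le> 1" for n by (simp add: u(3))
  obtain r f where r: "strict_mono (r :: nat \<Rightarrow> nat)" and fD: "f \<in> slope_dom" and lim: "converges (\<lambda>n. u (r n)) f"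
    by (rule slope_compact[OF compact_embedding u(2) uN uc])
  have fE: "f \<in> E" using fD by (rule slope_dom_Lp)
  have uE: "u n \<in> E" for n using u(2) by (rule slope_dom_Lp)
  have e0: "(\<lambda>n. ?e (r n)) \<longlonglongrightarrow> 0"
    using LIMSEQ_subseq_LIMSEQ[OF LIMSEQ_Suc[OF lim_1_over_n] r] by (simp add: comp_def)
  have "(\<lambda>n. c + ?e (r n)) \<longlonglongrightarrow> c + 0" by (intro tendsto_add tendsto_const e0)
  then have "(\<lambda>n. c + ?e (r n)) \<longlonglongrightarrow> c" by simp
  from slope_lower_semicontinuous(2)[OF u(2) u(4) this fE lim] have sf: "slope f \<le> c" .
  have "(\<lambda>n. N (u (r n))) \<longlonglongrightarrow> N f" by (rule N_tendsto[OF uE fE lim])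
  then have Nf: "N f = 1" unfolding u(3) by (simp add: LIMSEQ_const_iff)
  have fZ: "f \<in> Z" by (rule closedin_limit[OF Z u(1) fE lim])
  obtain g where g: "is_prox f g" by (rule prox_exists[OF fE])
  have conv: "converges (\<lambda>n. b (r n)) g" by (rule prox_continuous(1)[OF uE fE lim b(1) g])
  obtain a where a: "\<And>n. slope (b (r n)) \<le> a n" "a \<longlonglongrightarrow> slope g"
    using prox_continuous(2)[OF uE fE lim b(1) g] by blast
  have "(\<lambda>n. N (b (r n))) \<longlonglongrightarrow> N g"
    by (intro N_tendsto conv slope_dom_Lp is_proxD(1)[OF b(1)] is_proxD(1)[OF g])
  then have "(\<lambda>n. (c - ?e (r n)) * N (b (r n))) \<longlonglongrightarrow> (c - 0) * N g" by (intro tendsto_mult tendsto_diff tendsto_const e0)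
  then have "(c - 0) * N g \<le> slope g"
    by (rule LIMSEQ_le[OF _ a(2)]) (use b(2) a(1) order_trans in blast)
  then have "f \<in> critical_points c" using prox_imp_critical[OF fD Nf sf g] by simp
  then show False using fZ disj by blast
qed

text \<open>The normalized proximal map is the deformation of the minmax argument: since the genus only
  asks for odd continuous maps, no homotopy to the identity is needed.\<close>

definition descent :: "('a \<Rightarrow> real) \<Rightarrow> 'a \<Rightarrow> real" where
  "descent f = (let g = (SOME g. is_prox f g) in (\<lambda>x. 1 / N g * g x))"

lemma descentE:
  assumes f: "f \<in> slope_dom" "N f = 1"
  obtains g where "is_prox f g" "0 < N g" "descent f = (\<lambda>x. 1 / N g * g x)"
proof -
  define g where "g = (SOME g. is_prox f g)"
  have "\<exists>g. is_prox f g" by (rule prox_exists[OF slope_dom_Lp[OF f(1)]]) blast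
  then have "is_prox f g" unfolding g_def by (rule someI_ex)
  moreover have "descent f = (\<lambda>x. 1 / N g * g x)" by (simp add: descent_def Let_def g_def)
  ultimately show thesis using that prox_nonzero[OF f] by blast
qed

lemma descent_dom:
  assumes f: "f \<in> slope_dom" "N f = 1"
  shows "descent f \<in> slope_dom" "N (descent f) = 1"
proof -
  obtain g where g: "is_prox f g" "0 < N g" "descent f = (\<lambda>x. 1 / N g * g x)" by (rule descentE[OF f])
  show "descent f \<in> slope_dom" unfolding g(3) by (intro slope_cmult_le is_proxD(1)[OF g(1)])
  show "N (descent f) = 1" unfolding g(3) N_cmult using g(2) by simp
qed

text \<open>The arbitrary choices inside \<open>descent\<close> do no harm, since
  \<open>prox_continuous\<close> holds for any proximal points; the normalization is continuous
  because the limit has positive norm.\<close>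

lemma descent_continuous:
  assumes u: "\<And>n. u n \<in> slope_dom" "\<And>n. N (u n) = 1" and f: "f \<in> slope_dom" "N f = 1" and lim: "converges u f"
  shows "converges (\<lambda>n. descent (u n)) (descent f)"
proof -
  obtain g where g: "is_prox f g" "0 < N g" "descent f = (\<lambda>x. 1 / N g * g x)" by (rule descentE[OF f])
  have "\<exists>b. is_prox (u n) b \<and> 0 < N b \<and> descent (u n) = (\<lambda>x. 1 / N b * b x)" for n
    by (rule descentE[OF u, of n]) blast
  then have "\<exists>b. \<forall>n. is_prox (u n) (b n) \<and> 0 < N (b n) \<and> descent (u n) = (\<lambda>x. 1 / N (b n) * b n x)"
    by (intro choice allI)
  then obtain b where b: "\<And>n. is_prox (u n) (b n)" "\<And>n. 0 < N (b n)" "\<And>n. descent (u n) = (\<lambda>x. 1 / N (b n) * b n x)"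
    by blast
  have bE: "b n \<in> E" for n by (intro slope_dom_Lp is_proxD(1)[OF b(1)])
  have gE: "g \<in> E" by (intro slope_dom_Lp is_proxD(1)[OF g(1)])
  have conv: "converges b g" by (rule prox_continuous(1)[OF slope_dom_Lp[OF u(1)] slope_dom_Lp[OF f(1)] lim b(1) g(1)])
  have Nlim: "(\<lambda>n. N (b n)) \<longlonglongrightarrow> N g" by (rule N_tendsto[OF bE gE conv])
  have le: "N (\<lambda>x. descent (u n) x - descent f x) \<le> 1 / N (b n) * N (\<lambda>x. b n x - g x) + \<bar>1 / N (b n) - 1 / N g\<bar> * N g" for n
  proof -
    have eq: "(\<lambda>x. descent (u n) x - descent f x) = (\<lambda>x. 1 / N (b n) * (b n x - g x) + (1 / N (b n) - 1 / N g) * g x)"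
      unfolding b(3) g(3) by (auto simp: algebra_simps diff_divide_distrib)
    have "N (\<lambda>x. descent (u n) x - descent f x) \<le> N (\<lambda>x. 1 / N (b n) * (b n x - g x)) + N (\<lambda>x. (1 / N (b n) - 1 / N g) * g x)"
      unfolding eq by (intro N_add_le Lp_cmult Lp_diff bE gE)
    also have "\<dots> = \<bar>1 / N (b n)\<bar> * N (\<lambda>x. b n x - g x) + \<bar>1 / N (b n) - 1 / N g\<bar> * N g"
      by (simp only: N_cmult)
    also have "\<bar>1 / N (b n)\<bar> = 1 / N (b n)" by simp
    finally show ?thesis .
  qed
  have "(\<lambda>n. 1 / N (b n) * N (\<lambda>x. b n x - g x) + \<bar>1 / N (b n) - 1 / N g\<bar> * N g) \<longlonglongrightarrow> 1 / N g * 0 + \<bar>1 / N g - 1 / N g\<bar> * N g"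
    using g(2) by (intro tendsto_intros Nlim conv) auto
  then have lim0: "(\<lambda>n. 1 / N (b n) * N (\<lambda>x. b n x - g x) + \<bar>1 / N (b n) - 1 / N g\<bar> * N g) \<longlonglongrightarrow> 0" by simp
  show ?thesis
    by (rule tendsto_sandwich[OF _ _ tendsto_const lim0]) (intro always_eventually allI Lp_norm_nonneg le)+
qed

text \<open>Oddness holds up to null sets, since \<open>SOME\<close> may choose unrelated
  representatives for f and -f.\<close>

lemma descent_uminus:
  assumes f: "f \<in> slope_dom" "N f = 1"
  shows "N (\<lambda>x. descent (\<lambda>x. - f x) x - - descent f x) = 0"
proof -
  have mf: "(\<lambda>x. - f x) \<in> slope_dom" "N (\<lambda>x. - f x) = 1" using f slope_uminus by (auto simp: N_uminus)
  obtain g where g: "is_prox f g" "0 < N g" "descent f = (\<lambda>x. 1 / N g * g x)" by (rule descentE[OF f])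
  obtain k where k: "is_prox (\<lambda>x. - f x) k" "0 < N k" "descent (\<lambda>x. - f x) = (\<lambda>x. 1 / N k * k x)"
    by (rule descentE[OF mf])
  have kE: "k \<in> E" "g \<in> E" by (intro slope_dom_Lp is_proxD(1)[OF k(1)] is_proxD(1)[OF g(1)])+
  have 0: "N (\<lambda>x. k x - - g x) = 0"
    by (rule prox_unique[OF k(1) is_prox_uminus[OF g(1)] slope_dom_Lp[OF mf(1)]])
  have "N k = N (\<lambda>x. - g x)" by (rule N_cong[OF kE(1) Lp_uminus[OF kE(2)] 0])
  then have Nk: "N k = N g" by (simp add: N_uminus)
  have "(\<lambda>x. descent (\<lambda>x. - f x) x - - descent f x) = (\<lambda>x. 1 / N g * (k x - - g x))"
    unfolding g(3) k(3) Nk by (auto simp: algebra_simps add_divide_distrib)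
  then show ?thesis by (simp only: N_cmult 0 mult_zero_right)
qed

section \<open>Genus of the critical points\<close>

lemma minmax_level_nonneg:
  assumes "1 \<le> k" "minmax_level M p k = ereal l"
  shows "0 \<le> l"
proof -
  have "0 \<le> minmax_level M p k" unfolding minmax_level_def
  proof (rule INF_greatest)
    fix A assume A: "A \<in> genus_family M p k"
    \<comment> \<open>A supremum over the empty set would be -\<infinity>.\<close>
    have "A \<noteq> {}"
    proof
      assume "A = {}"
      then have "enat k \<le> 0" using A by (simp add: genus_family_def genus_def)
      then show False using assms(1) by (simp add: zero_enat_def)
    qed
    then obtain f where f: "f \<in> A" by blast
    have "0 \<le> ereal p * cheeger M p f" using p_pos by (auto simp: cheeger_eq)
    also have "\<dots> \<le> (SUP f\<in>A. ereal p * cheeger M p f)" using f by (rule SUP_upper)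
    finally show "0 \<le> (SUP f\<in>A. ereal p * cheeger M p f)" .
  qed
  then show ?thesis using assms(2) by simp
qed

text \<open>An almost optimal set is split along the zeros of the extended map H. On the zeros,
  descent goes below the critical level and j < k coordinates suffice; elsewhere H itself is nonzero
  in m < n coordinates.\<close>

lemma genus_critical_points:
  assumes k: "1 \<le> k" and n: "1 \<le> n" and level: "\<And>j. j < n \<Longrightarrow> minmax_level M p (k + j) = ereal l"
    and c0: "0 \<le> c" and c: "c powr p = l"
  shows "enat n \<le> genus M p (critical_points c)"
proof (rule ccontr)
  assume "\<not> ?thesis"
  then have "genus M p (critical_points c) < enat n" by simp
  then obtain m h where m: "m < n" and h: "odd_map_to_punctured M p (critical_points c) m h"
    using genus_less_iff[OF critical_points_subset, of n c] n by auto
  have symK: "fun_symmetric (critical_points c)" by (intro fun_symmetricI critical_points_uminus)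
  obtain H where Hc: "\<And>u f i. (\<And>n::nat. u n \<in> E) \<Longrightarrow> f \<in> E \<Longrightarrow> converges u f \<Longrightarrow> (\<lambda>n. H (u n) i) \<longlonglongrightarrow> H f i"
    and Ho: "\<And>f i. H (\<lambda>x. - f x) i = - H f i" and Hm: "\<And>f i. m \<le> i \<Longrightarrow> H f i = (0::real)"
    and Hh: "\<And>f. f \<in> critical_points c \<Longrightarrow> H f = h f"
    by (rule odd_extension[OF closedin_critical_points h symK]) blast
  \<comment> \<open>On critical points H agrees with h and cannot vanish, so \<open>prox_gap\<close>
    applies to Z.\<close>
  define Z where "Z = {f \<in> E. \<forall>i. H f i = 0}"
  have Z: "closedin T Z"
  proof (rule closedin_sequentialI)
    fix u f assume u: "\<And>n::nat. u n \<in> Z" and f: "f \<in> E" and lim: "converges u f"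
    have "H f i = 0" for i
    proof -
      have "(\<lambda>n. H (u n) i) \<longlonglongrightarrow> H f i" using u by (intro Hc f lim) (simp add: Z_def)
      moreover have "H (u n) i = 0" for n using u[of n] by (simp add: Z_def)
      ultimately show ?thesis by (simp add: LIMSEQ_const_iff)
    qed
    then show "f \<in> Z" using f by (simp add: Z_def)
  qed (auto simp: Z_def)
  have "Z \<inter> critical_points c = {}"
  proof (intro equals0I, elim IntE)
    fix f assume "f \<in> Z" and f: "f \<in> critical_points c"
    then have "h f = (\<lambda>i. 0)" using Hh[OF f] by (auto simp: Z_def)
    then show False using odd_map_to_puncturedD(3)[OF critical_points_subset h f] by simp
  qed
  then obtain e where e: "0 < e"
    and gap: "\<And>f g. f \<in> Z \<Longrightarrow> f \<in> slope_dom \<Longrightarrow> N f = 1 \<Longrightarrow> slope f \<le> c + e \<Longrightarrow> is_prox f g \<Longrightarrow> slope g < (c - e) * N g"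
    using prox_gap[OF Z] by blast
  have "ereal l < ereal ((c + e) powr p)"
    unfolding c[symmetric] using c0 e p_pos by (simp add: powr_less_mono2)
  \<comment> \<open>A is taken at the last of the n levels; the contradiction for its descended part
    will arise at the first.\<close>
  then have "minmax_level M p (k + (n - 1)) < ereal ((c + e) powr p)" using level[of "n - 1"] n by simp
  then obtain A where A: "A \<in> genus_family M p (k + (n - 1))"
    and supA: "(SUP f\<in>A. ereal p * cheeger M p f) < ereal ((c + e) powr p)"
    unfolding minmax_level_def INF_less_iff by blast
  have Acl: "closedin T A" and Asym: "fun_symmetric A" and AS: "A \<subseteq> Lp_sphere M p"
    and Ag: "enat (k + (n - 1)) \<le> genus M p A" using A by (auto simp: genus_family_def)
  have AE: "A \<subseteq> E" using AS by (auto simp: Lp_sphere_def)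
  have AD: "f \<in> slope_dom" "N f = 1" "slope f \<le> c + e" if f: "f \<in> A" for f
  proof -
    have "ereal p * cheeger M p f < ereal ((c + e) powr p)"
      using SUP_upper[OF f, of "\<lambda>f. ereal p * cheeger M p f"] supA by (rule le_less_trans)
    then have *: "f \<in> slope_dom" "slope f powr p < (c + e) powr p"
      using p_pos by (auto simp: cheeger_eq split: if_splits)
    then show "f \<in> slope_dom" by simp
    show "N f = 1" using f AS by (auto simp: Lp_sphere_def)
    show "slope f \<le> c + e"
      using * powr_le_powr_iff[of p "slope f" "c + e"] slope_nonneg[OF *(1)] c0 e p_pos by simp
  qed
  define C where "C = A \<inter> Z"
  have Ccl: "closedin T C" unfolding C_def by (intro closedin_Int Acl Z)
  have CA: "C \<subseteq> A" by (auto simp: C_def)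
  have CE: "C \<subseteq> E" using CA AE by blast
  have Cneg: "(\<lambda>x. - f x) \<in> C" if "f \<in> C" for f
    using that fun_symmetricD[OF Asym, of f] by (auto simp: C_def Z_def Ho Lp_uminus)
  have dE: "descent f \<in> E" if "f \<in> C" for f using that CA AD by (intro slope_dom_Lp descent_dom) auto
  have ds: "slope (descent f) < c - e" if f: "f \<in> C" for f
  proof -
    have fA: "f \<in> A" "f \<in> Z" using f by (auto simp: C_def)
    obtain g where g: "is_prox f g" "0 < N g" "descent f = (\<lambda>x. 1 / N g * g x)"
      by (rule descentE[OF AD(1,2)[OF fA(1)]])
    have "slope (descent f) = 1 / N g * slope g"
      unfolding g(3) using slope_cmult[OF is_proxD(1)[OF g(1)], of "1 / N g"] g(2) by simp
    also have "\<dots> < 1 / N g * ((c - e) * N g)"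
      using gap[OF fA(2) AD[OF fA(1)] g(1)] g(2) by (intro mult_strict_left_mono) auto
    finally show ?thesis using g(2) by simp
  qed
  \<comment> \<open>The image of C, saturated under null modifications: a closed set contains with a
    function all functions at distance 0.\<close>
  define B where "B = {g \<in> E. \<exists>f\<in>C. N (\<lambda>x. g x - descent f x) = 0}"
  have BE: "B \<subseteq> E" by (auto simp: B_def)
  have dB: "descent f \<in> B" if "f \<in> C" for f using that dE by (auto simp: B_def N_zero intro!: bexI[of _ f])
  have Bneg: "(\<lambda>x. - g x) \<in> B" if g: "g \<in> B" for g
  proof -
    obtain f where f: "f \<in> C" "N (\<lambda>x. g x - descent f x) = 0" "g \<in> E" using g by (auto simp: B_def)
    have 1: "N (\<lambda>x. - g x - - descent f x) = 0" using f(2) N_uminus[of "\<lambda>x. g x - descent f x"] by simp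
    have 2: "N (\<lambda>x. - descent f x - descent (\<lambda>x. - f x) x) = 0"
      using descent_uminus[of f] AD f(1) CA N_diff_commute[of "descent (\<lambda>x. - f x)" "\<lambda>x. - descent f x"] by auto
    have "N (\<lambda>x. - g x - descent (\<lambda>x. - f x) x)
        \<le> N (\<lambda>x. - g x - - descent f x) + N (\<lambda>x. - descent f x - descent (\<lambda>x. - f x) x)"
      using f(1,3) dE Cneg by (intro N_triangle Lp_uminus) auto
    then have "N (\<lambda>x. - g x - descent (\<lambda>x. - f x) x) = 0"
      using 1 2 Lp_norm_nonneg[of M p "\<lambda>x. - g x - descent (\<lambda>x. - f x) x"] by linarith
    then show ?thesis using f(3) Cneg[OF f(1)] Lp_uminus by (auto simp: B_def)
  qed
  have BS: "B \<subseteq> Lp_sphere M p"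
  proof
    fix g assume "g \<in> B"
    then obtain f where f: "f \<in> C" "N (\<lambda>x. g x - descent f x) = 0" "g \<in> E" by (auto simp: B_def)
    have "N g = N (descent f)" by (rule N_cong[OF f(3) dE[OF f(1)] f(2)])
    also have "\<dots> = 1" using AD f(1) CA by (intro descent_dom) auto
    finally show "g \<in> Lp_sphere M p" using f(3) by (simp add: Lp_sphere_def)
  qed
  have Bcl: "closedin T B"
  proof (rule closedin_sequentialI[OF BE])
    fix v g assume v: "\<And>n::nat. v n \<in> B" and g: "g \<in> E" and lim: "converges v g"
    have "\<exists>f. f \<in> C \<and> N (\<lambda>x. v n x - descent f x) = 0" for n using v[of n] by (auto simp: B_def)
    then have "\<exists>u. \<forall>n. u n \<in> C \<and> N (\<lambda>x. v n x - descent (u n) x) = 0" by (intro choice allI)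
    then obtain u where u: "\<And>n. u n \<in> C" "\<And>n. N (\<lambda>x. v n x - descent (u n) x) = 0" by blast
    have uD: "u n \<in> slope_dom" "N (u n) = 1" "slope (u n) \<le> c + e" for n using u(1)[of n] CA AD by auto
    have uN: "N (u n) \<le> 1" for n by (simp add: uD(2))
    \<comment> \<open>C lies in a slope sublevel set of the unit sphere, so the preimages
      subconverge; this compactness is what makes the image closed.\<close>
    obtain r f where r: "strict_mono (r :: nat \<Rightarrow> nat)" and f: "f \<in> slope_dom" and flim: "converges (\<lambda>n. u (r n)) f"
      by (rule slope_compact[OF compact_embedding uD(1) uN uD(3)])
    have fC: "f \<in> C" by (rule closedin_limit[OF Ccl u(1) slope_dom_Lp[OF f] flim])
    have dlim: "converges (\<lambda>n. descent (u (r n))) (descent f)"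
      by (rule descent_continuous[OF uD(1) uD(2) f AD(2) flim]) (use fC CA in auto)
    have dle: "N (\<lambda>x. v (r n) x - descent f x) \<le> N (\<lambda>x. descent (u (r n)) x - descent f x)" for n
      using N_triangle[of "v (r n)" "descent (u (r n))" "descent f"] u v BE dE fC by (metis add_0 subsetD)
    have 1: "converges (\<lambda>n. v (r n)) (descent f)"
      by (rule tendsto_sandwich[OF _ _ tendsto_const dlim]) (intro always_eventually allI Lp_norm_nonneg dle)+
    have "converges (\<lambda>n. v (r n)) g" using LIMSEQ_subseq_LIMSEQ[OF lim r] by (simp add: comp_def)
    then have "N (\<lambda>x. g x - descent f x) = 0"
      using converges_unique[of "\<lambda>n. v (r n)" g "descent f"] 1 v BE g dE[OF fC] by auto
    then show "g \<in> B" using g fC by (auto simp: B_def)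
  qed
  have Bsym: "fun_symmetric B" by (intro fun_symmetricI Bneg)
  have "genus M p B < enat k"
  proof (rule ccontr)
    assume "\<not> ?thesis"
    then have Bg: "enat k \<le> genus M p B" by simp
    \<comment> \<open>Nonemptiness yields a point with slope below c - e, hence c - e >= 0 and
      strict monotonicity of z^p applies at the end.\<close>
    then have "B \<noteq> {}" using k by (auto simp: genus_def zero_enat_def)
    then obtain f where "f \<in> C" by (auto simp: B_def)
    then have ce: "0 \<le> c - e" using ds[of f] slope_nonneg[OF descent_dom(1)] AD CA by fastforce
    have "B \<in> genus_family M p k" using Bcl Bsym BS Bg by (simp add: genus_family_def)
    then have "minmax_level M p k \<le> (SUP g\<in>B. ereal p * cheeger M p g)"
      unfolding minmax_level_def by (rule INF_lower)
    also have "\<dots> \<le> ereal ((c - e) powr p)"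
    proof (rule SUP_least)
      fix g assume "g \<in> B"
      then obtain f where f: "f \<in> C" "N (\<lambda>x. g x - descent f x) = 0" "g \<in> E" by (auto simp: B_def)
      have dD: "descent f \<in> slope_dom" using f(1) CA AD by (intro descent_dom) auto
      have "converges (\<lambda>_. descent f) g" using f(2) by (simp add: N_diff_commute)
      then have gD: "g \<in> slope_dom" "slope g \<le> slope (descent f)"
        using slope_lower_semicontinuous[OF dD order_refl tendsto_const f(3)] by auto
      then have "slope g powr p \<le> (c - e) powr p"
        using ds[OF f(1)] slope_nonneg p_pos by (intro powr_mono2) auto
      then show "ereal p * cheeger M p g \<le> ereal ((c - e) powr p)"
        using gD p_pos by (simp add: cheeger_eq)
    qed
    finally have "l \<le> (c - e) powr p" using level[of 0] n by simp
    moreover have "(c - e) powr p < c powr p" using ce e p_pos by (intro powr_less_mono2) auto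
    ultimately show False using c by simp
  qed
  then obtain j \<phi> where j: "j < k" and \<phi>: "odd_map_to_punctured M p B j \<phi>"
    using genus_less_iff[OF BE, of k] k by auto
  note \<phi>D = odd_map_to_puncturedD[OF BE \<phi>]
  \<comment> \<open>The composite is exactly odd although \<open>descent\<close> is odd only up to
    null sets, because \<phi> identifies functions at distance 0.\<close>
  have \<psi>: "odd_map_to_punctured M p C j (\<lambda>f. \<phi> (descent f))"
  proof (rule odd_map_to_puncturedI[OF CE])
    fix u f i assume u: "\<And>n::nat. u n \<in> C" and f: "f \<in> C" and lim: "converges u f"
    have "converges (\<lambda>n. descent (u n)) (descent f)"
      using u f CA AD by (intro descent_continuous lim) auto
    then show "(\<lambda>n. \<phi> (descent (u n)) i) \<longlonglongrightarrow> \<phi> (descent f) i"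
      by (intro continuous_map_limit_sequence[OF BE \<phi>D(1)] dB u f)
  next
    fix f i assume f: "f \<in> C"
    have "N (\<lambda>x. descent (\<lambda>x. - f x) x - - descent f x) = 0" using f CA AD by (intro descent_uminus) auto
    then have "\<phi> (descent (\<lambda>x. - f x)) = \<phi> (\<lambda>x. - descent f x)"
      by (intro odd_map_congruent[OF BE \<phi>] dB Cneg Bneg f)
    then show "\<phi> (descent (\<lambda>x. - f x)) i = - \<phi> (descent f) i" using \<phi>D(4)[OF dB[OF f]] by simp
  qed (use \<phi>D(2,3) dB in auto)
  obtain G where Gc: "\<And>u f i. (\<And>n::nat. u n \<in> E) \<Longrightarrow> f \<in> E \<Longrightarrow> converges u f \<Longrightarrow> (\<lambda>n. G (u n) i) \<longlonglongrightarrow> G f i"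
    and Go: "\<And>f i. G (\<lambda>x. - f x) i = - G f i" and Gm: "\<And>f i. j \<le> i \<Longrightarrow> G f i = (0::real)"
    and Gh: "\<And>f. f \<in> C \<Longrightarrow> G f = \<phi> (descent f)"
    by (rule odd_extension[OF Ccl \<psi> fun_symmetricI[OF Cneg]]) blast+
  \<comment> \<open>The coordinates of G follow those of H, shifted by m. G is nonzero on C, which
    is the part of A where H vanishes.\<close>
  have "odd_map_to_punctured M p A (m + j) (\<lambda>f i. if i < m then H f i else G f (i - m))"
  proof (rule odd_map_to_puncturedI[OF AE])
    fix u f i assume u: "\<And>n::nat. u n \<in> A" and f: "f \<in> A" and lim: "converges u f"
    have uf: "\<And>n. u n \<in> E" "f \<in> E" using u f AE by auto
    show "(\<lambda>n. if i < m then H (u n) i else G (u n) (i - m)) \<longlonglongrightarrow> (if i < m then H f i else G f (i - m))"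
      using Hc[OF uf lim, of i] Gc[OF uf lim, of "i - m"] by simp
  next
    fix f assume f: "f \<in> A"
    show "(\<lambda>i. if i < m then H f i else G f (i - m)) \<noteq> (\<lambda>i. 0)"
    proof (cases "f \<in> Z")
      case True
      then have fC: "f \<in> C" using f by (simp add: C_def)
      then have "G f \<noteq> (\<lambda>i. 0)" using Gh \<phi>D(3)[OF dB] by simp
      then obtain i where "G f i \<noteq> 0" by auto
      then have "(if m + i < m then H f (m + i) else G f (m + i - m)) \<noteq> 0" by simp
      then show ?thesis by meson
    next
      case False
      then obtain i where i: "H f i \<noteq> 0" using f AE by (auto simp: Z_def)
      then have "i < m" using Hm[of i f] by (meson not_le)
      then have "(if i < m then H f i else G f (i - m)) \<noteq> 0" using i by simp
      then show ?thesis by meson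
    qed
  qed (auto simp: Gm Ho Go)
  \<comment> \<open>From m <= n - 1 and j <= k - 1 the total is at most k + n - 2.\<close>
  moreover have "m + j < k + (n - 1)" using m j by simp
  ultimately have "genus M p A < enat (k + (n - 1))" using genus_less_iff[OF AE, of "k + (n - 1)"] k by auto
  then show False using Ag by simp
qed

lemma exists_critical_points_genus:
  assumes "1 \<le> k" "1 \<le> n" "\<And>j. j < n \<Longrightarrow> minmax_level M p (k + j) = ereal l"
  obtains c where "c powr p = l" "enat n \<le> genus M p (critical_points c)"
proof
  have l: "0 \<le> l" using minmax_level_nonneg[OF assms(1)] assms(3)[of 0] assms(2) by simp
  show *: "(l powr (1 / p)) powr p = l" using l p_pos by (simp add: powr_powr)
  show "enat n \<le> genus M p (critical_points (l powr (1 / p)))"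
    by (rule genus_critical_points[OF assms _ *]) auto
qed

end

theorem theorem1p1:
  fixes M :: "'a::metric_space measure" and p :: real
  assumes "sets M = sets borel"
    and "emeasure M (space M) < \<infinity>"
    and "2 \<le> p"
    and "compactly_embedded M p"
  shows "(\<forall>k\<ge>1. \<forall>l::real. minmax_level M p k = ereal l \<longrightarrow> eigenvalue M p l) \<and>
         (\<forall>k\<ge>1. \<forall>n\<ge>1. \<forall>l::real. (\<forall>j<n. minmax_level M p (k + j) = ereal l) \<longrightarrow>
            enat n \<le> genus M p (critical_set M p l) \<and>
            (n > 1 \<longrightarrow>
               infinite (Lp_class M p ` {f \<in> Lp_sphere M p. eigenfunction M p l f})))"
proof -
  interpret finite_measure M using assms(2) by (intro finite_measureI) auto
  interpret compact_Lp_metric_space M p using assms by unfold_locales auto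
  show ?thesis
  proof (intro conjI allI impI)
    fix k :: nat and l :: real assume k: "1 \<le> k" and l: "minmax_level M p k = ereal l"
    \<comment> \<open>A single level suffices here: genus at least 1 excludes the empty set.\<close>
    obtain c where c: "c powr p = l" "enat 1 \<le> genus M p (critical_points c)"
      by (rule exists_critical_points_genus[OF k order_refl, of l]) (use l in auto)
    then have "critical_points c \<noteq> {}" by (auto simp: genus_def zero_enat_def)
    then show "eigenvalue M p l" using critical_points_eigenfunction c(1) unfolding eigenvalue_def by blast
  next
    fix k n :: nat and l :: real
    assume k: "1 \<le> k" and n: "1 \<le> n" and l: "\<forall>j<n. minmax_level M p (k + j) = ereal l"
    obtain c where c: "c powr p = l" "enat n \<le> genus M p (critical_points c)"
      by (rule exists_critical_points_genus[OF k n, of l]) (use l in auto)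
    \<comment> \<open>Restricting odd maps transfers the bound from \<open>critical_points\<close>,
      where the minmax argument works, to the larger \<open>critical_set\<close>.\<close>
    have "genus M p (critical_points c) \<le> genus M p (critical_set M p l)"
      using critical_points_subset_critical_set[OF c(1)]
      by (rule genus_mono) (auto simp: critical_set_def Lp_sphere_def)
    then show "enat n \<le> genus M p (critical_set M p l)" using c(2) by (rule order_trans[rotated])
    assume n1: "1 < n"
    \<comment> \<open>Finitely many classes would keep the genus below 2, against n >= 2.\<close>
    have "infinite (Lp_class M p ` critical_points c)"
    proof
      assume "finite (Lp_class M p ` critical_points c)"
      then have "genus M p (critical_points c) < enat 2"
        by (intro genus_finite_classes critical_points_subset critical_points_uminus)
          (auto simp: critical_points_def)
      then have "enat n < enat 2" using c(2) by (rule le_less_trans[rotated])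
      then show False using n1 by simp
    qed
    moreover have "critical_points c \<subseteq> {f \<in> Lp_sphere M p. eigenfunction M p l f}"
      using critical_points_eigenfunction[OF _ c(1)] slope_dom_Lp
      by (auto simp: Lp_sphere_def critical_points_def)
    ultimately show "infinite (Lp_class M p ` {f \<in> Lp_sphere M p. eigenfunction M p l f})"
      by (meson finite_subset image_mono)
  qed
qed

end
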